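(* Let $\pi:\mathbb{L}\to M$ be a bundle of Lie algebras with fiber $\mathfrak{k}$ and let $k\in\mathbb{N}=\{0,1,2,\dots\}$ (so $k$ is finite). If $\mathfrak{k}$ is perfect or centerfree, then $\operatorname{Der}(\Gamma^k(\mathbb{L}))\cong\Gamma^k(\operatorname{Der}(\mathbb{L}))$ as Lie algebras.
   Context: All vector spaces and linear maps are over $\mathbb{K}\in\{\mathbb{R},\mathbb{C}\}$. A manifold is smooth, finite-dimensional over $\mathbb{R}$, Hausdorff, paracompact and connected. A Lie algebra $\mathfrak{g}$ is perfect if $[\mathfrak{g},\mathfrak{g}]=\mathfrak{g}$ (linear span of brackets), and centerfree if its center $\mathfrak{z}(\mathfrak{g})$ is $0$. $\operatorname{Der}(\mathfrak{g})$ is the Lie algebra (under commutator) of $\mathbb{K}$-linear derivations of $\mathfrak{g}$. Let $\mathfrak{k}$ be a finite-dimensional Lie algebra over $\mathbb{K}$. A bundle of Lie algebras $\pi:\mathbb{L}\to M$ with fiber $\mathfrak{k}$ is a smooth vector bundle with fiber $\mathfrak{k}$ over a manifold $M$ together with a bundle atlas whose transition maps take values in the Lie group $\operatorname{Aut}(\mathfrak{k})$ of Lie algebra automorphisms; each fiber $\mathbb{L}_x$ carries the Lie bracket for which the bundle charts restrict to Lie algebra isomorphisms $\mathbb{L}_x\to\mathfrak{k}$. $\Gamma^k(\mathbb{L})$ is the Lie algebra of $C^k$-sections of $\mathbb{L}$ with the pointwise bracket $[X,Y](x)=[X(x),Y(x)]$. $\operatorname{Der}(\mathbb{L})$ is the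 smooth subbundle of the vector bundle $\operatorname{Hom}(\mathbb{L},\mathbb{L})$ (with fibers $\operatorname{End}(\mathbb{L}_x)$) whose fiber over $x$ is $\operatorname{Der}(\mathbb{L}_x)$; $\Gamma^k(\operatorname{Der}(\mathbb{L}))$ is the Lie algebra of its $C^k$-sections with pointwise commutator bracket. *)

theory Defs
  imports "HOL-Analysis.Analysis"
begin

section \<open>Lie algebras\<close>

text \<open>
  The ground field is a type \<open>'k\<close> of class \<^class>\<open>real_normed_field\<close>. By the Gelfand--Mazur theorem
  the reals and the complex numbers are the only such fields, up to isomorphism.

  The fiber \<open>\<kk>\<close> is a type, so that the vector space theory of HOL applies to it; the class
  \<^class>\<open>ab_group_add\<close> admits one-element types, hence \<open>\<kk> = 0\<close> is included.
\<close>

locale fin_dim_lie_algebra = vector_space smul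
  for smul :: "'k::real_normed_field \<Rightarrow> 'f::ab_group_add \<Rightarrow> 'f" +
  fixes br :: "'f \<Rightarrow> 'f \<Rightarrow> 'f"
  assumes finite_dimensional: "\<exists>B. finite B \<and> span B = UNIV"
    and br_linear_right: "Vector_Spaces.linear smul smul (\<lambda>y. br x y)"
    and br_linear_left: "Vector_Spaces.linear smul smul (\<lambda>x. br x y)"
    and br_alternating: "br x x = 0"
    and jacobi: "br x (br y z) + br y (br z x) + br z (br x y) = 0"

definition perfect_lie :: "('k::real_normed_field \<Rightarrow> 'f::ab_group_add \<Rightarrow> 'f) \<Rightarrow> ('f \<Rightarrow> 'f \<Rightarrow> 'f) \<Rightarrow> bool"
  where "perfect_lie smul br \<longleftrightarrow> module.span smul {br x y | x y. True} = UNIV"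

definition lie_center :: "('f::ab_group_add \<Rightarrow> 'f \<Rightarrow> 'f) \<Rightarrow> 'f set"
  where "lie_center br = {x. \<forall>y. br x y = 0}"

definition centerfree_lie :: "('f::ab_group_add \<Rightarrow> 'f \<Rightarrow> 'f) \<Rightarrow> bool"
  where "centerfree_lie br \<longleftrightarrow> lie_center br = {0}"

text \<open>
  The fibers of a bundle, the Lie algebras of sections and the derivation algebras live on proper
  subsets of types, whence a structure with an explicit carrier. The zero and the negatives are
  determined by the scalar multiplication.
\<close>

record ('k, 'a) lie_struct =
  lcarrier :: "'a set"
  ladd :: "'a \<Rightarrow> 'a \<Rightarrow> 'a"
  lscale :: "'k \<Rightarrow> 'a \<Rightarrow> 'a"
  lbracket :: "'a \<Rightarrow> 'a \<Rightarrow> 'a"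

definition lie_closed :: "('k, 'a) lie_struct \<Rightarrow> bool"
  where "lie_closed G \<longleftrightarrow>
    (\<forall>x\<in>lcarrier G. \<forall>y\<in>lcarrier G. ladd G x y \<in> lcarrier G \<and> lbracket G x y \<in> lcarrier G) \<and>
    (\<forall>c. \<forall>x\<in>lcarrier G. lscale G c x \<in> lcarrier G)"

definition lie_of :: "('k \<Rightarrow> 'f::ab_group_add \<Rightarrow> 'f) \<Rightarrow> ('f \<Rightarrow> 'f \<Rightarrow> 'f) \<Rightarrow> ('k, 'f) lie_struct"
  where "lie_of smul br = \<lparr>lcarrier = UNIV, ladd = (+), lscale = smul, lbracket = br\<rparr>"

definition lie_iso :: "('k, 'a) lie_struct \<Rightarrow> ('k, 'b) lie_struct \<Rightarrow> ('a \<Rightarrow> 'b) \<Rightarrow> bool"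
  where "lie_iso G H h \<longleftrightarrow>
    bij_betw h (lcarrier G) (lcarrier H) \<and>
    (\<forall>x\<in>lcarrier G. \<forall>y\<in>lcarrier G. h (ladd G x y) = ladd H (h x) (h y)) \<and>
    (\<forall>c. \<forall>x\<in>lcarrier G. h (lscale G c x) = lscale H c (h x)) \<and>
    (\<forall>x\<in>lcarrier G. \<forall>y\<in>lcarrier G. h (lbracket G x y) = lbracket H (h x) (h y))"

definition lie_isomorphic :: "('k, 'a) lie_struct \<Rightarrow> ('k, 'b) lie_struct \<Rightarrow> bool"
  where "lie_isomorphic G H \<longleftrightarrow> (\<exists>h. lie_iso G H h)"

text \<open>
  Maps on the carrier are represented by extensional functions, so that equality of derivations
  is equality on the carrier.
\<close>

definition derivations :: "('k, 'a) lie_struct \<Rightarrow> ('a \<Rightarrow> 'a) set"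
  where "derivations G = {D \<in> lcarrier G \<rightarrow>\<^sub>E lcarrier G.
    (\<forall>x\<in>lcarrier G. \<forall>y\<in>lcarrier G. D (ladd G x y) = ladd G (D x) (D y)) \<and>
    (\<forall>c. \<forall>x\<in>lcarrier G. D (lscale G c x) = lscale G c (D x)) \<and>
    (\<forall>x\<in>lcarrier G. \<forall>y\<in>lcarrier G.
       D (lbracket G x y) = ladd G (lbracket G (D x) y) (lbracket G x (D y)))}"

definition Der :: "('k::ring_1, 'a) lie_struct \<Rightarrow> ('k, 'a \<Rightarrow> 'a) lie_struct"
  where "Der G = \<lparr>
    lcarrier = derivations G,
    ladd = (\<lambda>D D'. \<lambda>x\<in>lcarrier G. ladd G (D x) (D' x)),
    lscale = (\<lambda>c D. \<lambda>x\<in>lcarrier G. lscale G c (D x)),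
    lbracket = (\<lambda>D D'. \<lambda>x\<in>lcarrier G. ladd G (D (D' x)) (lscale G (- 1) (D' (D x))))\<rparr>"

section \<open>Manifolds\<close>

text \<open>
  \<open>C\<^sup>k\<close> for maps on relatively open subsets \<open>S\<close> of \<open>UNIV\<close> or of \<open>{0}\<close>. In the first case the
  derivative within \<open>S\<close> is the ordinary derivative; in the second one it is not unique, and every
  map is \<open>C\<^sup>k\<close>.
\<close>

primrec ck_on :: "nat \<Rightarrow> 'e::euclidean_space set \<Rightarrow> ('e \<Rightarrow> 'b::real_normed_vector) \<Rightarrow> bool"
  where
    "ck_on 0 S f \<longleftrightarrow> continuous_on S f"
  | "ck_on (Suc k) S f \<longleftrightarrow>
      (\<exists>f'. (\<forall>x\<in>S. (f has_derivative f' x) (at x within S)) \<and> (\<forall>v. ck_on k S (\<lambda>x. f' x v)))"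

definition paracompact :: "'m::topological_space itself \<Rightarrow> bool"
  where "paracompact _ \<longleftrightarrow>
    (\<forall>\<U> :: 'm set set. (\<forall>U\<in>\<U>. open U) \<and> \<Union>\<U> = UNIV \<longrightarrow>
      (\<exists>\<V>. (\<forall>V\<in>\<V>. open V \<and> (\<exists>U\<in>\<U>. V \<subseteq> U)) \<and> \<Union>\<V> = UNIV \<and> locally_finite_in euclidean \<V>))"

text \<open>
  The types of class \<^class>\<open>euclidean_space\<close> have positive dimension; the model space \<open>E = {0}\<close>
  admits the zero-dimensional manifold. A chart is a pair of its domain and its coordinate map.
  The atlas need not be maximal.
\<close>

locale smooth_manifold =
  fixes E :: "'e::euclidean_space set"
    and atlas :: "('m::t2_space set \<times> ('m \<Rightarrow> 'e)) set"
  assumes model_space: "E = UNIV \<or> E = {0}"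
    and connected: "connected (UNIV :: 'm set)"
    and paracompact: "paracompact TYPE('m)"
    and charts_cover: "(\<Union>(U, \<phi>)\<in>atlas. U) = UNIV"
    and chart: "(U, \<phi>) \<in> atlas \<Longrightarrow>
      open U \<and> openin (top_of_set E) (\<phi> ` U) \<and> homeomorphism U (\<phi> ` U) \<phi> (inv_into U \<phi>)"
    and chart_change: "(U, \<phi>) \<in> atlas \<Longrightarrow> (V, \<psi>) \<in> atlas \<Longrightarrow>
      ck_on k (\<phi> ` (U \<inter> V)) (\<psi> \<circ> inv_into U \<phi>)"

definition manifold_ck ::
    "('m set \<times> ('m \<Rightarrow> 'e::euclidean_space)) set \<Rightarrow> nat \<Rightarrow> 'm set \<Rightarrow> ('m \<Rightarrow> 'b::real_normed_vector) \<Rightarrow> bool"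
  where "manifold_ck atlas k W f \<longleftrightarrow>
    (\<forall>(U, \<phi>)\<in>atlas. ck_on k (\<phi> ` (U \<inter> W)) (f \<circ> inv_into U \<phi>))"

text \<open>
  A finite-dimensional vector space has a canonical smooth structure, for which a map into it is
  \<open>C\<^sup>k\<close> iff its coordinates with respect to a basis are, equivalently iff its compositions with all
  \<open>\<bbbK>\<close>-linear functionals are. (\<open>C\<^sup>k\<close> always refers to real differentiability, also for \<open>\<bbbK> = \<complex>\<close>.)
  A map \<open>A\<close> into endomorphisms is \<open>C\<^sup>k\<close> iff its matrix coefficients are, that is, iff
  \<open>x \<mapsto> A x v\<close> is \<open>C\<^sup>k\<close> for all \<open>v\<close>.
\<close>

definition vec_ck ::
    "('k::real_normed_field \<Rightarrow> 'f::ab_group_add \<Rightarrow> 'f) \<Rightarrow>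
     ('m set \<times> ('m \<Rightarrow> 'e::euclidean_space)) set \<Rightarrow> nat \<Rightarrow> 'm set \<Rightarrow> ('m \<Rightarrow> 'f) \<Rightarrow> bool"
  where "vec_ck smul atlas k W f \<longleftrightarrow>
    (\<forall>l. Vector_Spaces.linear smul (*) l \<longrightarrow> manifold_ck atlas k W (l \<circ> f))"

definition end_ck ::
    "('k::real_normed_field \<Rightarrow> 'f::ab_group_add \<Rightarrow> 'f) \<Rightarrow>
     ('m set \<times> ('m \<Rightarrow> 'e::euclidean_space)) set \<Rightarrow> nat \<Rightarrow> 'm set \<Rightarrow> ('m \<Rightarrow> 'f \<Rightarrow> 'f) \<Rightarrow> bool"
  where "end_ck smul atlas k W A \<longleftrightarrow> (\<forall>v. vec_ck smul atlas k W (\<lambda>x. A x v))"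

section \<open>Bundles of Lie algebras\<close>

text \<open>
  The total space is the type \<open>'l\<close>, and \<open>fib x\<close> is the Lie algebra structure of the fiber over \<open>x\<close>.
  A bundle chart \<open>(V, \<Phi>)\<close> stands for the local trivialization
  \<open>u \<mapsto> (proj u, \<Phi> u)\<close> from \<open>proj -` V\<close> to \<open>V \<times> \<kk>\<close>. The topology and the smooth structure
  of the total space are the ones for which all these trivializations are diffeomorphisms. They
  exist because the transition maps are smooth, and they are not needed as separate data.
\<close>

definition transition ::
    "('m \<Rightarrow> ('k, 'l) lie_struct) \<Rightarrow> ('l \<Rightarrow> 'f) \<Rightarrow> ('l \<Rightarrow> 'f) \<Rightarrow> 'm \<Rightarrow> 'f \<Rightarrow> 'f"
  where "transition fib \<Phi> \<Psi> x = \<Psi> \<circ> inv_into (lcarrier (fib x)) \<Phi>"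

locale lie_algebra_bundle =
  fin_dim_lie_algebra smul br + smooth_manifold E atlas
  for smul :: "'k::real_normed_field \<Rightarrow> 'f::ab_group_add \<Rightarrow> 'f"
    and br :: "'f \<Rightarrow> 'f \<Rightarrow> 'f"
    and E :: "'e::euclidean_space set"
    and atlas :: "('m::t2_space set \<times> ('m \<Rightarrow> 'e)) set" +
  fixes proj :: "'l \<Rightarrow> 'm"
    and fib :: "'m \<Rightarrow> ('k, 'l) lie_struct"
    and batlas :: "('m set \<times> ('l \<Rightarrow> 'f)) set"
  assumes fiber_carrier: "lcarrier (fib x) = proj -` {x}"
    and fiber_closed: "lie_closed (fib x)"
    and bundle_charts_cover: "(\<Union>(V, \<Phi>)\<in>batlas. V) = UNIV"
    and bundle_chart_open: "(V, \<Phi>) \<in> batlas \<Longrightarrow> open V"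
    and bundle_chart_iso: "(V, \<Phi>) \<in> batlas \<Longrightarrow> x \<in> V \<Longrightarrow> lie_iso (fib x) (lie_of smul br) \<Phi>"
    and transition_smooth: "(V, \<Phi>) \<in> batlas \<Longrightarrow> (W, \<Psi>) \<in> batlas \<Longrightarrow>
      end_ck smul atlas k (V \<inter> W) (transition fib \<Phi> \<Psi>)"
begin

text \<open>
  The transition maps take values in \<open>Aut(\<kk>)\<close>, which is a closed Lie subgroup of \<open>GL(\<kk>)\<close>.
  Hence smoothness into \<open>Aut(\<kk>)\<close> is smoothness into \<open>End(\<kk>)\<close>.
\<close>

lemma transition_automorphism:
  assumes V: "(V, \<Phi>) \<in> batlas" and W: "(W, \<Psi>) \<in> batlas" and x: "x \<in> V \<inter> W"
  shows "lie_iso (lie_of smul br) (lie_of smul br) (transition fib \<Phi> \<Psi> x)"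
proof -
  let ?F = "lcarrier (fib x)" and ?g = "inv_into (lcarrier (fib x)) \<Phi>"
  have P: "lie_iso (fib x) (lie_of smul br) \<Phi>" and Q: "lie_iso (fib x) (lie_of smul br) \<Psi>"
    using bundle_chart_iso V W x by auto
  have cl: "lie_closed (fib x)" by (rule fiber_closed)
  have b: "bij_betw \<Phi> ?F UNIV" using P by (simp add: lie_iso_def lie_of_def)
  have b': "bij_betw ?g UNIV ?F" by (rule bij_betw_inv_into[OF b])
  have gF: "?g v \<in> ?F" for v using b' by (auto simp: bij_betw_def)
  have r: "\<Phi> (?g v) = v" for v using b by (simp add: bij_betw_inv_into_right)
  have l: "?g (\<Phi> u) = u" if "u \<in> ?F" for u using b that by (simp add: bij_betw_inv_into_left)
  have add: "?g (v + w) = ladd (fib x) (?g v) (?g w)" for v w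
  proof -
    have "\<Phi> (ladd (fib x) (?g v) (?g w)) = v + w"
      using P gF r by (simp add: lie_iso_def lie_of_def)
    then show ?thesis using l[of "ladd (fib x) (?g v) (?g w)"] cl gF by (simp add: lie_closed_def)
  qed
  have scl: "?g (smul c v) = lscale (fib x) c (?g v)" for c v
  proof -
    have "\<Phi> (lscale (fib x) c (?g v)) = smul c v"
      using P gF r by (simp add: lie_iso_def lie_of_def)
    then show ?thesis using l[of "lscale (fib x) c (?g v)"] cl gF by (simp add: lie_closed_def)
  qed
  have brk: "?g (br v w) = lbracket (fib x) (?g v) (?g w)" for v w
  proof -
    have "\<Phi> (lbracket (fib x) (?g v) (?g w)) = br v w"
      using P gF r by (simp add: lie_iso_def lie_of_def)
    then show ?thesis using l[of "lbracket (fib x) (?g v) (?g w)"] cl gF by (simp add: lie_closed_def)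
  qed
  have "bij_betw (\<Psi> \<circ> ?g) UNIV UNIV"
    using b' Q by (intro bij_betw_trans[of ?g UNIV ?F]) (auto simp: lie_iso_def lie_of_def)
  then show ?thesis
    using Q gF by (simp add: lie_iso_def lie_of_def transition_def add scl brk)
qed

end

definition pointwise :: "('m \<Rightarrow> ('k, 'a) lie_struct) \<Rightarrow> ('m \<Rightarrow> 'a) set \<Rightarrow> ('k, 'm \<Rightarrow> 'a) lie_struct"
  where "pointwise F S = \<lparr>
    lcarrier = S,
    ladd = (\<lambda>X Y x. ladd (F x) (X x) (Y x)),
    lscale = (\<lambda>c X x. lscale (F x) c (X x)),
    lbracket = (\<lambda>X Y x. lbracket (F x) (X x) (Y x))\<rparr>"

text \<open>\<open>\<Gamma>\<^sup>k(\<bbbL>)\<close>\<close>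

definition sections ::
    "('k::real_normed_field \<Rightarrow> 'f::ab_group_add \<Rightarrow> 'f) \<Rightarrow>
     ('m set \<times> ('m \<Rightarrow> 'e::euclidean_space)) set \<Rightarrow> ('m \<Rightarrow> ('k, 'l) lie_struct) \<Rightarrow>
     ('m set \<times> ('l \<Rightarrow> 'f)) set \<Rightarrow> nat \<Rightarrow> ('k, 'm \<Rightarrow> 'l) lie_struct"
  where "sections smul atlas fib batlas k = pointwise fib
    {X. (\<forall>x. X x \<in> lcarrier (fib x)) \<and>
        (\<forall>(V, \<Phi>)\<in>batlas. vec_ck smul atlas k V (\<lambda>x. \<Phi> (X x)))}"

text \<open>
  \<open>\<Gamma>\<^sup>k(Der(\<bbbL>))\<close>. In the bundle chart of \<open>Hom(\<bbbL>, \<bbbL>)\<close> induced by \<open>\<Phi>\<close>, an endomorphism \<open>A x\<close> of the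
  fiber over \<open>x\<close> is represented by \<open>\<Phi> \<circ> A x \<circ> (\<Phi>|fiber)\<^sup>-\<^sup>1\<close>. Since \<open>Der(\<bbbL>)\<close> is a smooth subbundle,
  its \<open>C\<^sup>k\<close>-sections are the \<open>C\<^sup>k\<close>-sections of \<open>Hom(\<bbbL>, \<bbbL>)\<close> with values in \<open>Der(\<bbbL>)\<close>.
\<close>

definition der_sections ::
    "('k::real_normed_field \<Rightarrow> 'f::ab_group_add \<Rightarrow> 'f) \<Rightarrow>
     ('m set \<times> ('m \<Rightarrow> 'e::euclidean_space)) set \<Rightarrow> ('m \<Rightarrow> ('k, 'l) lie_struct) \<Rightarrow>
     ('m set \<times> ('l \<Rightarrow> 'f)) set \<Rightarrow> nat \<Rightarrow> ('k, 'm \<Rightarrow> 'l \<Rightarrow> 'l) lie_struct"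
  where "der_sections smul atlas fib batlas k = pointwise (\<lambda>x. Der (fib x))
    {A. (\<forall>x. A x \<in> lcarrier (Der (fib x))) \<and>
        (\<forall>(V, \<Phi>)\<in>batlas.
           end_ck smul atlas k V (\<lambda>x. \<Phi> \<circ> A x \<circ> inv_into (lcarrier (fib x)) \<Phi>))}"

end

theory Submission
  imports Defs "HOL-Computational_Algebra.Fundamental_Theorem_Algebra"
begin

text \<open>
  Let \<open>D\<close> be a derivation of the sections and \<open>m\<^sub>f\<close> the multiplication by a real \<open>C\<^sup>k\<close> function \<open>f\<close>.
  The commutator \<open>[D, m\<^sub>f]\<close> lies in the centroid, and so does \<open>m\<^sub>g\<close>. The centroid is commutative if
  the Lie algebra of sections is perfect or centerfree, and then \<open>f \<mapsto> [D, m\<^sub>f] \<xi>\<close> is a derivation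
  from \<open>C\<^sup>k\<close> functions to \<open>C\<^sup>k\<close> sections. For finite \<open>k\<close> such a derivation vanishes, so \<open>D\<close> is linear over
  the \<open>C\<^sup>k\<close> functions and therefore acts fiberwise.

  If the fiber is perfect then every section is a finite sum of brackets. This is a global
  statement which rests on the finite dimension of the manifold: the bundle is trivial over each of finitely
  many open sets that cover the base.
\<close>

section \<open>Functions of class \<open>C\<^sup>k\<close> on Euclidean spaces\<close>

text \<open>The vanishing of [[D, m_f], m_g] is exactly the Leibniz rule for f \<mapsto> [D, m_f],
  which is why commutativity of the centroid matters. Two obstacles shape the rest. In the perfect
  case a noncompact base may need infinitely many trivializations, and a partition of unity would
  give an infinite sum of brackets. Trivializations over pairwise disjoint sets merge into one, so
  the cover is sorted into finitely many families of disjoint sets. These come from an arrangement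
  of hypersurfaces h_i = t_i: for generic t no point lies on more than dim M of them, and the colour
  of a set is the number of hypersurfaces singled out as nearest. The scalars form an arbitrary real
  normed field, whereas the Leibniz argument concerns real functions. Coefficients of sections are
  therefore split into real functions, which requires the field to be spanned over the reals by 1
  and a single element j. This is the content of Gelfand-Mazur, obtained here from real polynomials
  and the fundamental theorem of algebra.\<close>

lemma ck_on_subset: "ck_on k S f \<Longrightarrow> T \<subseteq> S \<Longrightarrow> ck_on k T f"
proof (induction k arbitrary: f)
  case 0
  then show ?case by (auto intro: continuous_on_subset)
next
  case (Suc k)
  then obtain f' where "\<forall>x\<in>S. (f has_derivative f' x) (at x within S)" "\<forall>v. ck_on k S (\<lambda>x. f' x v)"
    by auto
  then show ?case using Suc.IH Suc.prems(2)
    by (auto intro!: exI[of _ f'] intro: has_derivative_subset)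
qed

lemma ck_on_cong: "ck_on k S f \<Longrightarrow> (\<And>x. x \<in> S \<Longrightarrow> g x = f x) \<Longrightarrow> ck_on k S g"
proof (cases k)
  case 0
  then show "ck_on k S f \<Longrightarrow> (\<And>x. x \<in> S \<Longrightarrow> g x = f x) \<Longrightarrow> ck_on k S g"
    by (auto cong: continuous_on_cong)
next
  case (Suc m)
  assume a: "ck_on k S f" "\<And>x. x \<in> S \<Longrightarrow> g x = f x"
  then obtain f' where f': "\<forall>x\<in>S. (f has_derivative f' x) (at x within S)" "\<forall>v. ck_on m S (\<lambda>x. f' x v)"
    using Suc by auto
  have "\<forall>x\<in>S. (g has_derivative f' x) (at x within S)"
    using f'(1) a(2) by (auto intro: has_derivative_transform)
  then show "ck_on k S g" using f'(2) Suc by auto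
qed

lemma ck_on_imp_continuous: "ck_on k S f \<Longrightarrow> continuous_on S f"
  by (cases k) (auto simp: continuous_on_eq_continuous_within intro: has_derivative_continuous)

lemma ck_on_SucD: "ck_on (Suc k) S f \<Longrightarrow> ck_on k S f"
proof (induction k arbitrary: f)
  case 0
  then show ?case using ck_on_imp_continuous by fastforce
next
  case (Suc k)
  from Suc.prems obtain f' where "\<forall>x\<in>S. (f has_derivative f' x) (at x within S)"
      "\<forall>v. ck_on (Suc k) S (\<lambda>x. f' x v)"
    by (subst (asm) ck_on.simps(2)) blast
  then show ?case using Suc.IH by (subst ck_on.simps(2)) blast
qed

lemma ck_on_const [simp]: "ck_on k S (\<lambda>x. c)"
proof (induction k arbitrary: c)
  case (Suc k)
  then show ?case by (auto intro!: exI[of _ "\<lambda>x v. 0"])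
qed auto

lemma ck_on_bounded_linear_compose:
  assumes L: "bounded_linear L"
  shows "ck_on k S f \<Longrightarrow> ck_on k S (\<lambda>x. L (f x))"
proof (induction k arbitrary: f)
  case 0
  then show ?case by (auto intro: bounded_linear.continuous_on[OF L])
next
  case (Suc k)
  then obtain f' where "\<forall>x\<in>S. (f has_derivative f' x) (at x within S)" "\<forall>v. ck_on k S (\<lambda>x. f' x v)"
    by auto
  then show ?case using Suc.IH
    by (auto intro!: exI[of _ "\<lambda>x v. L (f' x v)"] bounded_linear.has_derivative[OF L])
qed

lemma ck_on_bounded_linear:
  assumes L: "bounded_linear L"
  shows "ck_on k S L"
proof (cases k)
  case (Suc m)
  have "\<forall>x\<in>S. (L has_derivative L) (at x within S)"
    using bounded_linear.has_derivative[OF L has_derivative_ident] by auto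
  then show ?thesis using Suc by auto
qed (use linear_continuous_on[OF L] in auto)

lemma ck_on_add: "ck_on k S f \<Longrightarrow> ck_on k S g \<Longrightarrow> ck_on k S (\<lambda>x. f x + g x)"
proof (induction k arbitrary: f g)
  case 0
  then show ?case by (auto intro: continuous_on_add)
next
  case (Suc k)
  then obtain f' g' where "\<forall>x\<in>S. (f has_derivative f' x) (at x within S)" "\<forall>v. ck_on k S (\<lambda>x. f' x v)"
    "\<forall>x\<in>S. (g has_derivative g' x) (at x within S)" "\<forall>v. ck_on k S (\<lambda>x. g' x v)"
    by auto
  then show ?case using Suc.IH
    by (auto intro!: exI[of _ "\<lambda>x v. f' x v + g' x v"] has_derivative_add)
qed

lemma ck_on_sum: "(\<And>i. i \<in> I \<Longrightarrow> ck_on k S (f i)) \<Longrightarrow> ck_on k S (\<lambda>x. \<Sum>i\<in>I. f i x)"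
  by (induction I rule: infinite_finite_induct) (auto intro: ck_on_add)

lemma ck_on_uminus: "ck_on k S f \<Longrightarrow> ck_on k S (\<lambda>x. - f x)"
  by (rule ck_on_bounded_linear_compose[OF bounded_linear_minus[OF bounded_linear_ident]])

lemma ck_on_diff: "ck_on k S f \<Longrightarrow> ck_on k S g \<Longrightarrow> ck_on k S (\<lambda>x. f x - g x)"
  using ck_on_add[of k S f "\<lambda>x. - g x"] ck_on_uminus[of k S g] by simp

lemma ck_on_bounded_bilinear:
  assumes P: "bounded_bilinear p"
  shows "ck_on k S f \<Longrightarrow> ck_on k S g \<Longrightarrow> ck_on k S (\<lambda>x. p (f x) (g x))"
proof (induction k arbitrary: f g)
  case 0
  then show ?case by (auto intro: bounded_bilinear.continuous_on[OF P])
next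
  case (Suc k)
  then obtain f' g' where d: "\<forall>x\<in>S. (f has_derivative f' x) (at x within S)" "\<forall>v. ck_on k S (\<lambda>x. f' x v)"
    "\<forall>x\<in>S. (g has_derivative g' x) (at x within S)" "\<forall>v. ck_on k S (\<lambda>x. g' x v)"
    by auto
  have c: "ck_on k S f" "ck_on k S g" using Suc.prems ck_on_SucD by blast+
  have "\<forall>x\<in>S. ((\<lambda>x. p (f x) (g x)) has_derivative (\<lambda>v. p (f x) (g' x v) + p (f' x v) (g x))) (at x within S)"
    using d by (auto intro: bounded_bilinear.FDERIV[OF P])
  moreover have "\<forall>v. ck_on k S (\<lambda>x. p (f x) (g' x v) + p (f' x v) (g x))"
    using Suc.IH c d by (auto intro!: ck_on_add)
  ultimately show ?case by (auto intro!: exI[of _ "\<lambda>x v. p (f x) (g' x v) + p (f' x v) (g x)"])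
qed

lemmas ck_on_mult = ck_on_bounded_bilinear[OF bounded_bilinear_mult]
lemmas ck_on_scaleR = ck_on_bounded_bilinear[OF bounded_bilinear_scaleR]

lemma ck_on_power:
  fixes f :: "'a::euclidean_space \<Rightarrow> 'b::real_normed_field"
  shows "ck_on k S f \<Longrightarrow> ck_on k S (\<lambda>x. f x ^ n)"
  by (induction n) (auto intro: ck_on_mult)

lemma ck_on_compose:
  fixes f :: "'a::euclidean_space \<Rightarrow> 'b::euclidean_space" and g :: "'b \<Rightarrow> 'c::real_normed_vector"
  shows "ck_on k S f \<Longrightarrow> ck_on k T g \<Longrightarrow> f ` S \<subseteq> T \<Longrightarrow> ck_on k S (g \<circ> f)"
proof (induction k arbitrary: g)
  case 0
  then show ?case using continuous_on_compose[of S f g] continuous_on_subset[of T g] by simp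
next
  case (Suc k)
  then obtain f' g' where d: "\<forall>x\<in>S. (f has_derivative f' x) (at x within S)" "\<forall>v. ck_on k S (\<lambda>x. f' x v)"
    "\<forall>x\<in>T. (g has_derivative g' x) (at x within T)" "\<forall>v. ck_on k T (\<lambda>x. g' x v)"
    by auto
  have c: "ck_on k S f" using Suc.prems ck_on_SucD by blast
  have 1: "\<forall>x\<in>S. ((g \<circ> f) has_derivative (\<lambda>v. g' (f x) (f' x v))) (at x within S)"
  proof
    fix x assume x: "x \<in> S"
    have "(g has_derivative g' (f x)) (at (f x) within f ` S)"
      using d(3) x Suc.prems(3) by (blast intro: has_derivative_subset)
    from diff_chain_within[OF d(1)[rule_format, OF x] this]
    show "((g \<circ> f) has_derivative (\<lambda>v. g' (f x) (f' x v))) (at x within S)" by (simp add: o_def)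
  qed
  \<comment> \<open>The direction \<open>f' x v\<close> varies with \<open>x\<close>, but
    \<open>ck_on\<close> controls \<open>g'\<close> only in fixed directions. Expanding in
    \<open>Basis\<close> turns the expression into products of functions to which the induction
    hypothesis applies.\<close>
  have 2: "ck_on k S (\<lambda>x. g' (f x) (f' x v))" for v
  proof -
    have *: "ck_on k S (\<lambda>x. \<Sum>b\<in>Basis. (f' x v \<bullet> b) *\<^sub>R (g' \<circ> f) x b)"
    proof (intro ck_on_sum ck_on_scaleR)
      fix b :: 'b assume "b \<in> Basis"
      show "ck_on k S (\<lambda>x. f' x v \<bullet> b)"
        using ck_on_bounded_linear_compose[OF bounded_linear_inner_left] d(2) by blast
      have "ck_on k S ((\<lambda>y. g' y b) \<circ> f)" using Suc.IH[OF c _ Suc.prems(3)] d(4) by blast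
      then show "ck_on k S (\<lambda>x. (g' \<circ> f) x b)" by (simp add: o_def)
    qed
    show ?thesis
    proof (rule ck_on_cong[OF *])
      fix x assume "x \<in> S"
      then have "linear (g' (f x))" using d(3) Suc.prems(3) has_derivative_linear by blast
      then show "g' (f x) (f' x v) = (\<Sum>b\<in>Basis. (f' x v \<bullet> b) *\<^sub>R (g' \<circ> f) x b)"
        by (subst euclidean_representation[of "f' x v", symmetric])
           (simp only: linear_sum linear_cmul o_def)
    qed
  qed
  show ?case using 1 2 unfolding ck_on.simps(2) by (intro exI[of _ "\<lambda>x v. g' (f x) (f' x v)"] conjI allI)
qed

lemma ck_on_inverse:
  fixes f :: "'a::euclidean_space \<Rightarrow> real"
  shows "ck_on k S f \<Longrightarrow> (\<And>x. x \<in> S \<Longrightarrow> f x \<noteq> 0) \<Longrightarrow> ck_on k S (\<lambda>x. inverse (f x))"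
proof (induction k arbitrary: f)
  case 0
  then show ?case by (auto intro: continuous_on_inverse)
next
  case (Suc k)
  then obtain f' where d: "\<forall>x\<in>S. (f has_derivative f' x) (at x within S)" "\<forall>v. ck_on k S (\<lambda>x. f' x v)"
    by auto
  have c: "ck_on k S f" using Suc.prems ck_on_SucD by blast
  have i: "ck_on k S (\<lambda>x. inverse (f x))" using Suc.IH[OF c] Suc.prems by auto
  have "\<forall>x\<in>S. ((\<lambda>x. inverse (f x)) has_derivative (\<lambda>v. - (inverse (f x) * f' x v * inverse (f x)))) (at x within S)"
    using d Suc.prems by (auto intro!: has_derivative_inverse)
  moreover have "\<forall>v. ck_on k S (\<lambda>x. - (inverse (f x) * f' x v * inverse (f x)))"
    using i d by (auto intro!: ck_on_uminus ck_on_mult)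
  ultimately show ?case by (auto intro!: exI[of _ "\<lambda>x v. - (inverse (f x) * f' x v * inverse (f x))"])
qed

section \<open>Truncated powers\<close>

lemma has_derivative_pos_part_power:
  "((\<lambda>t::real. max 0 t ^ Suc (Suc n)) has_derivative (\<lambda>v. v * (real (Suc (Suc n)) * max 0 t ^ Suc n))) (at t)"
proof -
  consider "t > 0" | "t < 0" | "t = 0" by linarith
  then have "((\<lambda>t::real. max 0 t ^ Suc (Suc n)) has_real_derivative (real (Suc (Suc n)) * max 0 t ^ Suc n)) (at t)"
  proof cases
    case 1
    have "((\<lambda>t::real. t ^ Suc (Suc n)) has_real_derivative (real (Suc (Suc n)) * t ^ Suc n)) (at t)"
      by (rule derivative_eq_intros refl | simp)+
    moreover have "\<forall>\<^sub>F x in nhds t. max 0 x ^ Suc (Suc n) = x ^ Suc (Suc n)"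
      using eventually_nhds_in_open[of "{0<..}" t] 1 by (auto elim!: eventually_mono)
    ultimately show ?thesis using 1
      by (subst DERIV_cong_ev[OF refl _ refl]) (auto simp: max_def)
  next
    case 2
    have "\<forall>\<^sub>F x in nhds t. max 0 x ^ Suc (Suc n) = 0"
      using eventually_nhds_in_open[of "{..<0}" t] 2 by (auto elim!: eventually_mono)
    then show ?thesis using 2
      by (subst DERIV_cong_ev[OF refl _ refl, where g = "\<lambda>_. 0"]) (auto simp: max_def)
  next
    case 3
    have "((\<lambda>h::real. max 0 h ^ Suc (Suc n) / h) \<longlongrightarrow> 0) (at 0)"
    proof (rule Lim_null_comparison)
      show "((\<lambda>h::real. max 0 h ^ Suc n) \<longlongrightarrow> 0) (at 0)"
        by (auto intro!: tendsto_eq_intros)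
      show "\<forall>\<^sub>F h::real in at 0. norm (max 0 h ^ Suc (Suc n) / h) \<le> max 0 h ^ Suc n"
        by (auto intro!: always_eventually simp: max_def)
    qed
    then show ?thesis using 3 by (simp add: DERIV_def)
  qed
  then show ?thesis
    unfolding has_field_derivative_def by (rule has_derivative_eq_rhs) (simp add: fun_eq_iff mult.commute)
qed

text \<open>Differentiation lowers the exponent and the order by one each, down to the continuous
  function \<open>max 0 f\<close>; this fixes the exponent k + 1. These functions serve both as raw
  material for bump functions and as test functions of limited regularity.\<close>

lemma ck_on_pos_part_power:
  fixes f :: "'a::euclidean_space \<Rightarrow> real"
  shows "ck_on k S f \<Longrightarrow> ck_on k S (\<lambda>x. max 0 (f x) ^ Suc k)"
proof (induction k)
  case 0
  then show ?case by (auto intro!: continuous_intros)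
next
  case (Suc k)
  then obtain f' where d: "\<forall>x\<in>S. (f has_derivative f' x) (at x within S)" "\<forall>v. ck_on k S (\<lambda>x. f' x v)"
    by auto
  have c: "ck_on k S f" using Suc.prems ck_on_SucD by blast
  have "\<forall>x\<in>S. ((\<lambda>x. max 0 (f x) ^ Suc (Suc k)) has_derivative
      (\<lambda>v. f' x v * (real (Suc (Suc k)) * max 0 (f x) ^ Suc k))) (at x within S)"
    using d has_derivative_compose[OF _ has_derivative_pos_part_power] by blast
  moreover have "\<forall>v. ck_on k S (\<lambda>x. f' x v * (real (Suc (Suc k)) * max 0 (f x) ^ Suc k))"
    using Suc.IH[OF c] d by (intro allI ck_on_mult) auto
  ultimately show ?case
    unfolding ck_on.simps(2) by (intro exI conjI)
qed

lemma ck_on_zero_space: "S \<subseteq> {0} \<Longrightarrow> ck_on k S f"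
proof (induction k arbitrary: f)
  case (0 f)
  then have "finite S" by (meson finite.emptyI finite_insert finite_subset)
  then show ?case by (simp add: continuous_on_finite)
next
  case (Suc k f)
  have "(f has_derivative (\<lambda>v. 0)) (at x within S)" if "x \<in> S" for x
  proof -
    have "S = {x}" using Suc.prems that by auto
    then have "at x within S = bot" by (simp add: at_within_def)
    then show ?thesis by (simp add: has_derivative_def)
  qed
  then show ?case using Suc.IH[OF Suc.prems] 
    unfolding ck_on.simps(2) by (intro exI[of _ "\<lambda>x v. 0"]) blast
qed

lemma ck_on_open_Union:
  assumes "\<And>T. T \<in> \<T> \<Longrightarrow> open T" "\<And>T. T \<in> \<T> \<Longrightarrow> ck_on k T f"
  shows "ck_on k (\<Union>\<T>) f"
  using assms(2)
proof (induction k arbitrary: f)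
  case 0
  then show ?case using assms(1) by (auto intro: continuous_on_open_Union)
next
  case (Suc k)
  \<comment> \<open>Each member of the cover comes with its own derivative. They agree because
    derivatives at interior points are unique, so one canonical choice serves all of them.\<close>
  define f' where "f' x = frechet_derivative f (at x)" for x
  have D: "\<exists>g. (\<forall>x\<in>T. (f has_derivative g x) (at x)) \<and> (\<forall>v. ck_on k T (\<lambda>x. g x v))" if T: "T \<in> \<T>" for T
  proof -
    obtain g where g: "\<forall>x\<in>T. (f has_derivative g x) (at x within T)" "\<forall>v. ck_on k T (\<lambda>x. g x v)"
      using Suc.prems[OF T] unfolding ck_on.simps(2) by blast
    have "\<forall>x\<in>T. (f has_derivative g x) (at x)"
      using g(1) assms(1)[OF T] by (metis at_within_open)
    then show ?thesis using g(2) by blast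
  qed
  have 1: "(f has_derivative f' x) (at x)" if "x \<in> \<Union>\<T>" for x
    using D that unfolding f'_def by (metis UnionE differentiableI frechet_derivative_works)
  have 2: "ck_on k T (\<lambda>x. f' x v)" if T: "T \<in> \<T>" for T v
  proof -
    obtain g where g: "\<forall>x\<in>T. (f has_derivative g x) (at x)" "\<forall>v. ck_on k T (\<lambda>x. g x v)"
      using D[OF T] by blast
    show ?thesis
      by (rule ck_on_cong[OF g(2)[rule_format, of v]]) (use g(1) f'_def frechet_derivative_at in metis)
  qed
  show ?case using 1 Suc.IH 2
    unfolding ck_on.simps(2) by (intro exI[of _ f']) (auto intro: has_derivative_at_withinI)
qed

section \<open>Real normed fields have dimension at most two\<close>

definition real_poly_eval :: "'k::real_normed_field \<Rightarrow> real poly \<Rightarrow> 'k"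
  where "real_poly_eval a p = poly (map_poly of_real p) a"

lemma real_poly_eval_mult: "real_poly_eval a (p * q) = real_poly_eval a p * real_poly_eval a q"
proof -
  have "map_poly of_real (p * q) = map_poly of_real p * (map_poly of_real q :: 'a poly)"
    by (rule poly_eqI) (simp add: coeff_map_poly coeff_mult)
  then show ?thesis by (simp add: real_poly_eval_def)
qed

lemma real_poly_eval_add: "real_poly_eval a (p + q) = real_poly_eval a p + real_poly_eval a q"
proof -
  have "map_poly of_real (p + q) = map_poly of_real p + (map_poly of_real q :: 'a poly)"
    by (rule poly_eqI) (simp add: coeff_map_poly)
  then show ?thesis by (simp add: real_poly_eval_def)
qed

lemma real_poly_eval_diff: "real_poly_eval a (p - q) = real_poly_eval a p - real_poly_eval a q"
  using real_poly_eval_add[of a "p - q" q] by (simp add: algebra_simps)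

lemma real_poly_eval_const: "real_poly_eval a [:c:] = of_real c" and real_poly_eval_one: "real_poly_eval a 1 = 1" and real_poly_eval_linear: "real_poly_eval a [:c, d:] = of_real c + a * of_real d"
  and real_poly_eval_quadratic: "real_poly_eval a [:c, d, e:] = of_real c + a * (of_real d + a * of_real e)"
  by (simp_all add: real_poly_eval_def map_poly_pCons one_pCons)

lemma real_poly_eval_power: "real_poly_eval a (p ^ n) = real_poly_eval a p ^ n"
  by (induction n) (simp_all add: real_poly_eval_mult real_poly_eval_one)

lemma real_poly_eval_of_real: "real_poly_eval (of_real x :: 'k::real_normed_field) p = of_real (poly p x)"
  by (induction p) (simp_all add: real_poly_eval_def map_poly_pCons)

text \<open>A real polynomial is split by peeling off a factor for each complex root. A monic
  quadratic factor has norm at least \<open>m\<close>, and a linear factor is bounded through its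
  square, which is again a monic quadratic. With the squared norm on the right both kinds contribute
  a factor \<open>m\<close> per degree.\<close>

lemma monic_lower_bound:
  fixes a :: "'k::real_normed_field"
  assumes m: "m > 0" and quad: "\<And>s t. m \<le> norm (a * a + of_real s * a + of_real t)"
  shows "lead_coeff p = 1 \<Longrightarrow> m ^ degree p \<le> (norm (real_poly_eval a p))\<^sup>2"
proof (induction "degree p" arbitrary: p rule: less_induct)
  case less
  show ?case
  proof (cases "degree p = 0")
    case True
    then obtain c where "p = [:c:]" by (metis degree_eq_zeroE)
    then show ?thesis using less.prems by (simp add: real_poly_eval_const)
  next
    case False
    have "degree (map_poly complex_of_real p) = degree p"
      by (rule degree_map_poly) simp
    then have "\<not> constant (poly (map_poly complex_of_real p))"
      using False by (simp add: constant_degree)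
    then obtain z :: complex where z: "real_poly_eval z p = 0"
      using fundamental_theorem_of_algebra unfolding real_poly_eval_def by blast
    have p0: "p \<noteq> 0" using False by auto
    show ?thesis
    proof (cases "Im z = 0")
      case True
      then have "z = of_real (Re z)" by (simp add: complex_eq_iff)
      then have "poly p (Re z) = 0" using z real_poly_eval_of_real[of "Re z" p, where 'k = complex] by simp
      then obtain h where h: "p = [:- Re z, 1:] * h" by (metis dvdE poly_eq_0_iff_dvd)
      have h0: "h \<noteq> 0" using h p0 by auto
      have deg: "degree p = Suc (degree h)" unfolding h using h0 by (subst degree_mult_eq) auto
      have "lead_coeff h = 1" using less.prems unfolding h by (simp only: lead_coeff_mult) simp
      then have IH: "m ^ degree h \<le> (norm (real_poly_eval a h))\<^sup>2" using less.hyps deg by simp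
      have "m \<le> norm (a * a + of_real (- 2 * Re z) * a + of_real ((Re z)\<^sup>2))" by (rule quad)
      also have "a * a + of_real (- 2 * Re z) * a + of_real ((Re z)\<^sup>2) = (real_poly_eval a [:- Re z, 1:])\<^sup>2"
        by (simp add: real_poly_eval_linear power2_eq_square algebra_simps)
      finally have "m \<le> (norm (real_poly_eval a [:- Re z, 1:]))\<^sup>2" by (simp add: norm_power)
      then have "m * m ^ degree h \<le> (norm (real_poly_eval a [:- Re z, 1:]))\<^sup>2 * (norm (real_poly_eval a h))\<^sup>2"
        using IH m by (intro mult_mono) auto
      then show ?thesis unfolding deg unfolding h real_poly_eval_mult norm_mult power_mult_distrib by simp
    next
      case False
      define q where "q = [:(Re z)\<^sup>2 + (Im z)\<^sup>2, - 2 * Re z, 1:]"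
      have q: "degree q = 2" "lead_coeff q = 1" "q \<noteq> 0" by (simp_all add: q_def)
      have zq: "real_poly_eval z q = 0"
        by (simp add: q_def real_poly_eval_quadratic complex_eq_iff power2_eq_square algebra_simps)
      \<comment> \<open>The remainder has degree below 2 and vanishes at the non-real
        \<open>z\<close>, hence is zero. Thus \<open>q\<close>, the minimal polynomial of
        \<open>z\<close> over the reals, divides \<open>p\<close>.\<close>
      define r where "r = p mod q"
      have "degree r < 2" using degree_mod_less'[of q p] q unfolding r_def by (cases "p mod q = 0") auto
      then have "r = [:coeff r 0, coeff r 1:]"
        by (intro poly_eqI) (auto simp: coeff_pCons coeff_eq_0 split: nat.splits)
      then obtain c d where r: "r = [:c, d:]" by blast
      have "real_poly_eval z r = 0"
        using z zq real_poly_eval_add[of z "q * (p div q)" r] real_poly_eval_mult[of z q "p div q"] by (simp add: r_def)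
      then have "d * Im z = 0" "c + d * Re z = 0" by (simp_all add: r real_poly_eval_linear complex_eq_iff mult.commute)
      then have "r = 0" using False r by simp
      then obtain h where h: "p = q * h" unfolding r_def by (metis mod_0_imp_dvd dvdE)
      have h0: "h \<noteq> 0" using h p0 by auto
      have deg: "degree p = 2 + degree h" using h h0 q by (simp add: degree_mult_eq)
      have "lead_coeff h = 1" using less.prems q(2) unfolding h by (simp only: lead_coeff_mult mult_1_left)
      then have IH: "m ^ degree h \<le> (norm (real_poly_eval a h))\<^sup>2" using less.hyps deg by simp
      have "m \<le> norm (a * a + of_real (- 2 * Re z) * a + of_real ((Re z)\<^sup>2 + (Im z)\<^sup>2))" by (rule quad)
      also have "a * a + of_real (- 2 * Re z) * a + of_real ((Re z)\<^sup>2 + (Im z)\<^sup>2) = real_poly_eval a q"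
        by (simp add: q_def real_poly_eval_quadratic algebra_simps)
      finally have "m\<^sup>2 \<le> (norm (real_poly_eval a q))\<^sup>2" using m by (intro power_mono) auto
      then have "m\<^sup>2 * m ^ degree h \<le> (norm (real_poly_eval a q))\<^sup>2 * (norm (real_poly_eval a h))\<^sup>2"
        using IH m by (intro mult_mono) auto
      then show ?thesis unfolding deg unfolding h real_poly_eval_mult norm_mult power_mult_distrib power_add by simp
    qed
  qed
qed

text \<open>
  Let \<open>m\<close> be the minimum of the norms of the monic real quadratic polynomials at \<open>a\<close>, attained by \<open>q\<close>.
  Since \<open>q\<^sup>n - c\<^sup>n = (q - c) h\<close> with \<open>h\<close> monic of degree \<open>2 (n - 1)\<close>, the norm of \<open>q - c\<close> at \<open>a\<close> is at most
  \<open>(m\<^sup>n + \<bar>c\<bar>\<^sup>n) / m\<^sup>n\<^sup>-\<^sup>1\<close>, which tends to \<open>m\<close>.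
\<close>
lemma quadratic_minimum_step:
  fixes a :: "'k::real_normed_field"
  assumes m: "m > 0" and quad: "\<And>s t. m \<le> norm (a * a + of_real s * a + of_real t)"
    and eq: "norm (a * a + of_real s * a + of_real t) = m" and c: "\<bar>c\<bar> < m"
  shows "norm (a * a + of_real s * a + of_real (t - c)) = m"
proof -
  define q where "q = [:t, s, 1:]"
  have eval_q: "real_poly_eval a q = a * a + of_real s * a + of_real t"
    by (simp add: q_def real_poly_eval_quadratic algebra_simps)
  have eval_qc: "real_poly_eval a (q - [:c:]) = a * a + of_real s * a + of_real (t - c)"
    by (simp add: real_poly_eval_diff eval_q real_poly_eval_const algebra_simps)
  have bound: "norm (real_poly_eval a (q - [:c:])) \<le> m + m * (\<bar>c\<bar> / m) ^ Suc n" for n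
  proof -
    define h where "h = (\<Sum>i<Suc n. [:c:] ^ (Suc n - Suc i) * q ^ i)"
    have fac: "q ^ Suc n - [:c:] ^ Suc n = (q - [:c:]) * h"
      unfolding h_def by (rule power_diff_sumr2)
    have d: "degree (q ^ Suc n) = 2 * Suc n" by (simp add: q_def degree_power_eq del: power_Suc)
    have dc: "degree ([:c:] ^ Suc n) = 0" by (simp add: poly_const_pow del: power_Suc)
    have dd: "degree (q ^ Suc n - [:c:] ^ Suc n) = 2 * Suc n"
      using d dc degree_add_eq_left[of "- ([:c:] ^ Suc n)" "q ^ Suc n"] by (simp del: power_Suc)
    have l: "lead_coeff (q ^ Suc n - [:c:] ^ Suc n) = 1"
    proof -
      have "coeff ([:c:] ^ Suc n) (2 * Suc n) = 0" by (rule coeff_eq_0) (use dc in simp)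
      moreover have "coeff (q ^ Suc n) (2 * Suc n) = 1"
        using lead_coeff_power[of q "Suc n"] unfolding d by (simp add: q_def)
      ultimately show ?thesis unfolding dd by (simp del: power_Suc)
    qed
    have lq: "lead_coeff (q - [:c:]) = 1" and dq: "degree (q - [:c:]) = 2" by (simp_all add: q_def)
    have lh: "lead_coeff h = 1" using l lq unfolding fac by (simp only: lead_coeff_mult mult_1_left)
    then have "h \<noteq> 0" by auto
    then have "degree (q - [:c:]) + degree h = 2 * Suc n"
      using dd lq unfolding fac by (metis degree_mult_eq leading_coeff_0_iff zero_neq_one)
    then have dh: "degree h = n * 2" using dq by simp
    have "(m ^ n)\<^sup>2 \<le> (norm (real_poly_eval a h))\<^sup>2"
      using monic_lower_bound[OF m quad lh] unfolding dh power_mult .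
    then have mh: "m ^ n \<le> norm (real_poly_eval a h)" by (rule power2_le_imp_le) simp
    have "norm (real_poly_eval a (q - [:c:])) * m ^ n \<le> norm (real_poly_eval a (q - [:c:])) * norm (real_poly_eval a h)"
      using mh by (intro mult_left_mono) auto
    also have "\<dots> = norm (real_poly_eval a q ^ Suc n - of_real c ^ Suc n)"
      by (simp only: norm_mult[symmetric] real_poly_eval_mult[symmetric] fac[symmetric]) (simp only: real_poly_eval_diff real_poly_eval_power real_poly_eval_const)
    also have "\<dots> \<le> norm (real_poly_eval a q ^ Suc n) + norm (of_real c ^ Suc n :: 'k)" by (rule norm_triangle_ineq4)
    also have "\<dots> = m ^ Suc n + \<bar>c\<bar> ^ Suc n" by (simp only: norm_power eval_q eq norm_of_real)
    also have "\<dots> = (m + m * (\<bar>c\<bar> / m) ^ Suc n) * m ^ n"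
      using m by (simp add: field_simps power_divide)
    finally show ?thesis using m by (simp del: power_Suc)
  qed
  have "(\<lambda>n. m + m * (\<bar>c\<bar> / m) ^ Suc n) \<longlonglongrightarrow> m + m * 0"
    using m c by (intro tendsto_intros LIMSEQ_Suc LIMSEQ_power_zero) auto
  then have "norm (real_poly_eval a (q - [:c:])) \<le> m + m * 0"
    using bound by (intro LIMSEQ_le_const) auto
  then show ?thesis using quad[of s "t - c"] unfolding eval_qc by simp
qed

text \<open>If no monic quadratic vanished at \<open>a\<close>, their norms would attain a positive
  minimum \<open>m\<close>. By the preceding lemma the minimum is attained again after any shift of
  the constant term by less than \<open>m\<close>, so it propagates arbitrarily far along the
  constant terms, although elements of norm \<open>m\<close> are at most 2 m apart.\<close>

lemma real_normed_field_quadratic: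
  fixes a :: "'k::real_normed_field"
  obtains s t where "a * a + of_real s * a + of_real t = 0"
proof (rule ccontr)
  assume "\<not> thesis"
  then have nz: "a * a + of_real s * a + of_real t \<noteq> 0" for s t using that by blast
  have a_r: "a \<noteq> of_real r" for r
    using nz[of "- 2 * r" "r * r"] by (auto simp: algebra_simps)
  \<comment> \<open>\<open>r0\<close> is a real number nearest to \<open>a\<close>: beyond radius 2
    |a| the distance exceeds |a|, the distance of 0.\<close>
  obtain r0 where r0: "\<And>r. r \<in> {-2 * norm a..2 * norm a} \<Longrightarrow> norm (a - of_real r0) \<le> norm (a - of_real r)"
    using continuous_attains_inf[of "{-2 * norm a..2 * norm a}" "\<lambda>r. norm (a - of_real r)"]
    by (force intro!: continuous_intros)
  define d where "d = norm (a - of_real r0)"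
  have d: "d > 0" using a_r by (simp add: d_def)
  have dr: "d \<le> norm (a - of_real r)" for r
  proof (cases "\<bar>r\<bar> \<le> 2 * norm a")
    case False
    have "d \<le> norm a" using r0[of 0] by (simp add: d_def)
    also have "\<dots> \<le> norm (of_real r :: 'k) - norm a" using False by simp
    also have "\<dots> \<le> norm (a - of_real r)" by (metis norm_minus_commute norm_triangle_ineq2)
    finally show ?thesis .
  qed (use r0 in \<open>auto simp: d_def abs_le_iff\<close>)
  have ds: "\<bar>s\<bar> * d \<le> norm (of_real s * a + of_real t)" for s t
  proof (cases "s = 0")
    case False
    have "\<bar>s\<bar> * d \<le> \<bar>s\<bar> * norm (a - of_real (- t / s))" by (intro mult_left_mono dr) simp
    also have "\<dots> = norm (of_real s * (a - of_real (- t / s)))" by (simp add: norm_mult)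
    also have "of_real s * (a - of_real (- t / s)) = of_real s * a + of_real t"
      using False by (simp add: field_simps)
    finally show ?thesis .
  qed simp
  \<comment> \<open>\<open>M\<close> is the value at s = t = 0. The bounds \<open>S\<close> and
    \<open>T\<close> are chosen so that a quadratic with norm below \<open>M\<close> has its
    coefficients in the rectangle, whence the minimum over the rectangle is global.\<close>
  define M where "M = norm (a * a)"
  define S where "S = 2 * M / d"
  define T where "T = 2 * M + S * norm a"
  have pos: "0 \<le> M" "0 \<le> S" "0 \<le> T" using d by (simp_all add: M_def S_def T_def)
  define g where "g = (\<lambda>(s, t). norm (a * a + of_real s * a + of_real t))"
  have ne: "(0, 0) \<in> {-S..S} \<times> {-T..T}" using pos by simp
  have "compact ({-S..S} \<times> {-T..T})" by (simp add: compact_Times)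
  moreover have "continuous_on ({-S..S} \<times> {-T..T}) g"
    unfolding g_def case_prod_beta by (intro continuous_intros)
  ultimately obtain z where z: "z \<in> {-S..S} \<times> {-T..T}" "\<forall>y\<in>{-S..S} \<times> {-T..T}. g z \<le> g y"
    using continuous_attains_inf ne by (metis empty_iff)
  obtain s0 t0 where z0: "z = (s0, t0)" by fastforce
  define m where "m = g z"
  have m: "m > 0" using nz by (simp add: m_def z0 g_def)
  have mM: "m \<le> M" using z(2)[rule_format, OF ne] by (simp add: m_def M_def g_def)
  have quad: "m \<le> norm (a * a + of_real s * a + of_real t)" for s t
  proof (rule ccontr)
    assume "\<not> ?thesis"
    then have lt: "norm (a * a + of_real s * a + of_real t) < m" by simp
    have "of_real s * a + of_real t = (a * a + of_real s * a + of_real t) - a * a" by simp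
    then have "norm (of_real s * a + of_real t) \<le> norm (a * a + of_real s * a + of_real t) + M"
      unfolding M_def by (metis norm_triangle_ineq4)
    then have n: "norm (of_real s * a + of_real t) \<le> 2 * M" using lt mM by linarith
    then have s: "\<bar>s\<bar> \<le> S" using ds[of s t] d by (simp add: S_def field_simps)
    have "of_real t = (of_real s * a + of_real t) - of_real s * a" by simp
    then have "norm (of_real t :: 'k) \<le> norm (of_real s * a + of_real t) + norm (of_real s * a)"
      by (metis norm_triangle_ineq4)
    also have "\<dots> \<le> T"
      using n s by (auto simp: T_def norm_mult intro!: add_mono mult_right_mono)
    finally have "(s, t) \<in> {-S..S} \<times> {-T..T}" using s by (auto simp: abs_le_iff)
    then have "m \<le> g (s, t)" using z(2) by (simp add: m_def)
    then show False using lt by (simp add: g_def)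
  qed
  have "norm (a * a + of_real s0 * a + of_real (t0 - real n * (m / 2))) = m" for n
  proof (induction n)
    case 0
    show ?case by (simp add: m_def z0 g_def)
  next
    case (Suc n)
    have "t0 - real (Suc n) * (m / 2) = t0 - real n * (m / 2) - m / 2" by (simp add: field_simps)
    then show ?case using quadratic_minimum_step[OF m quad Suc.IH, of "m / 2"] m by (simp only:)
  qed
  \<comment> \<open>Five shifts by m/2 give two elements of norm \<open>m\<close> at distance 5 m /
    2 > 2 m.\<close>
  from this[of 0] this[of 5] have
    "norm (a * a + of_real s0 * a + of_real t0) = m"
    "norm (a * a + of_real s0 * a + of_real t0 - of_real (5 * (m / 2))) = m"
    by (simp_all add: algebra_simps)
  moreover have "norm (of_real (5 * (m / 2)) :: 'k) \<le>
    norm (a * a + of_real s0 * a + of_real t0) + norm (a * a + of_real s0 * a + of_real t0 - of_real (5 * (m / 2)))"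
    using norm_triangle_ineq4[of "a * a + of_real s0 * a + of_real t0"
        "a * a + of_real s0 * a + of_real t0 - of_real (5 * (m / 2))"] by (simp only: diff_diff_eq2 add_diff_cancel_left')
  ultimately show False using m unfolding norm_of_real by simp
qed

text \<open>Completing the square gives each element a real translate whose square is real. If that
  square is nonnegative the element is real; otherwise, after scaling, its translate squares to -1
  and hence is a real multiple of one fixed \<open>j\<close>, because -1 has only two square roots
  in a field. If all scalars are real, \<open>im\<close> and \<open>j\<close> are 0.\<close>

lemma real_normed_field_cases:
  fixes dummy :: "'k::real_normed_field"
  obtains re im :: "'k \<Rightarrow> real" and j :: 'k
  where "bounded_linear re" "bounded_linear im" "\<And>z. z = of_real (re z) + of_real (im z) * j"
proof (cases "\<forall>z::'k. \<exists>r. z = of_real r")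
  case True
  then obtain re where re: "\<And>z::'k. z = of_real (re z)" by metis
  have "bounded_linear re"
  proof (rule bounded_linear_intro[where K = 1])
    show "re (x + y) = re x + re y" for x y using re by (metis of_real_add of_real_eq_iff)
    show "re (r *\<^sub>R x) = r *\<^sub>R re x" for r x
      using re by (metis of_real_eq_iff of_real_mult scaleR_conv_of_real real_scaleR_def)
    show "norm (re x) \<le> norm x * 1" for x using re[of x] by (metis mult.right_neutral norm_of_real real_norm_def order_refl)
  qed
  then show ?thesis using that[of re "\<lambda>_. 0" 0] re by simp
next
  case False
  then obtain a :: 'k where a: "\<And>r. a \<noteq> of_real r" by blast
  have sq: "\<exists>s D. (z + of_real s)\<^sup>2 = of_real D" for z :: 'k
  proof -
    obtain s t where "z * z + of_real s * z + of_real t = 0" by (rule real_normed_field_quadratic)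
    moreover have "(z + of_real (s / 2))\<^sup>2 = (z * z + of_real s * z + of_real t) + of_real (s\<^sup>2 / 4 - t)"
      by (simp add: power2_eq_square field_simps)
    ultimately have "(z + of_real (s / 2))\<^sup>2 = of_real (s\<^sup>2 / 4 - t)" by simp
    then show ?thesis by blast
  qed
  have pos: "\<exists>r. w = of_real r" if "w\<^sup>2 = of_real D" "D \<ge> 0" for w :: 'k and D
  proof -
    have "w\<^sup>2 = (of_real (sqrt D))\<^sup>2" using that by (simp flip: of_real_power)
    then show ?thesis by (metis of_real_minus power2_eq_iff)
  qed
  obtain s D where D: "(a + of_real s)\<^sup>2 = of_real D" using sq by blast
  have "D < 0"
  proof (rule ccontr)
    assume "\<not> D < 0"
    then obtain r where "a + of_real s = of_real r" using pos[OF D] by auto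
    then have "a = of_real (r - s)" by (simp add: algebra_simps)
    then show False using a by blast
  qed
  define j where "j = (a + of_real s) / of_real (sqrt (- D))"
  have j: "j\<^sup>2 = - 1"
    using \<open>D < 0\<close> D by (simp add: j_def power_divide flip: of_real_power) 
  have nj: "norm j = 1"
  proof -
    have "(norm j)\<^sup>2 = 1" by (metis j norm_minus_cancel norm_one norm_power)
    then show ?thesis by (simp add: power2_eq_1_iff) (smt (verit) norm_ge_zero)
  qed
  have ex: "\<exists>x y. z = of_real x + of_real y * j" for z :: 'k
  proof -
    obtain s D where D: "(z + of_real s)\<^sup>2 = of_real D" using sq by blast
    show ?thesis
    proof (cases "D \<ge> 0")
      case True
      then obtain r where "z + of_real s = of_real r" using pos[OF D] by auto
      then have "z = of_real (r - s) + of_real 0 * j" by (simp add: algebra_simps)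
      then show ?thesis by blast
    next
      case False
      have "(z + of_real s)\<^sup>2 = (of_real (sqrt (- D)) * j)\<^sup>2"
        using False D j by (simp add: power_mult_distrib flip: of_real_power)
      then have "z + of_real s = of_real (sqrt (- D)) * j \<or> z + of_real s = of_real (- sqrt (- D)) * j"
        by (simp add: power2_eq_iff)
      then obtain y where "z + of_real s = of_real y * j" by blast
      then have "z = of_real (- s) + of_real y * j" by (simp add: algebra_simps)
      then show ?thesis by blast
    qed
  qed
  \<comment> \<open>Multiplication by the conjugate bounds the norm from below by the coordinates.
    This yields both the uniqueness of the coordinates and the boundedness of \<open>re\<close> and
    \<open>im\<close>.\<close>
  have lower: "\<bar>x\<bar> + \<bar>y\<bar> \<le> 2 * norm (of_real x + of_real y * j)" for x y
  proof (cases "\<bar>x\<bar> + \<bar>y\<bar> = 0")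
    case False
    have jj: "j * (j * z) = - z" for z using j by (metis mult.assoc mult_minus1 power2_eq_square)
    have "(of_real x + of_real y * j) * (of_real x - of_real y * j) = of_real (x\<^sup>2 + y\<^sup>2)"
      by (simp add: jj power2_eq_square algebra_simps)
    then have "x\<^sup>2 + y\<^sup>2 = norm (of_real x + of_real y * j) * norm (of_real x - of_real y * j)"
      by (metis norm_mult norm_of_real abs_of_nonneg sum_power2_ge_zero)
    also have "\<dots> \<le> norm (of_real x + of_real y * j) * (\<bar>x\<bar> + \<bar>y\<bar>)"
      using norm_triangle_ineq4[of "of_real x" "of_real y * j"] nj by (intro mult_left_mono) (auto simp: norm_mult)
    finally have 1: "x\<^sup>2 + y\<^sup>2 \<le> norm (of_real x + of_real y * j) * (\<bar>x\<bar> + \<bar>y\<bar>)" .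
    have "(\<bar>x\<bar> + \<bar>y\<bar>) * (\<bar>x\<bar> + \<bar>y\<bar>) \<le> 2 * (x\<^sup>2 + y\<^sup>2)"
      using zero_le_power2[of "\<bar>x\<bar> - \<bar>y\<bar>"] by (simp add: power2_eq_square algebra_simps)
    also have "\<dots> \<le> 2 * norm (of_real x + of_real y * j) * (\<bar>x\<bar> + \<bar>y\<bar>)" using 1 by simp
    finally show ?thesis using False by (auto dest: mult_right_le_imp_le)
  next
    case True
    have "0 \<le> 2 * norm (of_real x + of_real y * j)" by simp
    then show ?thesis using True by linarith
  qed
  have uniq: "x = x' \<and> y = y'" if "of_real x + of_real y * j = of_real x' + of_real y' * j" for x y x' y'
  proof -
    have "of_real (x - x') + of_real (y - y') * j = 0" using that by (simp add: algebra_simps)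
    then show ?thesis using lower[of "x - x'" "y - y'"] by (simp only: norm_zero) linarith
  qed
  obtain re im where ri: "\<And>z::'k. z = of_real (re z) + of_real (im z) * j" using ex by metis
  have add: "re (x + y) = re x + re y \<and> im (x + y) = im x + im y" for x y
    by (rule uniq) (use ri[of x] ri[of y] ri[of "x + y"] in \<open>simp add: algebra_simps\<close>)
  have scale: "re (r *\<^sub>R x) = r *\<^sub>R re x \<and> im (r *\<^sub>R x) = r *\<^sub>R im x" for r x
  proof (rule uniq)
    have "of_real (re (r *\<^sub>R x)) + of_real (im (r *\<^sub>R x)) * j = of_real r * (of_real (re x) + of_real (im x) * j)"
      using ri[of x] ri[of "r *\<^sub>R x"] by (simp add: scaleR_conv_of_real)
    then show "of_real (re (r *\<^sub>R x)) + of_real (im (r *\<^sub>R x)) * j = of_real (r *\<^sub>R re x) + of_real (r *\<^sub>R im x) * j"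
      by (simp add: algebra_simps)
  qed
  have bd: "\<bar>re z\<bar> \<le> norm z * 2 \<and> \<bar>im z\<bar> \<le> norm z * 2" for z
    using lower[of "re z" "im z"] ri[of z] by auto
  have "bounded_linear re" "bounded_linear im"
    using add scale bd by (auto intro!: bounded_linear_intro[where K = 2])
  then show ?thesis using that ri by blast
qed

section \<open>Functions of class \<open>C\<^sup>k\<close> on manifolds\<close>

lemma manifold_ck_subset: "manifold_ck atlas k W f \<Longrightarrow> W' \<subseteq> W \<Longrightarrow> manifold_ck atlas k W' f"
  unfolding manifold_ck_def by (fast intro: ck_on_subset)

lemma manifold_ck_const [simp]: "manifold_ck atlas k W (\<lambda>x. c)"
  by (auto simp: manifold_ck_def o_def)

lemma manifold_ck_bounded_linear:
  "bounded_linear L \<Longrightarrow> manifold_ck atlas k W f \<Longrightarrow> manifold_ck atlas k W (\<lambda>x. L (f x))"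
  unfolding manifold_ck_def o_def by (fast intro: ck_on_bounded_linear_compose)

lemma manifold_ck_add:
  "manifold_ck atlas k W f \<Longrightarrow> manifold_ck atlas k W g \<Longrightarrow> manifold_ck atlas k W (\<lambda>x. f x + g x)"
  unfolding manifold_ck_def o_def by (fast intro: ck_on_add)

lemma manifold_ck_sum:
  "(\<And>i. i \<in> I \<Longrightarrow> manifold_ck atlas k W (f i)) \<Longrightarrow> manifold_ck atlas k W (\<lambda>x. \<Sum>i\<in>I. f i x)"
  by (induction I rule: infinite_finite_induct) (auto intro: manifold_ck_add)

lemma manifold_ck_diff:
  "manifold_ck atlas k W f \<Longrightarrow> manifold_ck atlas k W g \<Longrightarrow> manifold_ck atlas k W (\<lambda>x. f x - g x)"
  unfolding manifold_ck_def o_def by (fast intro: ck_on_diff)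

lemma manifold_ck_uminus: "manifold_ck atlas k W f \<Longrightarrow> manifold_ck atlas k W (\<lambda>x. - f x)"
  unfolding manifold_ck_def o_def by (fast intro: ck_on_uminus)

lemma manifold_ck_mult:
  fixes f g :: "'m \<Rightarrow> 'b::real_normed_algebra"
  shows "manifold_ck atlas k W f \<Longrightarrow> manifold_ck atlas k W g \<Longrightarrow> manifold_ck atlas k W (\<lambda>x. f x * g x)"
  unfolding manifold_ck_def o_def by (fast intro: ck_on_mult)

lemma manifold_ck_power:
  fixes f :: "'m \<Rightarrow> 'b::real_normed_field"
  shows "manifold_ck atlas k W f \<Longrightarrow> manifold_ck atlas k W (\<lambda>x. f x ^ n)"
  unfolding manifold_ck_def o_def by (fast intro: ck_on_power)

lemma manifold_ck_pos_part_power: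
  fixes f :: "'m \<Rightarrow> real"
  shows "manifold_ck atlas k W f \<Longrightarrow> manifold_ck atlas k W (\<lambda>x. max 0 (f x) ^ Suc k)"
  unfolding manifold_ck_def o_def by (fast intro: ck_on_pos_part_power)

context smooth_manifold
begin

lemma chart_inj: "(U, \<phi>) \<in> atlas \<Longrightarrow> inj_on \<phi> U"
  using chart[of U \<phi>] by (metis homeomorphism_def inj_on_inverseI)

lemma chart_inv: "(U, \<phi>) \<in> atlas \<Longrightarrow> x \<in> U \<Longrightarrow> inv_into U \<phi> (\<phi> x) = x"
  using chart_inj by (rule inv_into_f_f)

lemma chart_open: "(U, \<phi>) \<in> atlas \<Longrightarrow> open U"
  using chart by blast

lemma chart_continuous: "(U, \<phi>) \<in> atlas \<Longrightarrow> continuous_on U \<phi>"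
  using chart by (blast dest: homeomorphism_cont1)

lemma chart_inv_continuous: "(U, \<phi>) \<in> atlas \<Longrightarrow> continuous_on (\<phi> ` U) (inv_into U \<phi>)"
  using chart by (blast dest: homeomorphism_cont2)

lemma chart_image_subset: "(U, \<phi>) \<in> atlas \<Longrightarrow> \<phi> ` U \<subseteq> E"
  using chart openin_imp_subset by blast

lemma chart_image_open:
  assumes "(U, \<phi>) \<in> atlas" "open W"
  shows "openin (top_of_set E) (\<phi> ` (U \<inter> W))"
proof -
  have "openin (top_of_set (\<phi> ` U)) (\<phi> ` (U \<inter> W))"
    using chart[OF assms(1)] assms(2) by (intro homeomorphism_imp_open_map[of U _ \<phi>]) auto
  then show ?thesis using chart[OF assms(1)] openin_trans by blast
qed

lemma chart_at: obtains U \<phi> where "(U, \<phi>) \<in> atlas" "x \<in> U"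
proof -
  have "x \<in> (\<Union>(U, \<phi>)\<in>atlas. U)" using charts_cover by simp
  then show ?thesis using that by auto
qed

lemma manifold_ck_cong:
  assumes f: "manifold_ck atlas k W f" and eq: "\<And>x. x \<in> W \<Longrightarrow> g x = f x"
  shows "manifold_ck atlas k W g"
  unfolding manifold_ck_def
proof (clarify)
  fix U \<phi> assume U: "(U, \<phi>) \<in> atlas"
  then have "ck_on k (\<phi> ` (U \<inter> W)) (f \<circ> inv_into U \<phi>)" using f by (auto simp: manifold_ck_def)
  then show "ck_on k (\<phi> ` (U \<inter> W)) (g \<circ> inv_into U \<phi>)"
    by (rule ck_on_cong) (use eq chart_inv[OF U] in auto)
qed

lemma manifold_ck_inverse:
  fixes f :: "'m \<Rightarrow> real"
  assumes f: "manifold_ck atlas k W f" and nz: "\<And>x. x \<in> W \<Longrightarrow> f x \<noteq> 0"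
  shows "manifold_ck atlas k W (\<lambda>x. inverse (f x))"
  unfolding manifold_ck_def
proof (clarify)
  fix U \<phi> assume U: "(U, \<phi>) \<in> atlas"
  then have "ck_on k (\<phi> ` (U \<inter> W)) (\<lambda>x. f (inv_into U \<phi> x))" using f by (auto simp: manifold_ck_def o_def)
  then show "ck_on k (\<phi> ` (U \<inter> W)) ((\<lambda>x. inverse (f x)) \<circ> inv_into U \<phi>)"
    unfolding o_def by (rule ck_on_inverse) (use nz chart_inv[OF U] in auto)
qed

lemma manifold_ck_chartD:
  assumes U: "(U, \<phi>) \<in> atlas" and f: "manifold_ck atlas k W f"
  shows "ck_on k (\<phi> ` (U \<inter> W)) (f \<circ> inv_into U \<phi>)"
  using assms by (auto simp: manifold_ck_def)

lemma manifold_ck_Union: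
  assumes "\<And>W. W \<in> \<W> \<Longrightarrow> open W" "\<And>W. W \<in> \<W> \<Longrightarrow> manifold_ck atlas k W f"
  shows "manifold_ck atlas k (\<Union>\<W>) f"
  unfolding manifold_ck_def
proof (clarify)
  fix U \<phi> assume U: "(U, \<phi>) \<in> atlas"
  show "ck_on k (\<phi> ` (U \<inter> \<Union>\<W>)) (f \<circ> inv_into U \<phi>)"
  proof (cases "E = UNIV")
    case True
    have eq: "\<phi> ` (U \<inter> \<Union>\<W>) = \<Union>((\<lambda>W. \<phi> ` (U \<inter> W)) ` \<W>)" by blast
    show ?thesis unfolding eq
      by (rule ck_on_open_Union)
         (use chart_image_open[OF U] assms(1) manifold_ck_chartD[OF U assms(2)] True in auto)
  next
    case False
    then have "\<phi> ` (U \<inter> \<Union>\<W>) \<subseteq> {0}" using chart_image_subset[OF U] model_space by blast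
    then show ?thesis by (rule ck_on_zero_space)
  qed
qed

lemma manifold_ck_local:
  assumes "\<And>x. x \<in> W \<Longrightarrow> \<exists>N. open N \<and> x \<in> N \<and> manifold_ck atlas k (N \<inter> W) f" and "open W"
  shows "manifold_ck atlas k W f"
proof -
  define \<W> where "\<W> = {N. open N \<and> N \<subseteq> W \<and> manifold_ck atlas k N f}"
  have "W = \<Union>\<W>"
  proof
    show "W \<subseteq> \<Union>\<W>"
    proof
      fix x assume "x \<in> W"
      then obtain N where "open N" "x \<in> N" "manifold_ck atlas k (N \<inter> W) f" using assms(1) by blast
      then have "N \<inter> W \<in> \<W>" "x \<in> N \<inter> W" using \<open>x \<in> W\<close> assms(2) by (auto simp: \<W>_def)
      then show "x \<in> \<Union>\<W>" by blast
    qed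
  qed (auto simp: \<W>_def)
  moreover have "manifold_ck atlas k (\<Union>\<W>) f" by (rule manifold_ck_Union) (auto simp: \<W>_def)
  ultimately show ?thesis by simp
qed

lemma manifold_ck_continuous:
  assumes f: "manifold_ck atlas k W f" and W: "open W"
  shows "continuous_on W f"
proof -
  have "continuous_on (U \<inter> W) f" if U: "(U, \<phi>) \<in> atlas" for U \<phi>
  proof -
    have "ck_on k (\<phi> ` (U \<inter> W)) (f \<circ> inv_into U \<phi>)" using f U by (auto simp: manifold_ck_def)
    then have "continuous_on (\<phi> ` (U \<inter> W)) (f \<circ> inv_into U \<phi>)" by (rule ck_on_imp_continuous)
    moreover have "continuous_on (U \<inter> W) \<phi>"
      using chart_continuous[OF U] by (rule continuous_on_subset) simp
    ultimately have "continuous_on (U \<inter> W) ((f \<circ> inv_into U \<phi>) \<circ> \<phi>)"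
      by (rule continuous_on_compose[rotated])
    then show ?thesis
      by (rule continuous_on_eq) (use chart_inv[OF U] in auto)
  qed
  then have "continuous_on (\<Union>((\<lambda>(U, \<phi>). U \<inter> W) ` atlas)) f"
    using W chart_open by (intro continuous_on_open_Union) auto
  moreover have "\<Union>((\<lambda>(U, \<phi>). U \<inter> W) ` atlas) = W" using charts_cover by auto
  ultimately show ?thesis by simp
qed

text \<open>Functions of the coordinates of one chart are tested in all other charts through the
  smooth chart changes.\<close>

lemma manifold_ck_chart:
  assumes U: "(U, \<phi>) \<in> atlas" and u: "ck_on k (\<phi> ` (U \<inter> W)) u"
  shows "manifold_ck atlas k (U \<inter> W) (\<lambda>x. u (\<phi> x))"
  unfolding manifold_ck_def
proof (clarify)
  fix U' \<phi>' assume U': "(U', \<phi>') \<in> atlas"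
  have "ck_on k (\<phi>' ` (U' \<inter> (U \<inter> W))) (\<phi> \<circ> inv_into U' \<phi>')"
    using chart_change[OF U' U] by (rule ck_on_subset) auto
  moreover have "(\<phi> \<circ> inv_into U' \<phi>') ` \<phi>' ` (U' \<inter> (U \<inter> W)) \<subseteq> \<phi> ` (U \<inter> W)"
    using chart_inv[OF U'] by auto
  ultimately have "ck_on k (\<phi>' ` (U' \<inter> (U \<inter> W))) (u \<circ> (\<phi> \<circ> inv_into U' \<phi>'))"
    using u by (intro ck_on_compose)
  then show "ck_on k (\<phi>' ` (U' \<inter> (U \<inter> W))) ((\<lambda>x. u (\<phi> x)) \<circ> inv_into U' \<phi>')"
    by (simp add: o_def)
qed

section \<open>Coordinate balls and bump functions\<close>

lemma closed_model: "closed E"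
  using model_space by auto

lemma chart_ball:
  assumes U: "(U, \<phi>) \<in> atlas" and W: "open W" and x: "x \<in> U" "x \<in> W"
  obtains r where "r > 0" "compact {y \<in> U. dist (\<phi> x) (\<phi> y) \<le> r}"
    "{y \<in> U. dist (\<phi> x) (\<phi> y) \<le> r} \<subseteq> W" "open {y \<in> U. dist (\<phi> x) (\<phi> y) < r}"
proof -
  have "\<phi> x \<in> \<phi> ` (U \<inter> W)" using x by blast
  with chart_image_open[OF U W] obtain r where r: "r > 0" "cball (\<phi> x) r \<inter> E \<subseteq> \<phi> ` (U \<inter> W)"
    unfolding openin_contains_cball by blast
  let ?K = "{y \<in> U. dist (\<phi> x) (\<phi> y) \<le> r}"
  have K: "?K = inv_into U \<phi> ` (cball (\<phi> x) r \<inter> E)"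
  proof
    show "?K \<subseteq> inv_into U \<phi> ` (cball (\<phi> x) r \<inter> E)"
    proof
      fix y assume "y \<in> ?K"
      then have "\<phi> y \<in> cball (\<phi> x) r \<inter> E" "y = inv_into U \<phi> (\<phi> y)"
        using chart_image_subset[OF U] chart_inv[OF U] by auto
      then show "y \<in> inv_into U \<phi> ` (cball (\<phi> x) r \<inter> E)" by blast
    qed
    show "inv_into U \<phi> ` (cball (\<phi> x) r \<inter> E) \<subseteq> ?K"
    proof
      fix y assume "y \<in> inv_into U \<phi> ` (cball (\<phi> x) r \<inter> E)"
      then obtain z where z: "z \<in> cball (\<phi> x) r \<inter> E" "y = inv_into U \<phi> z" by blast
      then have "z \<in> \<phi> ` U" using r by blast
      then have "y \<in> U" "\<phi> y = z" using z(2) by (simp_all add: inv_into_into f_inv_into_f)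
      then show "y \<in> ?K" using z(1) by simp
    qed
  qed
  have "compact ?K" unfolding K
    using chart_inv_continuous[OF U] r(2) closed_model
    by (intro compact_continuous_image compact_Int_closed) (auto elim!: continuous_on_subset)
  moreover have "?K \<subseteq> W"
  proof
    fix y assume "y \<in> ?K"
    then have "\<phi> y \<in> cball (\<phi> x) r \<inter> E" "y \<in> U" using chart_image_subset[OF U] by auto
    then have "\<phi> y \<in> \<phi> ` (U \<inter> W)" "y \<in> U" using r(2) by blast+
    then show "y \<in> W" using chart_inj[OF U] by (auto dest: inj_onD)
  qed
  moreover have "open {y \<in> U. dist (\<phi> x) (\<phi> y) < r}"
  proof -
    have "open (\<phi> -` ball (\<phi> x) r \<inter> U)"
      using chart_continuous[OF U] chart_open[OF U] by (simp add: continuous_on_open_vimage)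
    then show ?thesis by (simp add: vimage_def Int_def conj_commute)
  qed
  ultimately show ?thesis using that r(1) by blast
qed

text \<open>\<open>K\<close> is closed in the whole manifold and not merely in \<open>V\<close>, so
  \<open>V\<close> and \<open>- K\<close> form an open cover, and the extension is of class C^k on
  each of the two.\<close>

lemma manifold_ck_zero_extension:
  assumes V: "open V" and f: "manifold_ck atlas k V f" and K: "closed K" "K \<subseteq> V"
    and z: "\<And>x. x \<in> V - K \<Longrightarrow> f x = 0"
  shows "manifold_ck atlas k UNIV (\<lambda>x. if x \<in> V then f x else 0)"
proof -
  let ?g = "\<lambda>x. if x \<in> V then f x else 0"
  have "manifold_ck atlas k (\<Union>{V, - K}) ?g"
  proof (rule manifold_ck_Union)
    fix W assume "W \<in> {V, - K}"
    then show "manifold_ck atlas k W ?g"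
    proof (elim insertE emptyE)
      assume "W = V" then show ?thesis using f by (auto intro: manifold_ck_cong)
    next
      assume "W = - K" then show ?thesis
        by (intro manifold_ck_cong[OF manifold_ck_const[of atlas k W 0]]) (use z in auto)
    qed
  qed (use V K in auto)
  moreover have "\<Union>{V, - K} = UNIV" using K by auto
  ultimately show ?thesis by simp
qed

text \<open>Since only class C^k is asked for, truncated powers replace the usual exponential. In
  the coordinates \<open>p\<close> vanishes outside the ball of radius r and \<open>q\<close> inside
  the one of radius r/2, so p / (p + q) is defined everywhere and equals 1 near the centre. The
  compact coordinate ball is closed because the manifold is Hausdorff; this permits extension by
  zero.\<close>

lemma bump:
  assumes W: "open W" and x: "x \<in> W"
  obtains b where "manifold_ck atlas k UNIV b" "\<And>y. 0 \<le> b y" "\<And>y. b y \<le> (1::real)"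
    "closure {y. b y \<noteq> 0} \<subseteq> W" "\<exists>N. open N \<and> x \<in> N \<and> (\<forall>y\<in>N. b y = 1)" "compact (closure {y. b y \<noteq> 0})"
proof -
  obtain U \<phi> where U: "(U, \<phi>) \<in> atlas" "x \<in> U" by (rule chart_at)
  obtain r where r: "r > 0" "compact {y \<in> U. dist (\<phi> x) (\<phi> y) \<le> r}"
    "{y \<in> U. dist (\<phi> x) (\<phi> y) \<le> r} \<subseteq> W" "open {y \<in> U. dist (\<phi> x) (\<phi> y) < r}"
    by (rule chart_ball[OF U(1) W U(2) x])
  let ?K = "{y \<in> U. dist (\<phi> x) (\<phi> y) \<le> r}"
  define w where "w z = (\<phi> x - z) \<bullet> (\<phi> x - z)" for z
  have w: "w (\<phi> y) = (dist (\<phi> x) (\<phi> y))\<^sup>2" for y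
    by (simp add: w_def dist_norm power2_norm_eq_inner)
  define p where "p z = max 0 (r\<^sup>2 - w z) ^ Suc k" for z
  define q where "q z = max 0 (w z - (r/2)\<^sup>2) ^ Suc k" for z
  have pq: "p z + q z > 0" for z
  proof -
    have "(r/2)\<^sup>2 < r\<^sup>2" using r(1) by (simp add: power_strict_mono)
    then have "r\<^sup>2 - w z > 0 \<or> w z - (r/2)\<^sup>2 > 0" by linarith
    then show ?thesis by (auto simp: p_def q_def max_def add_pos_nonneg add_nonneg_pos simp del: power_Suc)
  qed
  have pq0: "p z \<ge> 0" "q z \<ge> 0" for z by (simp_all add: p_def q_def)
  define u where "u z = p z * inverse (p z + q z)" for z
  have i: "ck_on k S (\<lambda>z. \<phi> x - z)" for S
    by (intro ck_on_diff ck_on_const ck_on_bounded_linear bounded_linear_ident)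
  have cw: "ck_on k S w" for S
    unfolding w_def by (rule ck_on_bounded_bilinear[OF bounded_bilinear_inner i i])
  have cp: "ck_on k S p" and cq: "ck_on k S q" for S
    unfolding p_def q_def by (intro ck_on_pos_part_power ck_on_diff ck_on_const cw)+
  have cu: "ck_on k S u" for S
    unfolding u_def using pq by (intro ck_on_mult ck_on_inverse ck_on_add cp cq) (metis less_irrefl)
  define b where "b y = (if y \<in> U then u (\<phi> y) else 0)" for y
  have u0: "u (\<phi> y) = 0" if "y \<in> U - ?K" for y
  proof -
    have "r\<^sup>2 \<le> w (\<phi> y)" using that r(1) unfolding w by (intro power_mono) auto
    then show ?thesis by (simp add: u_def p_def)
  qed
  have cl: "closed ?K" using r(2) by (rule compact_imp_closed)
  have cb: "manifold_ck atlas k UNIV b"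
    unfolding b_def using manifold_ck_chart[OF U(1) cu, of UNIV] u0
    by (intro manifold_ck_zero_extension[OF chart_open[OF U(1)] _ cl]) auto
  have sub: "closure {y. b y \<noteq> 0} \<subseteq> ?K"
    using u0 by (intro closure_minimal cl) (auto simp: b_def)
  have "\<exists>N. open N \<and> x \<in> N \<and> (\<forall>y\<in>N. b y = 1)"
  proof -
    let ?N = "\<phi> -` ball (\<phi> x) (r/2) \<inter> U"
    have "open ?N"
      using chart_continuous[OF U(1)] chart_open[OF U(1)] by (simp add: continuous_on_open_vimage)
    moreover have "b y = 1" if y: "y \<in> ?N" for y
    proof -
      have "w (\<phi> y) \<le> (r/2)\<^sup>2" using y r(1) unfolding w by (intro power_mono) auto
      then have "q (\<phi> y) = 0" by (simp add: q_def)
      then show ?thesis using y pq[of "\<phi> y"] by (simp add: b_def u_def)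
    qed
    moreover have "x \<in> ?N" using U(2) r(1) by simp
    ultimately show ?thesis by blast
  qed
  moreover have "0 \<le> b y" "b y \<le> 1" for y
    using pq0[of "\<phi> y"] pq[of "\<phi> y"] by (auto simp: b_def u_def field_simps)
  moreover have "compact (closure {y. b y \<noteq> 0})"
    using compact_Int_closed[OF r(2) closed_closure] sub by (metis inf.absorb_iff2)
  ultimately show ?thesis using that cb sub r(3) by blast
qed

end

section \<open>Derivations on functions of class \<open>C\<^sup>k\<close>\<close>

text \<open>All derivatives up to order \<open>k\<close> vanish at 0, being limits from the left; by
  Taylor the function is therefore o(t^k) on the right as well. The induction integrates the
  estimate for the derivative through the mean value theorem.\<close>

lemma ck_on_flat:
  fixes f :: "real \<Rightarrow> real"
  assumes "ck_on k {-r<..<r} f" "r > 0" "\<And>t. -r < t \<Longrightarrow> t < 0 \<Longrightarrow> f t = 0" "\<epsilon> > 0"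
  shows "\<exists>d>0. \<forall>t. 0 \<le> t \<and> t < d \<longrightarrow> \<bar>f t\<bar> \<le> \<epsilon> * t ^ k"
  using assms
proof (induction k arbitrary: f)
  case (0 f)
  have f0: "f 0 = 0"
  proof -
    have "isCont f 0" using 0 by (auto simp: continuous_on_eq_continuous_at)
    then have "(f \<longlongrightarrow> f 0) (at_left 0)" by (simp add: isCont_def filterlim_at_split)
    moreover have "\<forall>\<^sub>F t in at_left 0. f t = 0"
      using 0(2,3) by (auto simp: eventually_at_left_field intro!: exI[of _ "-r"])
    then have "(f \<longlongrightarrow> 0) (at_left 0)" by (rule tendsto_eventually)
    ultimately show ?thesis using tendsto_unique trivial_limit_at_left_real by blast
  qed
  have "isCont f 0" using 0 by (auto simp: continuous_on_eq_continuous_at)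
  then obtain d where "d > 0" "\<forall>t. dist t 0 < d \<longrightarrow> dist (f t) (f 0) < \<epsilon>"
    using 0(4) unfolding continuous_at_eps_delta by (auto simp: dist_real_def)
  then show ?case using f0 by (intro exI[of _ d]) (auto simp: dist_real_def less_imp_le)
next
  case (Suc k f)
  obtain f' where f': "\<forall>x\<in>{-r<..<r}. (f has_derivative f' x) (at x within {-r<..<r})"
    "\<forall>v. ck_on k {-r<..<r} (\<lambda>x. f' x v)"
    using Suc.prems(1) unfolding ck_on.simps(2) by blast
  define g where "g x = f' x 1" for x
  have g: "(f has_real_derivative g x) (at x)" if "x \<in> {-r<..<r}" for x
  proof -
    have d: "(f has_derivative f' x) (at x)"
      using f'(1) that by (metis at_within_open open_greaterThanLessThan)
    have "f' x = (*) (g x)"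
    proof
      fix v
      show "f' x v = g x * v"
        using linear_cmul[OF has_derivative_linear[OF d], of v 1] by (simp add: g_def)
    qed
    then show ?thesis using d by (simp add: has_field_derivative_def)
  qed
  have g0: "g t = 0" if "-r < t" "t < 0" for t
  proof -
    have "((\<lambda>_. 0) has_real_derivative g t) (at t)"
      by (rule has_field_derivative_transform_within_open[of f _ _ "{-r<..<0}"])
         (use g[of t] that Suc.prems(2,3) in auto)
    then show ?thesis using DERIV_unique DERIV_const by blast
  qed
  obtain d where d: "d > 0" "\<forall>t. 0 \<le> t \<and> t < d \<longrightarrow> \<bar>g t\<bar> \<le> \<epsilon> * t ^ k"
    using Suc.IH[of g] f'(2) Suc.prems(2,4) g0 unfolding g_def by blast
  have f0: "f 0 = 0"
  proof -
    have "isCont f 0" using g[of 0] Suc.prems(2) by (auto intro: DERIV_isCont)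
    then have "(f \<longlongrightarrow> f 0) (at_left 0)" by (simp add: isCont_def filterlim_at_split)
    moreover have "\<forall>\<^sub>F t in at_left 0. f t = 0"
      using Suc.prems(2,3) by (auto simp: eventually_at_left_field intro!: exI[of _ "-r"])
    then have "(f \<longlongrightarrow> 0) (at_left 0)" by (rule tendsto_eventually)
    ultimately show ?thesis using tendsto_unique trivial_limit_at_left_real by blast
  qed
  have "\<bar>f t\<bar> \<le> \<epsilon> * t ^ Suc k" if t: "0 \<le> t" "t < min d r" for t
  proof (cases "t = 0")
    case False
    then have "0 < t" using t by simp
    then obtain z where z: "0 < z" "z < t" "f t - f 0 = (t - 0) * g z"
      using MVT2[of 0 t f g] g t by auto
    have "\<bar>g z\<bar> \<le> \<epsilon> * z ^ k" using d(2) z t by auto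
    also have "\<dots> \<le> \<epsilon> * t ^ k" using z Suc.prems(4) by (intro mult_left_mono power_mono) auto
    finally have "t * \<bar>g z\<bar> \<le> t * (\<epsilon> * t ^ k)" using t by (intro mult_left_mono) auto
    then show ?thesis using z f0 t by (simp add: abs_mult mult_ac)
  qed (use f0 in simp)
  then show ?case using d(1) Suc.prems(2) by (intro exI[of _ "min d r"]) auto
qed

lemma ck_on_line:
  fixes f :: "'a::euclidean_space \<Rightarrow> real"
  assumes "ck_on k S f" "(\<lambda>t. z + t *\<^sub>R v) ` T \<subseteq> S"
  shows "ck_on k T (\<lambda>t. f (z + t *\<^sub>R v))"
proof -
  have "ck_on k T (\<lambda>t. z + t *\<^sub>R v)"
    by (intro ck_on_add ck_on_const ck_on_bounded_linear bounded_linear_scaleR_left)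
  then have "ck_on k T (f \<circ> (\<lambda>t. z + t *\<^sub>R v))" using assms by (intro ck_on_compose)
  then show ?thesis by (simp add: o_def)
qed

text \<open>The arguments are global functions while the values are used over \<open>V\<close> only:
  the instance is a real coordinate of a section in a trivialization over \<open>V\<close>.\<close>

locale ck_derivation = smooth_manifold E atlas
  for E :: "'e::euclidean_space set" and atlas :: "('m::t2_space set \<times> ('m \<Rightarrow> 'e)) set" +
  fixes k :: nat and V :: "'m set" and \<delta> :: "('m \<Rightarrow> real) \<Rightarrow> 'm \<Rightarrow> real"
  assumes open_domain: "open V"
    and ck: "\<And>f. manifold_ck atlas k UNIV f \<Longrightarrow> manifold_ck atlas k V (\<delta> f)"
    and add: "\<And>f g x. manifold_ck atlas k UNIV f \<Longrightarrow> manifold_ck atlas k UNIV g \<Longrightarrow> x \<in> V \<Longrightarrow>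
      \<delta> (\<lambda>x. f x + g x) x = \<delta> f x + \<delta> g x"
    and const: "\<And>c x. x \<in> V \<Longrightarrow> \<delta> (\<lambda>_. c) x = 0"
    and leibniz: "\<And>f g x. manifold_ck atlas k UNIV f \<Longrightarrow> manifold_ck atlas k UNIV g \<Longrightarrow> x \<in> V \<Longrightarrow>
      \<delta> (\<lambda>x. f x * g x) x = f x * \<delta> g x + g x * \<delta> f x"
begin

text \<open>With a bump \<open>b\<close> that is 1 at \<open>x\<close> and supported in
  \<open>N\<close>, the product b f is identically 0, and the Leibniz rule at \<open>x\<close> reads
  0 = \<delta> f x.\<close>

lemma local_zero:
  assumes f: "manifold_ck atlas k UNIV f" and x: "x \<in> V" and N: "open N" "x \<in> N" "\<And>y. y \<in> N \<Longrightarrow> f y = 0"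
  shows "\<delta> f x = 0"
proof -
  obtain b where b: "manifold_ck atlas k UNIV b" "closure {y. b y \<noteq> 0} \<subseteq> N"
    "\<exists>N'. open N' \<and> x \<in> N' \<and> (\<forall>y\<in>N'. b y = (1::real))"
    by (rule bump[OF N(1,2)])
  have "(\<lambda>y. b y * f y) = (\<lambda>_. 0)" using N(3) b(2) closure_subset[of "{y. b y \<noteq> 0}"] by fastforce
  then have "\<delta> (\<lambda>y. b y * f y) x = 0" using const[OF x, of 0] by simp
  then show ?thesis using leibniz[OF b(1) f x] b(3) N by auto
qed

lemma local_eq:
  assumes f: "manifold_ck atlas k UNIV f" and g: "manifold_ck atlas k UNIV g"
    and x: "x \<in> V" and N: "open N" "x \<in> N" "\<And>y. y \<in> N \<Longrightarrow> f y = g y"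
  shows "\<delta> f x = \<delta> g x"
proof -
  have d: "manifold_ck atlas k UNIV (\<lambda>y. f y - g y)" using f g by (rule manifold_ck_diff)
  have "\<delta> (\<lambda>y. f y - g y) x = 0" using local_zero[OF d x N(1,2)] N(3) by simp
  then show ?thesis using add[OF g d x] by simp
qed

lemma power_rule:
  assumes f: "manifold_ck atlas k UNIV f" and x: "x \<in> V"
  shows "\<delta> (\<lambda>y. f y ^ Suc n) x = real (Suc n) * f x ^ n * \<delta> f x"
proof (induction n)
  case (Suc n)
  show ?case using leibniz[OF f manifold_ck_power[OF f, of "Suc n"] x] Suc.IH
    by (simp add: algebra_simps)
qed simp

text \<open>A continuous function vanishing at \<open>x\<close> is p^2 - q^2 with continuous
  \<open>p\<close> and \<open>q\<close> vanishing at \<open>x\<close>, and the Leibniz rule kills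
  both squares there. The square roots are what confines this argument to k = 0.\<close>

lemma zero_order_0:
  assumes k: "k = 0" and f: "manifold_ck atlas k UNIV f" and x: "x \<in> V" and fx: "f x = 0"
  shows "\<delta> f x = 0"
proof -
  define p where "p y = sqrt (max 0 (f y))" for y
  define q where "q y = sqrt (max 0 (- f y))" for y
  have p: "manifold_ck atlas k UNIV p" and q: "manifold_ck atlas k UNIV q"
    using f unfolding manifold_ck_def k p_def q_def o_def by (auto intro!: continuous_intros)
  have q': "manifold_ck atlas k UNIV (\<lambda>y. - q y)" using q by (rule manifold_ck_uminus)
  have "f = (\<lambda>y. p y * p y + (- q y) * q y)"
    by (rule ext) (simp add: p_def q_def max_def)
  then have "\<delta> f x = \<delta> (\<lambda>y. p y * p y + (- q y) * q y) x" by simp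
  also have "\<dots> = \<delta> (\<lambda>y. p y * p y) x + \<delta> (\<lambda>y. (- q y) * q y) x"
    by (rule add[OF manifold_ck_mult[OF p p] manifold_ck_mult[OF q' q] x])
  also have "\<dots> = 0"
    using leibniz[OF p p x] leibniz[OF q' q x] fx by (simp add: p_def q_def)
  finally show ?thesis .
qed

text \<open>
  If \<open>f\<close> has nonzero differential at \<open>x\<close> then \<open>max 0 f ^ (k + 1)\<close> is only just \<open>C\<^sup>k\<close>, so that the
  value of \<open>\<delta>\<close> on it, which is \<open>(k + 1) f\<^sup>k \<delta> f\<close> where \<open>f > 0\<close> and \<open>0\<close> where \<open>f < 0\<close>, can be \<open>C\<^sup>k\<close> only if
  \<open>\<delta> f\<close> vanishes at \<open>x\<close>.
\<close>
lemma zero_regular: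
  assumes E: "E = UNIV" and U: "(U, \<phi>) \<in> atlas" "x \<in> U"
    and f: "manifold_ck atlas k UNIV f" and x: "x \<in> V"
    and der: "((f \<circ> inv_into U \<phi>) has_derivative f') (at (\<phi> x))" and v: "f' v \<noteq> 0"
  shows "\<delta> f x = 0"
proof -
  define z where "z = \<phi> x"
  define S where "S = \<phi> ` (U \<inter> V)"
  have S: "open S" "z \<in> S" using chart_image_open[OF U(1) open_domain] U(2) x E by (auto simp: S_def z_def)
  \<comment> \<open>The direction is scaled so that \<open>f\<close> has slope 1 along the line
    \<open>L\<close> through the image of \<open>x\<close>.\<close>
  define w where "w = (1 / f' v) *\<^sub>R v"
  have lin: "linear f'" using der by (rule has_derivative_linear)
  have w: "f' w = 1" using v linear_cmul[OF lin] by (simp add: w_def)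
  define L where "L t = z + t *\<^sub>R w" for t
  have Lc: "continuous_on UNIV L" unfolding L_def by (intro continuous_intros)
  have L0: "L 0 = z" by (simp add: L_def)
  have "open (L -` S)" by (intro open_vimage S(1) Lc)
  then obtain r0 where r0: "r0 > 0" "\<And>t. \<bar>t\<bar> < r0 \<Longrightarrow> L t \<in> S"
    using S(2) L0 unfolding open_dist by (force simp: dist_real_def)
  define g where "g y = f y - f x" for y
  have g: "manifold_ck atlas k UNIV g" unfolding g_def by (intro manifold_ck_diff f manifold_ck_const)
  have dg: "\<delta> g y = \<delta> f y" if "y \<in> V" for y
    using add[OF g manifold_ck_const[of atlas k UNIV "f x"] that] const[OF that, of "f x"] by (simp add: g_def)
  define h where "h t = g (inv_into U \<phi> (L t))" for t
  have hx: "inv_into U \<phi> z = x" using chart_inv[OF U] by (simp add: z_def)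
  have "(L has_derivative (\<lambda>t. t *\<^sub>R w)) (at 0)"
    unfolding L_def by (auto intro!: derivative_eq_intros)
  then have "((f \<circ> inv_into U \<phi>) \<circ> L has_derivative (f' \<circ> (\<lambda>t. t *\<^sub>R w))) (at 0)"
    by (rule diff_chain_at) (use der L0 z_def in simp)
  then have "((\<lambda>t. (f \<circ> inv_into U \<phi>) (L t) - f x) has_derivative (\<lambda>t. t * 1)) (at 0)"
    using w linear_cmul[OF lin] by (auto intro!: derivative_eq_intros simp: o_def)
  then have dh: "(h has_real_derivative 1) (at 0)"
    unfolding h_def g_def has_field_derivative_def o_def by (rule has_derivative_eq_rhs) auto
  have h0: "h 0 = 0" by (simp add: h_def L0 hx g_def)
  have "((\<lambda>t. h t / t) \<longlongrightarrow> 1) (at 0)" using dh h0 by (simp add: DERIV_def)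
  then have "\<forall>\<^sub>F t in at 0. dist (h t / t) 1 < 1/2" by (rule tendstoD) simp
  then obtain r1 where r1: "r1 > 0" "\<And>t. t \<noteq> 0 \<Longrightarrow> \<bar>t\<bar> < r1 \<Longrightarrow> \<bar>h t / t - 1\<bar> < 1/2"
    unfolding eventually_at by (auto simp: dist_real_def)
  define r where "r = min r0 r1"
  have r: "r > 0" using r0 r1 by (simp add: r_def)
  \<comment> \<open>Slope above 1/2 gives \<open>h\<close> the sign of t near 0, and the lower bound
    t/2 to the right of 0.\<close>
  have ratio: "h t / t > 1/2" if "t \<noteq> 0" "\<bar>t\<bar> < r" for t
    using r1(2)[of t] that unfolding r_def by linarith
  have hpos: "h t \<ge> t / 2" if "0 < t" "t < r" for t
    using ratio[of t] that by (simp add: field_simps)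
  have hneg: "h t < 0" if "- r < t" "t < 0" for t
  proof -
    have "1/2 < h t / t" using that by (intro ratio) auto
    then have "0 < h t / t" by linarith
    then show ?thesis using that by (simp add: zero_less_divide_iff)
  qed
  define P where "P y = max 0 (g y) ^ Suc k" for y
  have P: "manifold_ck atlas k UNIV P" unfolding P_def by (rule manifold_ck_pos_part_power[OF g])
  have gc: "continuous_on UNIV g" using manifold_ck_continuous[OF g] by simp
  have dP: "\<delta> P y = real (Suc k) * g y ^ k * \<delta> g y" if "g y > 0" "y \<in> V" for y
  proof -
    have o: "open (g -` {0<..})" by (intro open_vimage gc) auto
    have "\<delta> P y = \<delta> (\<lambda>y. g y ^ Suc k) y"
      by (rule local_eq[OF P manifold_ck_power[OF g] that(2) o]) (use that(1) in \<open>auto simp: P_def max_def\<close>)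
    then show ?thesis using power_rule[OF g that(2)] by simp
  qed
  have dP0: "\<delta> P y = 0" if "g y < 0" "y \<in> V" for y
  proof -
    have o: "open (g -` {..<0})" by (intro open_vimage gc) auto
    show ?thesis
      by (rule local_zero[OF P that(2) o]) (use that(1) in \<open>auto simp: P_def max_def\<close>)
  qed
  define \<psi> where "\<psi> t = \<delta> P (inv_into U \<phi> (L t))" for t
  define \<omega> where "\<omega> t = \<delta> g (inv_into U \<phi> (L t))" for t
  have LS: "(\<lambda>t. z + t *\<^sub>R w) ` {-r<..<r} \<subseteq> S" using r0(2) by (auto simp: L_def r_def)
  have LV: "inv_into U \<phi> (L t) \<in> V" if "-r < t" "t < r" for t
  proof -
    have "L t \<in> S" using r0(2)[of t] that by (auto simp: r_def)
    then show ?thesis using chart_inv[OF U(1)] by (auto simp: S_def)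
  qed
  have "ck_on k {-r<..<r} \<psi>"
    using ck_on_line[OF manifold_ck_chartD[OF U(1) ck[OF P], folded S_def] LS] by (simp add: \<psi>_def[abs_def] L_def)
  have \<omega>c: "ck_on k {-r<..<r} \<omega>"
    using ck_on_line[OF manifold_ck_chartD[OF U(1) ck[OF g], folded S_def] LS] by (simp add: \<omega>_def[abs_def] L_def)
  have \<psi>neg: "\<psi> t = 0" if "-r < t" "t < 0" for t
    using dP0 hneg[OF that] LV that r by (simp add: \<psi>_def h_def)
  \<comment> \<open>The factor k + 1 is at least 1 and may be dropped from a lower bound.\<close>
  have \<psi>pos: "\<bar>\<omega> t\<bar> * (t / 2) ^ k \<le> \<bar>\<psi> t\<bar>" if "0 < t" "t < r" for t
  proof -
    have "\<psi> t = real (Suc k) * h t ^ k * \<omega> t"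
      using dP[of "inv_into U \<phi> (L t)"] hpos[OF that] that LV by (simp add: \<psi>_def h_def \<omega>_def)
    moreover have "(t / 2) ^ k \<le> h t ^ k" using hpos[OF that] that by (intro power_mono) auto
    then have "1 * (t / 2) ^ k \<le> real (Suc k) * h t ^ k" using that by (intro mult_mono) auto
    ultimately show ?thesis
      using mult_right_mono[of "(t / 2) ^ k" "real (Suc k) * h t ^ k" "\<bar>\<omega> t\<bar>"] hpos[OF that] that
      by (simp add: abs_mult mult_ac)
  qed
  \<comment> \<open>To the right of 0 the function \<psi> is at least |\<omega>| (t/2)^k in absolute
    value, but being flat from the left it is o(t^k). The constant \<epsilon> / 2^k offsets the
    halving of t.\<close>
  have small: "\<bar>\<omega> 0\<bar> \<le> \<epsilon>" if \<epsilon>: "\<epsilon> > 0" for \<epsilon>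
  proof -
    obtain d where d: "d > 0" "\<forall>t. 0 \<le> t \<and> t < d \<longrightarrow> \<bar>\<psi> t\<bar> \<le> (\<epsilon> / 2 ^ k) * t ^ k"
      using ck_on_flat[OF \<open>ck_on k {-r<..<r} \<psi>\<close> r \<psi>neg, of "\<epsilon> / 2 ^ k"] \<epsilon> by auto
    have le: "\<bar>\<omega> t\<bar> \<le> \<epsilon>" if t: "0 < t" "t < min d r" for t
    proof -
      have "\<bar>\<omega> t\<bar> * (t / 2) ^ k \<le> (\<epsilon> / 2 ^ k) * t ^ k" using \<psi>pos[of t] d(2) t by (force intro: order_trans)
      also have "\<dots> = \<epsilon> * (t / 2) ^ k" by (simp add: power_divide)
      finally show ?thesis using t by simp
    qed
    have "isCont \<omega> 0"
      using ck_on_imp_continuous[OF \<omega>c] r by (auto simp: continuous_on_eq_continuous_at)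
    then have "((\<lambda>t. \<bar>\<omega> t\<bar>) \<longlongrightarrow> \<bar>\<omega> 0\<bar>) (at_right 0)"
      by (intro tendsto_rabs) (simp add: isCont_def filterlim_at_split)
    moreover have "\<forall>\<^sub>F t in at_right 0. \<bar>\<omega> t\<bar> \<le> \<epsilon>"
      using le d(1) r by (auto simp: eventually_at_right_field intro!: exI[of _ "min d r"])
    ultimately show ?thesis by (rule tendsto_upperbound) simp
  qed
  have "\<omega> 0 = 0" using small[of "\<bar>\<omega> 0\<bar> / 2"] by (cases "\<omega> 0 = 0") auto
  then show ?thesis using dg[OF x] by (simp add: \<omega>_def L0 hx)
qed

text \<open>In dimension zero every point is open, so that \<open>f\<close> is locally constant.
  Otherwise, if \<open>f\<close> has zero derivative in a coordinate direction \<open>v\<close>, a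
  local coordinate \<open>u\<close> is added: both \<open>u\<close> and f + u have nonzero
  differential at \<open>x\<close>, so \<delta> vanishes on both and hence on
  \<open>f\<close>.\<close>

lemma zero:
  assumes f: "manifold_ck atlas k UNIV f" and x: "x \<in> V"
  shows "\<delta> f x = 0"
proof -
  obtain U \<phi> where U: "(U, \<phi>) \<in> atlas" "x \<in> U" by (rule chart_at)
  consider "k = 0" | "E \<noteq> UNIV" | "k > 0" "E = UNIV" by blast
  then show ?thesis
  proof cases
    case 1
    have d: "manifold_ck atlas k UNIV (\<lambda>y. f y - f x)" by (intro manifold_ck_diff f manifold_ck_const)
    then have "\<delta> (\<lambda>y. f y - f x) x = 0" using zero_order_0[OF 1] x by simp
    then show ?thesis
      using add[OF d manifold_ck_const[of atlas k UNIV "f x"] x] const[OF x, of "f x"] by simp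
  next
    case 2
    then have "\<phi> ` U \<subseteq> {0}" using chart_image_subset[OF U(1)] model_space by blast
    then have "y = x" if "y \<in> U" for y
      using that U(2) chart_inj[OF U(1)] by (metis image_subset_iff inj_onD singletonD)
    then have "\<delta> f x = \<delta> (\<lambda>_. f x) x"
      by (intro local_eq[OF f manifold_ck_const x chart_open[OF U(1)] U(2)]) auto
    then show ?thesis using const[OF x] by simp
  next
    case 3
    obtain m where m: "k = Suc m" using 3 by (cases k) auto
    have op: "open (\<phi> ` U)" "\<phi> x \<in> \<phi> ` U"
      using chart_image_open[OF U(1) open_UNIV] U(2) 3 by auto
    have dex: "\<exists>h'. ((h \<circ> inv_into U \<phi>) has_derivative h') (at (\<phi> x))"
      if "manifold_ck atlas k UNIV h" for h :: "'m \<Rightarrow> real"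
    proof -
      have "ck_on (Suc m) (\<phi> ` U) (h \<circ> inv_into U \<phi>)"
        using manifold_ck_chartD[OF U(1) that] m by simp
      then obtain h' where "\<forall>x\<in>\<phi> ` U. ((h \<circ> inv_into U \<phi>) has_derivative h' x) (at x within \<phi> ` U)"
        unfolding ck_on.simps(2) by blast
      then have "((h \<circ> inv_into U \<phi>) has_derivative h' (\<phi> x)) (at (\<phi> x) within \<phi> ` U)" using op by blast
      then show ?thesis using op by (metis at_within_open)
    qed
    obtain f' where f': "((f \<circ> inv_into U \<phi>) has_derivative f') (at (\<phi> x))" using dex[OF f] by blast
    obtain v :: 'e where v: "v \<in> Basis" using nonempty_Basis by blast
    obtain b where b: "manifold_ck atlas k UNIV b" "closure {y. b y \<noteq> 0} \<subseteq> U"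
      "\<exists>N. open N \<and> x \<in> N \<and> (\<forall>y\<in>N. b y = (1::real))"
      by (rule bump[OF chart_open[OF U(1)] U(2)])
    then obtain N where N: "open N" "x \<in> N" "\<And>y. y \<in> N \<Longrightarrow> b y = 1" by blast
    \<comment> \<open>The coordinate in direction \<open>v\<close>, cut off to be globally defined
      and unchanged near \<open>x\<close>.\<close>
    define u where "u y = (if y \<in> U then b y * (\<phi> y \<bullet> v) else 0)" for y
    have u: "manifold_ck atlas k UNIV u"
      unfolding u_def
    proof (rule manifold_ck_zero_extension[OF chart_open[OF U(1)] _ closed_closure b(2)])
      have "manifold_ck atlas k (U \<inter> UNIV) (\<lambda>y. \<phi> y \<bullet> v)"
        by (rule manifold_ck_chart[OF U(1), where u = "\<lambda>z. z \<bullet> v"])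
           (rule ck_on_bounded_linear[OF bounded_linear_inner_left])
      then show "manifold_ck atlas k U (\<lambda>y. b y * (\<phi> y \<bullet> v))"
        using manifold_ck_subset[OF b(1)] by (intro manifold_ck_mult) auto
    next
      fix y assume "y \<in> U - closure {y. b y \<noteq> 0}"
      then have "b y = 0" using closure_subset[of "{y. b y \<noteq> 0}"] by auto
      then show "b y * (\<phi> y \<bullet> v) = 0" by simp
    qed
    have du: "((u \<circ> inv_into U \<phi>) has_derivative (\<lambda>y. y \<bullet> v)) (at (\<phi> x))"
    proof (rule has_derivative_transform_within_open)
      show "((\<lambda>y. y \<bullet> v) has_derivative (\<lambda>y. y \<bullet> v)) (at (\<phi> x))" by (auto intro!: derivative_eq_intros)
      show "open (\<phi> ` (U \<inter> N))" using chart_image_open[OF U(1) N(1)] 3 by simp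
      show "\<phi> x \<in> \<phi> ` (U \<inter> N)" using U(2) N(2) by blast
      fix y assume "y \<in> \<phi> ` (U \<inter> N)"
      then show "y \<bullet> v = (u \<circ> inv_into U \<phi>) y"
        using N(3) chart_inv[OF U(1)] by (auto simp: u_def)
    qed
    have u0: "\<delta> u x = 0"
      by (rule zero_regular[OF 3(2) U u x du, of v]) (use v in \<open>simp add: inner_Basis\<close>)
    show ?thesis
    proof (cases "f' v = 0")
      case False
      then show ?thesis by (rule zero_regular[OF 3(2) U f x f'])
    next
      case True
      have fu: "manifold_ck atlas k UNIV (\<lambda>y. f y + u y)" using f u by (rule manifold_ck_add)
      have "(((\<lambda>y. f y + u y) \<circ> inv_into U \<phi>) has_derivative (\<lambda>y. f' y + y \<bullet> v)) (at (\<phi> x))"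
        using has_derivative_add[OF f' du] by (simp add: o_def)
      then have "\<delta> (\<lambda>y. f y + u y) x = 0"
        by (rule zero_regular[OF 3(2) U fu x, of _ v]) (use v True in \<open>simp add: inner_Basis\<close>)
      then show ?thesis using add[OF f u x] u0 by simp
    qed
  qed
qed

end

section \<open>Exhaustions and bump functions\<close>

context smooth_manifold
begin

text \<open>A connected, locally compact and paracompact space is \<sigma>-compact. Starting from
  one member of a locally finite cover by relatively compact sets, all members meeting the closures
  reached so far are added; each stage is finite, and the union is open and closed. Local
  compactness comes from the compact supports of bump functions.\<close>

lemma compact_exhaustion:
  obtains K :: "nat \<Rightarrow> 'm set" where "K 0 = {}" "\<And>n. compact (K n)" "\<And>n. K n \<subseteq> interior (K (Suc n))" "(\<Union>n. K n) = UNIV"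
proof -
  define \<U> where "\<U> = {N :: 'm set. open N \<and> compact (closure N)}"
  have "x \<in> \<Union>\<U>" for x
  proof -
    obtain b :: "'m \<Rightarrow> real" where b: "manifold_ck atlas 0 UNIV b" "compact (closure {y. b y \<noteq> 0})"
        "\<exists>N. open N \<and> x \<in> N \<and> (\<forall>y\<in>N. b y = 1)"
      by (rule bump[OF open_UNIV, of x 0]) auto
    have "open {y. b y \<noteq> 0}"
      using manifold_ck_continuous[OF b(1)] by (simp add: open_Collect_neq)
    then have "{y. b y \<noteq> 0} \<in> \<U>" using b by (simp add: \<U>_def)
    moreover have "x \<in> {y. b y \<noteq> 0}" using b(3) by auto
    ultimately show ?thesis by blast
  qed
  then have "(\<forall>U\<in>\<U>. open U) \<and> \<Union>\<U> = UNIV" by (auto simp: \<U>_def)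
  then obtain \<V> where \<V>: "\<forall>V\<in>\<V>. open V \<and> (\<exists>U\<in>\<U>. V \<subseteq> U)" "\<Union>\<V> = UNIV" "locally_finite_in euclidean \<V>"
    using paracompact[unfolded paracompact_def, THEN spec, THEN mp] by metis
  have covV: "\<exists>V\<in>\<V>. x \<in> V" for x using \<V>(2) by (metis UNIV_I UnionE)
  have comp: "compact (closure V)" if V: "V \<in> \<V>" for V
  proof -
    obtain U where "U \<in> \<U>" "V \<subseteq> U" using \<V>(1) V by blast
    then have "compact (closure U)" "closure V \<subseteq> closure U" using closure_mono[of V U] by (auto simp: \<U>_def)
    then show ?thesis using compact_Int_closed[of "closure U" "closure V"] by (simp add: inf.absorb2)
  qed
  have fin: "finite {V \<in> \<V>. V \<inter> C \<noteq> {}}" if C: "compact C" for C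
  proof -
    have "\<forall>x. \<exists>N. open N \<and> x \<in> N \<and> finite {V \<in> \<V>. V \<inter> N \<noteq> {}}"
      using \<V>(3) unfolding locally_finite_in_def by simp
    then obtain N where N: "\<And>x. open (N x)" "\<And>x. x \<in> N x" "\<And>x. finite {V \<in> \<V>. V \<inter> N x \<noteq> {}}"
      by metis
    have CN: "C \<subseteq> (\<Union>x\<in>UNIV. N x)" using N(2) by auto
    obtain D where D: "D \<subseteq> UNIV" "finite D" "C \<subseteq> (\<Union>x\<in>D. N x)"
      by (rule compactE_image[OF C N(1) CN])
    have "{V \<in> \<V>. V \<inter> C \<noteq> {}} \<subseteq> (\<Union>x\<in>D. {V \<in> \<V>. V \<inter> N x \<noteq> {}})" using D(3) by blast
    moreover have "finite (\<Union>x\<in>D. {V \<in> \<V>. V \<inter> N x \<noteq> {}})" using D(2) N(3) by blast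
    ultimately show ?thesis by (rule finite_subset)
  qed
  obtain V0 where V0: "V0 \<in> \<V>" "V0 \<noteq> {}" using \<V>(2) by fastforce
  define G where "G = rec_nat {V0} (\<lambda>_ G. {V \<in> \<V>. V \<inter> \<Union>(closure ` G) \<noteq> {}})"
  have G0: "G 0 = {V0}" and GS: "G (Suc n) = {V \<in> \<V>. V \<inter> \<Union>(closure ` G n) \<noteq> {}}" for n
    by (simp_all add: G_def)
  have G: "finite (G n) \<and> G n \<subseteq> \<V>" for n
  proof (induction n)
    case (Suc n)
    then have "compact (\<Union>(closure ` G n))" using comp by (intro compact_Union) auto
    then show ?case using fin by (simp add: GS)
  qed (use V0 in \<open>simp add: G0\<close>)
  define L where "L n = \<Union>(closure ` G n)" for n
  have Lc: "compact (L n)" for n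
    unfolding L_def using G[of n] comp by (intro compact_Union) auto
  have Li: "L n \<subseteq> interior (L (Suc n))" for n
  proof
    fix x assume x: "x \<in> L n"
    obtain V where V: "V \<in> \<V>" "x \<in> V" using covV[of x] by blast
    then have "V \<in> G (Suc n)" using x by (auto simp: GS L_def)
    then have "V \<subseteq> L (Suc n)" using closure_subset[of V] by (auto simp: L_def)
    then show "x \<in> interior (L (Suc n))" using V \<V>(1) by (intro interiorI[of V]) auto
  qed
  have "open (\<Union>n. L n)"
  proof -
    have "(\<Union>n. L n) = (\<Union>n. interior (L n))"
    proof
      show "(\<Union>n. L n) \<subseteq> (\<Union>n. interior (L n))" using Li by (intro UN_least) (metis SUP_upper2 UNIV_I)
      show "(\<Union>n. interior (L n)) \<subseteq> (\<Union>n. L n)" by (intro UN_mono interior_subset order_refl)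
    qed
    then show ?thesis by (metis open_UN open_interior)
  qed
  \<comment> \<open>A member of the cover that meets stage n belongs to stage n + 1. Hence a member
    containing a point outside the union misses the union altogether.\<close>
  moreover have "open (- (\<Union>n. L n))"
  proof (subst open_subopen, intro ballI)
    fix x assume x: "x \<in> - (\<Union>n. L n)"
    obtain V where V: "V \<in> \<V>" "x \<in> V" using covV[of x] by blast
    have "V \<subseteq> - (\<Union>n. L n)"
    proof (rule ccontr)
      assume "\<not> ?thesis"
      then obtain n where "V \<inter> L n \<noteq> {}" by blast
      then have "V \<in> G (Suc n)" using V by (simp add: GS L_def)
      then have "x \<in> L (Suc n)" using V closure_subset[of V] by (auto simp: L_def)
      then show False using x by blast
    qed
    then show "\<exists>T. open T \<and> x \<in> T \<and> T \<subseteq> - (\<Union>n. L n)" using V \<V>(1) by blast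
  qed
  moreover have "(\<Union>n. L n) \<noteq> {}"
  proof -
    have "V0 \<subseteq> L 0" using closure_subset[of V0] by (simp add: L_def G0)
    then show ?thesis using V0 by blast
  qed
  moreover have "\<forall>T::'m set. open T \<and> open (- T) \<longrightarrow> T = {} \<or> T = UNIV"
    using connected unfolding connected_clopen by (simp add: closed_def)
  ultimately have un: "(\<Union>n. L n) = UNIV" by blast
  show ?thesis
  \<comment> \<open>The empty set is put in front so that every point has a first shell, including
    the points of the first compact set.\<close>
  proof (rule that[of "case_nat {} L"])
    show "(\<Union>n. case_nat {} L n) = UNIV"
    proof -
      have "x \<in> (\<Union>n. case_nat {} L n)" for x
      proof -
        obtain n where "x \<in> L n" using un by (metis UNIV_I UN_E)
        then have "x \<in> case_nat {} L (Suc n)" by simp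
        then show ?thesis by (rule UN_I[OF UNIV_I])
      qed
      then show ?thesis by blast
    qed
  qed (use Lc Li in \<open>auto split: nat.splits\<close>)
qed

text \<open>Countability allows null sets found chart by chart to be united into a null set.\<close>

lemma countable_subatlas:
  obtains \<A> where "\<A> \<subseteq> atlas" "countable \<A>" "(\<Union>p\<in>\<A>. fst p) = UNIV"
proof -
  obtain K :: "nat \<Rightarrow> 'm set" where K: "\<And>n. compact (K n)" "(\<Union>n. K n) = UNIV"
    using compact_exhaustion by metis
  have op: "open (fst p)" if "p \<in> atlas" for p using chart_open[of "fst p" "snd p"] that by simp
  have "\<exists>D\<subseteq>atlas. finite D \<and> K n \<subseteq> (\<Union>p\<in>D. fst p)" for n
  proof -
    have cov: "K n \<subseteq> (\<Union>p\<in>atlas. fst p)" using charts_cover by (simp add: case_prod_beta)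
    obtain D where "D \<subseteq> atlas" "finite D" "K n \<subseteq> (\<Union>p\<in>D. fst p)"
      by (rule compactE_image[OF K(1) op cov])
    then show ?thesis by blast
  qed
  then obtain D where D: "\<And>n. D n \<subseteq> atlas" "\<And>n. finite (D n)" "\<And>n. K n \<subseteq> (\<Union>p\<in>D n. fst p)"
    by metis
  show ?thesis
  proof (rule that[of "\<Union>n. D n"])
    show "countable (\<Union>n. D n)" using D(2) by (simp add: countable_finite)
    have "x \<in> (\<Union>p\<in>(\<Union>n. D n). fst p)" for x
    proof -
      obtain n where "x \<in> K n" using K(2) by (metis UNIV_I UN_E)
      then have "x \<in> (\<Union>p\<in>D n. fst p)" using D(3) by (metis subsetD)
      then show ?thesis by auto
    qed
    then show "(\<Union>p\<in>(\<Union>n. D n). fst p) = UNIV" by (metis UNIV_eq_I)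
  qed (use D(1) in blast)
qed

text \<open>Each compact shell between consecutive sets of the exhaustion is covered by finitely
  many bumps whose supports avoid the set two steps before its outer boundary. A neighbourhood
  inside a given compact set then meets only the bumps of finitely many shells.\<close>

lemma countable_bumps:
  assumes op: "\<And>U. U \<in> \<U> \<Longrightarrow> open U" and cov: "\<Union>\<U> = (UNIV :: 'm set)"
  obtains b :: "nat \<Rightarrow> 'm \<Rightarrow> real" and u where
    "\<And>i. u i \<in> \<U>" "\<And>i. manifold_ck atlas k UNIV (b i)" "\<And>i x. 0 \<le> b i x"
    "\<And>i. closure {x. b i x \<noteq> 0} \<subseteq> u i" "\<And>x. \<exists>i. b i x = 1"
    "\<And>x. \<exists>N. open N \<and> x \<in> N \<and> finite {i. \<exists>y\<in>N. b i y \<noteq> 0}"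
proof -
  obtain K :: "nat \<Rightarrow> 'm set" where K: "K 0 = {}" "\<And>n. compact (K n)" "\<And>n. K n \<subseteq> interior (K (Suc n))" "(\<Union>n. K n) = UNIV"
    by (rule compact_exhaustion) blast
  have K': "K n \<subseteq> K (Suc n)" for n using K(3)[of n] interior_subset[of "K (Suc n)"] by (rule order_trans)
  have Kmono: "K m \<subseteq> K n" if "m \<le> n" for m n using lift_Suc_mono_le[of K, OF K'] that by blast
  \<comment> \<open>At n = 0 the truncated subtraction gives \<open>K 0 = {}\<close>, so the last
    condition is void there.\<close>
  define P where "P n = {p :: ('m \<Rightarrow> real) \<times> 'm set. snd p \<in> \<U> \<and> manifold_ck atlas k UNIV (fst p) \<and> (\<forall>x. 0 \<le> fst p x) \<and>
     closure {x. fst p x \<noteq> 0} \<subseteq> snd p \<and> (\<forall>x. fst p x \<noteq> 0 \<longrightarrow> x \<notin> K (n - 1))}" for n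
  have "\<exists>B\<subseteq>P n. finite B \<and> K (Suc n) - interior (K n) \<subseteq> (\<Union>p\<in>B. interior {x. fst p x = 1})" for n
  proof -
    have c: "compact (K (Suc n) - interior (K n))" using K(2) by (intro compact_diff) auto
    have ex: "\<exists>p\<in>P n. x \<in> interior {x. fst p x = 1}" if x: "x \<in> K (Suc n) - interior (K n)" for x
    proof -
      obtain U where U: "U \<in> \<U>" "x \<in> U" using cov by (metis UNIV_I UnionE)
      have "K (n - 1) \<subseteq> interior (K n)" using K(1) K(3)[of "n - 1"] by (cases n) auto
      then have x': "x \<in> U \<inter> - K (n - 1)" using U(2) x by blast
      have o: "open (U \<inter> - K (n - 1))" using op[OF U(1)] K(2)[THEN compact_imp_closed] by auto
      obtain b where b: "manifold_ck atlas k UNIV b" "\<And>y. 0 \<le> b y" "closure {y. b y \<noteq> 0} \<subseteq> U \<inter> - K (n - 1)"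
         "\<exists>N. open N \<and> x \<in> N \<and> (\<forall>y\<in>N. b y = (1::real))"
        by (rule bump[OF o x', of k]) blast
      have "(b, U) \<in> P n" using U(1) b closure_subset[of "{y. b y \<noteq> 0}"] by (auto simp: P_def)
      moreover have "x \<in> interior {x. b x = 1}" using b(4) by (auto simp: interior_def)
      ultimately show ?thesis by force
    qed
    show ?thesis
      by (rule compactE_image[OF c, of "P n" "\<lambda>p. interior {x. fst p x = 1}"]) (use ex in auto)
  qed
  then obtain B where B: "\<And>n. B n \<subseteq> P n" "\<And>n. finite (B n)"
    "\<And>n. K (Suc n) - interior (K n) \<subseteq> (\<Union>p\<in>B n. interior {x. fst p x = 1})"
    by metis
  \<comment> \<open>The bumps of all shells are renumbered by naturals; numbers that are not hit
    receive the zero function and an arbitrary member of the cover.\<close>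
  define I where "I = (SIGMA n:UNIV. B n)"
  have cI: "countable I" unfolding I_def using B(2) by (intro countable_SIGMA) (auto simp: countable_finite)
  define e where "e = to_nat_on I"
  have einj: "inj_on e I" unfolding e_def using cI by (rule inj_on_to_nat_on)
  obtain U0 where U0: "U0 \<in> \<U>" using cov by (metis UNIV_I UnionE)
  define b where "b i = (if i \<in> e ` I then fst (snd (inv_into I e i)) else (\<lambda>_. 0))" for i
  define u where "u i = (if i \<in> e ` I then snd (snd (inv_into I e i)) else U0)" for i
  have be: "b (e p) = fst (snd p)" "u (e p) = snd (snd p)" if "p \<in> I" for p
    using that einj by (simp_all add: b_def u_def)
  have cases: "(\<exists>p\<in>I. i = e p) \<or> (b i = (\<lambda>_. 0) \<and> u i = U0)" for i
    by (auto simp: b_def u_def)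
  have IP: "snd p \<in> P (fst p)" if "p \<in> I" for p using that B(1)[of "fst p"] by (auto simp: I_def)
  show ?thesis
  proof (rule that[of u b])
    fix i
    show "u i \<in> \<U>" "manifold_ck atlas k UNIV (b i)" "0 \<le> b i x" for x
      using cases[of i] IP U0 be by (auto simp: P_def)
    show "closure {x. b i x \<noteq> 0} \<subseteq> u i"
      using cases[of i]
    proof (elim disjE bexE)
      fix p assume p: "p \<in> I" "i = e p"
      show ?thesis using IP[OF p(1)] unfolding p(2) be[OF p(1)] P_def by blast
    qed simp
  next
    fix x
    define n where "n = (LEAST n. x \<in> K (Suc n))"
    have "\<exists>n. x \<in> K n" using K(4) by auto
    then have ex: "\<exists>n. x \<in> K (Suc n)" using K' by blast
    then have n: "x \<in> K (Suc n)" unfolding n_def by (rule LeastI_ex)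
    have "x \<notin> K n"
    proof
      assume x: "x \<in> K n"
      then obtain m where m: "n = Suc m" using K(1) by (cases n) auto
      then have "n \<le> m" using x unfolding n_def by (metis Least_le)
      then show False using m by simp
    qed
    then have "x \<in> K (Suc n) - interior (K n)" using n interior_subset[of "K n"] by blast
    then obtain p where p: "p \<in> B n" "x \<in> interior {x. fst p x = 1}" using B(3)[of n] by blast
    then have "fst p x = 1" using interior_subset[of "{x. fst p x = 1}"] by blast
    moreover have "(n, p) \<in> I" using p by (simp add: I_def)
    ultimately have "b (e (n, p)) x = 1" by (simp add: be)
    then show "\<exists>i. b i x = 1" by blast
  next
    fix x
    obtain m where m: "x \<in> K m" using K(4) by auto
    define N where "N = interior (K (Suc m))"
    have "{i. \<exists>y\<in>N. b i y \<noteq> 0} \<subseteq> e ` (SIGMA n:{..Suc m}. B n)"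
    proof
      fix i assume "i \<in> {i. \<exists>y\<in>N. b i y \<noteq> 0}"
      then obtain y where y: "y \<in> N" "b i y \<noteq> 0" by blast
      then obtain p where p: "p \<in> I" "i = e p" using cases[of i] by auto
      then have "y \<notin> K (fst p - 1)" using IP[of p] y be by (auto simp: P_def)
      moreover have "y \<in> K (Suc m)" using y interior_subset[of "K (Suc m)"] by (auto simp: N_def)
      ultimately have "fst p - 1 < Suc m" using Kmono by (metis linorder_not_le subsetD)
      then have "p \<in> (SIGMA n:{..Suc m}. B n)" using p(1) by (auto simp: I_def)
      then show "i \<in> e ` (SIGMA n:{..Suc m}. B n)" using p by blast
    qed
    then have "finite {i. \<exists>y\<in>N. b i y \<noteq> 0}" by (rule finite_subset) (use B(2) in auto)
    moreover have "x \<in> N" using m K(3) by (auto simp: N_def)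
    ultimately show "\<exists>N. open N \<and> x \<in> N \<and> finite {i. \<exists>y\<in>N. b i y \<noteq> 0}"
      by (intro exI[of _ N]) (auto simp: N_def)
  qed
qed

text \<open>\<open>J\<close> will be the set of bumps of one colour. The index set is cut down to
  the nonzero terms at \<open>x\<close>, as \<open>sum\<close> over an infinite set is 0 by default.
  Local finiteness makes the union of the closed supports locally a finite union, hence closed near
  each point.\<close>

lemma locally_finite_sum:
  fixes b :: "nat \<Rightarrow> 'm \<Rightarrow> real"
  assumes b: "\<And>i. manifold_ck atlas k UNIV (b i)"
    and lf: "\<And>x. \<exists>N. open N \<and> x \<in> N \<and> finite {i. \<exists>y\<in>N. b i y \<noteq> 0}"
  defines "S \<equiv> \<lambda>J x. \<Sum>i | i \<in> J \<and> b i x \<noteq> 0. b i x"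
  shows "manifold_ck atlas k UNIV (S J)" "closure {x. S J x \<noteq> 0} \<subseteq> (\<Union>i\<in>J. closure {x. b i x \<noteq> 0})"
proof -
  have loc: "S J y = (\<Sum>i\<in>F \<inter> J. b i y)" if "F = {i. \<exists>y\<in>N. b i y \<noteq> 0}" "finite F" "y \<in> N" for F N y
    unfolding S_def using that by (intro sum.mono_neutral_left) auto
  show "manifold_ck atlas k UNIV (S J)"
  proof (rule manifold_ck_local)
    fix x
    obtain N where N: "open N" "x \<in> N" "finite {i. \<exists>y\<in>N. b i y \<noteq> 0}" using lf by blast
    let ?F = "{i. \<exists>y\<in>N. b i y \<noteq> 0}"
    have "manifold_ck atlas k UNIV (\<lambda>y. \<Sum>i\<in>?F \<inter> J. b i y)" using b by (intro manifold_ck_sum)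
    then have "manifold_ck atlas k (N \<inter> UNIV) (\<lambda>y. \<Sum>i\<in>?F \<inter> J. b i y)" by (rule manifold_ck_subset) simp
    then have "manifold_ck atlas k (N \<inter> UNIV) (S J)"
      by (rule manifold_ck_cong) (use loc[OF refl N(3)] in auto)
    then show "\<exists>N. open N \<and> x \<in> N \<and> manifold_ck atlas k (N \<inter> UNIV) (S J)" using N by blast
  qed simp
  show "closure {x. S J x \<noteq> 0} \<subseteq> (\<Union>i\<in>J. closure {x. b i x \<noteq> 0})"
  proof
    fix x assume x: "x \<in> closure {x. S J x \<noteq> 0}"
    obtain N where N: "open N" "x \<in> N" "finite {i. \<exists>y\<in>N. b i y \<noteq> 0}" using lf by blast
    let ?F = "{i. \<exists>y\<in>N. b i y \<noteq> 0}"
    have "x \<in> closure (N \<inter> {x. S J x \<noteq> 0})"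
      using open_Int_closure_subset[OF N(1)] N(2) x by blast
    moreover have "N \<inter> {x. S J x \<noteq> 0} \<subseteq> (\<Union>i\<in>?F \<inter> J. {x. b i x \<noteq> 0})"
    proof
      fix y assume y: "y \<in> N \<inter> {x. S J x \<noteq> 0}"
      then have "(\<Sum>i\<in>?F \<inter> J. b i y) \<noteq> 0" using loc[OF refl N(3)] by auto
      then obtain i where "i \<in> ?F \<inter> J" "b i y \<noteq> 0" by (rule sum.not_neutral_contains_not_neutral)
      then show "y \<in> (\<Union>i\<in>?F \<inter> J. {x. b i x \<noteq> 0})" by blast
    qed
    moreover have "(\<Union>i\<in>?F \<inter> J. {x. b i x \<noteq> 0}) \<subseteq> (\<Union>i\<in>?F \<inter> J. closure {x. b i x \<noteq> 0})"
      by (intro UN_mono closure_subset order_refl)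
    moreover have "closed (\<Union>i\<in>?F \<inter> J. closure {x. b i x \<noteq> 0})" using N(3) by (intro closed_UN) auto
    ultimately have "x \<in> (\<Union>i\<in>?F \<inter> J. closure {x. b i x \<noteq> 0})"
      using closure_minimal by (metis (no_types, lifting) order_trans subsetD)
    then show "x \<in> (\<Union>i\<in>J. closure {x. b i x \<noteq> 0})" by blast
  qed
qed

end

section \<open>Covers by finitely many disjoint families\<close>

text \<open>The vectors are (1, x, x^2, ...) for the distinct parameters x = 1 / (i + 1). A vector
  orthogonal to DIM of them is the coefficient vector of a polynomial with more roots than its
  degree allows, which is the Vandermonde argument. Parameters in (0, 1] keep the infinitely many
  vectors bounded, so that one \<epsilon> serves all indices.\<close>

lemma moment_curve:
  obtains c :: "nat \<Rightarrow> 'a::euclidean_space" and s :: 'a and \<epsilon> :: real where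
    "\<And>T. card T = DIM('a) \<Longrightarrow> span (c ` T) = UNIV" "\<epsilon> > 0"
    "\<And>i s'. dist s s' < \<epsilon> \<Longrightarrow> s' \<bullet> c i \<in> {1/4<..<1/2}"
proof -
  define N where "N = DIM('a)"
  have N: "N > 0" by (simp add: N_def)
  obtain e where e: "bij_betw e (Basis :: 'a set) {..<N}"
    unfolding N_def using ex_bij_betw_finite_nat[of "Basis :: 'a set"] by (auto simp: atLeast0LessThan)
  obtain b0 :: 'a where b0: "b0 \<in> Basis" "e b0 = 0"
    using e N unfolding bij_betw_def by (metis imageE lessThan_iff)
  define x where "x i = 1 / real (Suc i)" for i
  have x: "inj x" by (auto simp: inj_def x_def)
  have x1: "\<bar>x i\<bar> \<le> 1" for i by (simp add: x_def)
  define c where "c i = (\<Sum>b\<in>Basis. x i ^ e b *\<^sub>R b)" for i :: nat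
  have ci: "c i \<bullet> b = x i ^ e b" if "b \<in> Basis" for i and b :: 'a
    using that by (simp add: c_def inner_sum_left inner_Basis if_distrib sum.delta cong: if_cong)
  have nc: "norm (c i) \<le> real N" for i
  proof -
    have "norm (c i) \<le> (\<Sum>b\<in>Basis. \<bar>c i \<bullet> b\<bar>)" by (rule norm_le_l1)
    also have "\<dots> \<le> (\<Sum>b\<in>(Basis :: 'a set). 1)"
      using x1 by (intro sum_mono) (simp add: ci power_abs power_le_one)
    finally show ?thesis by (simp add: N_def)
  qed
  \<comment> \<open>\<open>b0\<close> carries the constant coordinate 1, so \<open>s\<close> pairs
    to exactly 3/8, the midpoint of the interval, with every vector of the curve. As these have norm
    at most N, a perturbation below 1 / (8 N) moves the pairing by less than 1/8.\<close>
  show ?thesis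
  proof (rule that[of c "1 / (8 * real N)" "(3/8) *\<^sub>R b0"])
    fix T :: "nat set" assume T: "card T = DIM('a)"
    show "span (c ` T) = UNIV"
    proof (rule ccontr)
      assume "span (c ` T) \<noteq> UNIV"
      then have "dim (c ` T) < DIM('a)" using dim_eq_full dim_subset_UNIV le_neq_implies_less by blast
      then obtain v where v: "v \<noteq> 0" "\<And>y. y \<in> span (c ` T) \<Longrightarrow> orthogonal v y"
        using orthogonal_to_subspace_exists by blast
      define p where "p = (\<Sum>b\<in>Basis. monom (v \<bullet> b) (e b))"
      have roots: "poly p (x i) = 0" if "i \<in> T" for i
      proof -
        have "poly p (x i) = (\<Sum>b\<in>Basis. (v \<bullet> b) * (c i \<bullet> b))"
          by (simp add: p_def poly_sum poly_monom ci)
        also have "\<dots> = v \<bullet> c i" by (rule euclidean_inner[symmetric])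
        also have "\<dots> = 0" using v(2)[of "c i"] that by (auto simp: orthogonal_def span_base)
        finally show ?thesis .
      qed
      have deg: "degree p < N"
        unfolding p_def
      proof (rule degree_sum_less)
        fix b :: 'a assume "b \<in> Basis"
        then have "e b < N" using e by (auto simp: bij_betw_def)
        then show "degree (monom (v \<bullet> b) (e b)) < N" using degree_monom_le le_less_trans by blast
      qed (use N in simp)
      have "p = 0"
      proof (rule ccontr)
        assume "p \<noteq> 0"
        have "finite T" using T by (metis card.infinite DIM_positive less_irrefl)
        have "N = card (x ` T)" using T card_image[OF inj_on_subset[OF x]] by (simp add: N_def)
        also have "\<dots> \<le> card {r. poly p r = 0}"
          using roots poly_roots_finite[OF \<open>p \<noteq> 0\<close>] by (intro card_mono) auto
        also have "\<dots> \<le> degree p" using \<open>p \<noteq> 0\<close> by (rule card_poly_roots_bound)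
        finally show False using deg by simp
      qed
      have "v \<bullet> b = 0" if b: "b \<in> Basis" for b
      proof -
        have "coeff p (e b) = (\<Sum>b'\<in>Basis. if b' = b then v \<bullet> b' else 0)"
          unfolding p_def coeff_sum
          using b e by (intro sum.cong) (auto simp: bij_betw_def dest: inj_onD)
        then show ?thesis using \<open>p = 0\<close> b by simp
      qed
      then have "v = 0" using euclidean_all_zero_iff[of v] by blast
      then show False using v(1) by simp
    qed
  next
    fix i s' assume d: "dist ((3/8) *\<^sub>R b0) s' < 1 / (8 * real N)"
    have "(s' - (3/8) *\<^sub>R b0) \<bullet> c i = s' \<bullet> c i - 3/8"
      using ci[OF b0(1), of i] b0(2) inner_commute[of b0 "c i"] by (simp add: inner_diff_left)
    then have "\<bar>s' \<bullet> c i - 3/8\<bar> \<le> norm (s' - (3/8) *\<^sub>R b0) * norm (c i)"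
      by (metis Cauchy_Schwarz_ineq2)
    also have "\<dots> \<le> norm (s' - (3/8) *\<^sub>R b0) * real N" using nc by (intro mult_left_mono) auto
    also have "\<dots> < 1 / 8" using d N by (simp add: dist_norm norm_minus_commute field_simps)
    finally have "\<bar>s' \<bullet> c i - 3/8\<bar> < 1/8" .
    then show "s' \<bullet> c i \<in> {1/4<..<1/2}" unfolding greaterThanLessThan_iff abs_less_iff by linarith
  qed (use N in simp)
qed

section \<open>Generic hypersurfaces and coloured covers\<close>

context smooth_manifold
begin

text \<open>The elementary case of Sard's theorem, applied in each chart of a countable
  subatlas.\<close>

lemma negligible_image:
  fixes g :: "'m \<Rightarrow> 'n::euclidean_space"
  assumes g: "manifold_ck atlas 1 UNIV g" and dim: "DIM('e) < DIM('n)"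
  shows "negligible (range g)"
proof -
  obtain \<A> where A: "\<A> \<subseteq> atlas" "countable \<A>" "(\<Union>p\<in>\<A>. fst p) = UNIV" by (rule countable_subatlas)
  have "negligible (g ` fst p)" if p: "p \<in> \<A>" for p
  proof -
    obtain U \<phi> where U: "p = (U, \<phi>)" "(U, \<phi>) \<in> atlas" using A(1) p by (cases p) auto
    have "ck_on (Suc 0) (\<phi> ` U) (g \<circ> inv_into U \<phi>)" using manifold_ck_chartD[OF U(2) g] by simp
    then have "(g \<circ> inv_into U \<phi>) differentiable_on (\<phi> ` U)"
      unfolding ck_on.simps(2) differentiable_on_def differentiable_def by blast
    then have "negligible ((g \<circ> inv_into U \<phi>) ` \<phi> ` U)"
      by (rule negligible_differentiable_image_lowdim[OF dim])
    moreover have "(g \<circ> inv_into U \<phi>) ` \<phi> ` U = g ` U" using chart_inv[OF U(2)] by force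
    ultimately show ?thesis by (simp add: U)
  qed
  then have "negligible (\<Union>p\<in>\<A>. g ` fst p)"
    using A(2) by (intro negligible_countable_Union) auto
  moreover have "(\<Union>p\<in>\<A>. g ` fst p) = range g" using A(3) by (metis image_UN)
  ultimately show ?thesis by simp
qed

text \<open>
  Levels \<open>t i\<close> on a moment curve depend on finitely many parameters only, and the parameters for
  which more than \<open>dim M\<close> of the hypersurfaces \<open>h i = t i\<close> meet form a negligible set.
\<close>
lemma generic_levels:
  fixes h :: "nat \<Rightarrow> 'm \<Rightarrow> real"
  assumes h: "\<And>i. manifold_ck atlas 1 UNIV (h i)"
  obtains t :: "nat \<Rightarrow> real" where "\<And>i. t i \<in> {1/4<..<1/2}"
    "\<And>x T. card T = Suc DIM('e) \<Longrightarrow> \<exists>i\<in>T. h i x \<noteq> t i"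
proof -
  \<comment> \<open>The parameter space has one dimension more than the model space, so that the
    parameters determined by a point of the manifold are negligible.\<close>
  obtain c :: "nat \<Rightarrow> 'e \<times> real" and s \<epsilon> where c: "\<And>T. card T = DIM('e \<times> real) \<Longrightarrow> span (c ` T) = UNIV"
    "\<epsilon> > 0" "\<And>i s'. dist s s' < \<epsilon> \<Longrightarrow> s' \<bullet> c i \<in> {1/4<..<1/2}"
    by (rule moment_curve) blast
  define bad where "bad T = {s'. \<exists>x. \<forall>i\<in>T. s' \<bullet> c i = h i x}" for T
  define \<T> where "\<T> = {T :: nat set. finite T \<and> card T = Suc DIM('e)}"
  have "negligible (bad T)" if T: "T \<in> \<T>" for T
  proof -
    have fT: "finite T" and "card T = DIM('e \<times> real)" using T by (simp_all add: \<T>_def)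
    then have sp: "span (c ` T) = UNIV" using c(1) by simp
    have "\<exists>\<alpha>. b = (\<Sum>i\<in>T. \<alpha> i *\<^sub>R c i)" for b
    proof -
      have "b \<in> span (c ` T)" using sp by simp
      then obtain u where u: "b = (\<Sum>v\<in>c ` T. u v *\<^sub>R v)"
        using fT by (auto simp: span_finite)
      have "inj_on c T"
      proof (rule eq_card_imp_inj_on[OF fT])
        have "DIM('e \<times> real) \<le> card (c ` T)"
          using sp fT dim_le_card[of "UNIV :: ('e \<times> real) set" "c ` T"] by simp
        then show "card (c ` T) = card T" using \<open>card T = _\<close> card_image_le[OF fT, of c] by simp
      qed
      then have "b = (\<Sum>i\<in>T. u (c i) *\<^sub>R c i)" using u by (simp add: sum.reindex)
      then show ?thesis by (intro exI[of _ "\<lambda>i. u (c i)"])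
    qed
    then obtain \<alpha> where \<alpha>: "\<And>b. b = (\<Sum>i\<in>T. \<alpha> b i *\<^sub>R c i)" by metis
    \<comment> \<open>The vectors \<open>c i\<close> with \<open>i\<close> in \<open>T\<close> form
      a basis, so a parameter with levels \<open>h i x\<close> on \<open>T\<close> is recovered
      linearly from these values. Bad parameters thus lie in the image of a C^1 map from the
      manifold.\<close>
    define g where "g x = (\<Sum>b\<in>Basis. (\<Sum>i\<in>T. \<alpha> b i * h i x) *\<^sub>R b)" for x
    have "manifold_ck atlas 1 UNIV g"
      unfolding g_def
      by (intro manifold_ck_sum manifold_ck_bounded_linear[OF bounded_linear_scaleR_left] manifold_ck_mult manifold_ck_const h)
    then have "negligible (range g)" by (rule negligible_image) simp
    moreover have "bad T \<subseteq> range g"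
    proof
      fix s' assume "s' \<in> bad T"
      then obtain x where x: "\<And>i. i \<in> T \<Longrightarrow> s' \<bullet> c i = h i x" by (auto simp: bad_def)
      have eq: "s' \<bullet> b = (\<Sum>i\<in>T. \<alpha> b i * h i x)" for b
      proof -
        have "s' \<bullet> b = s' \<bullet> (\<Sum>i\<in>T. \<alpha> b i *\<^sub>R c i)" by (rule arg_cong[OF \<alpha>])
        then show ?thesis by (simp add: inner_sum_right x)
      qed
      have "g x = (\<Sum>b\<in>Basis. (s' \<bullet> b) *\<^sub>R b)" by (simp only: g_def eq)
      then have "s' = g x" by (simp add: euclidean_representation)
      then show "s' \<in> range g" by blast
    qed
    ultimately show ?thesis by (rule negligible_subset)
  qed
  moreover have "countable \<T>"
    by (rule countable_subset[OF _ countable_Collect_finite]) (auto simp: \<T>_def)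
  ultimately have neg: "negligible (\<Union>(bad ` \<T>))" by (intro negligible_countable_Union) auto
  have "\<not> ball s \<epsilon> \<subseteq> \<Union>(bad ` \<T>)"
    using negligible_subset[OF neg] open_not_negligible[of "ball s \<epsilon>"] c(2) by force
  then obtain s' where "s' \<in> ball s \<epsilon>" and s'2: "s' \<notin> \<Union>(bad ` \<T>)" by (meson subsetI)
  then have s': "dist s s' < \<epsilon>" by simp
  show ?thesis
  proof (rule that[of "\<lambda>i. s' \<bullet> c i"])
    fix x and T :: "nat set" assume T: "card T = Suc DIM('e)"
    then have "T \<in> \<T>" using card.infinite by (force simp: \<T>_def)
    then have "s' \<notin> bad T" using s'2 by blast
    then show "\<exists>i\<in>T. h i x \<noteq> s' \<bullet> c i" unfolding bad_def mem_Collect_eq by metis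
  qed (use c(3) s' in blast)
qed

text \<open>
  In the proof \<open>C J I\<close> consists of the points at which the levels in \<open>J\<close> are nearer than all the others, and
  \<open>I\<close> are the others that are exceeded. Two such sets with the same number of elements in \<open>J\<close> are
  disjoint, and by genericity \<open>J\<close> with at most \<open>dim M\<close> elements suffice.
\<close>
lemma colored_cover:
  assumes op: "\<And>U. U \<in> \<U> \<Longrightarrow> open U" and cov: "\<Union>\<U> = (UNIV :: 'm set)"
  obtains n :: nat and \<W> :: "nat \<Rightarrow> 'm set set" and \<mu> :: "nat \<Rightarrow> 'm \<Rightarrow> real" where
    "\<And>c W. W \<in> \<W> c \<Longrightarrow> open W" "\<And>c W. W \<in> \<W> c \<Longrightarrow> \<exists>U\<in>\<U>. W \<subseteq> U"
    "\<And>c W W'. W \<in> \<W> c \<Longrightarrow> W' \<in> \<W> c \<Longrightarrow> W \<noteq> W' \<Longrightarrow> W \<inter> W' = {}"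
    "\<And>c. manifold_ck atlas k UNIV (\<mu> c)" "\<And>c. closure {x. \<mu> c x \<noteq> 0} \<subseteq> \<Union>(\<W> c)"
    "\<And>x. \<exists>c<n. \<mu> c x \<noteq> 0"
proof -
  \<comment> \<open>Order 1 is used here whatever \<open>k\<close> is: genericity needs
    differentiable functions, even when k = 0. Order \<open>k\<close> enters only with the second
    family of bumps.\<close>
  obtain h :: "nat \<Rightarrow> 'm \<Rightarrow> real" and u where h:
    "\<And>i. u i \<in> \<U>" "\<And>i. manifold_ck atlas 1 UNIV (h i)"
    "\<And>i. closure {x. h i x \<noteq> 0} \<subseteq> u i" "\<And>x. \<exists>i. h i x = 1"
    "\<And>x. \<exists>N. open N \<and> x \<in> N \<and> finite {i. \<exists>y\<in>N. h i y \<noteq> 0}"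
    by (rule countable_bumps[OF op cov]) blast+
  obtain t where t: "\<And>i. t i \<in> {1/4<..<1/2}" "\<And>x T. card T = Suc DIM('e) \<Longrightarrow> \<exists>i\<in>T. h i x \<noteq> t i"
    by (rule generic_levels[of h]) (use h(2) in blast)+
  define v where "v i x = h i x - t i" for i x
  have vc: "continuous_on UNIV (v i)" for i
    unfolding v_def using manifold_ck_continuous[OF h(2)] by (intro continuous_intros) auto
  define C where "C J I = {x. (\<forall>j\<in>J. \<forall>i\<in>-J. \<bar>v j x\<bar> < \<bar>v i x\<bar>) \<and> (\<forall>i\<in>-J. v i x \<noteq> 0) \<and> {i\<in>-J. v i x > 0} = I}" for J I
  \<comment> \<open>For an index in \<open>I\<close> the function \<open>h i\<close> exceeds a
    positive level, so the whole set lies in \<open>u i\<close>; hence the demand that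
    \<open>I\<close> be nonempty.\<close>
  define \<W> where "\<W> c = {interior (C J I) | J I. finite J \<and> card J = c \<and> I \<noteq> {}}" for c
  have sub: "\<exists>U\<in>\<U>. W \<subseteq> U" if W: "W \<in> \<W> c" for W c
  proof -
    obtain J I i where I: "W = interior (C J I)" "i \<in> I" using W by (auto simp: \<W>_def)
    have "W \<subseteq> u i"
    proof
      fix x assume "x \<in> W"
      then have "x \<in> C J I" using I(1) interior_subset[of "C J I"] by blast
      then have "v i x > 0" using I(2) by (auto simp: C_def)
      then have "h i x \<noteq> 0" using t(1)[of i] by (auto simp: v_def)
      then show "x \<in> u i" using h(3)[of i] closure_subset[of "{x. h i x \<noteq> 0}"] by blast
    qed
    then show ?thesis using h(1) by blast
  qed
  have disj: "W \<inter> W' = {}" if Wc: "W \<in> \<W> c" "W' \<in> \<W> c" "W \<noteq> W'" for W W' c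
  proof (rule ccontr)
    assume "W \<inter> W' \<noteq> {}"
    then obtain x where x: "x \<in> W" "x \<in> W'" by blast
    obtain J I where "W = interior (C J I)" "finite J" "card J = c"
      using Wc(1) unfolding \<W>_def by blast
    moreover obtain J' I' where "W' = interior (C J' I')" "finite J'" "card J' = c"
      using Wc(2) unfolding \<W>_def by blast
    ultimately have JI: "W = interior (C J I)" "finite J" "card J = c"
      "W' = interior (C J' I')" "finite J'" "card J' = c" by auto
    have xC: "x \<in> C J I" "x \<in> C J' I'" using x JI interior_subset by blast+
    have "J = J'"
    proof (rule ccontr)
      assume "J \<noteq> J'"
      \<comment> \<open>Two different finite sets of equal size each contain an element outside the
        other; at a common point each of these would have to be strictly nearer than the
        other.\<close>
      then have "\<not> J \<subseteq> J'" "\<not> J' \<subseteq> J" using JI by (metis card_subset_eq)+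
      then obtain i i' where "i \<in> J" "i \<notin> J'" "i' \<in> J'" "i' \<notin> J" by blast
      then have "\<bar>v i x\<bar> < \<bar>v i' x\<bar>" "\<bar>v i' x\<bar> < \<bar>v i x\<bar>" using xC by (auto simp: C_def)
      then show False by simp
    qed
    then have "I = I'" using xC by (auto simp: C_def)
    then show False using \<open>J = J'\<close> JI Wc(3) by simp
  qed
  define n where "n = Suc DIM('e)"
  have cover: "\<exists>c<n. \<exists>W\<in>\<W> c. x \<in> W" for x
  proof -
    \<comment> \<open>The hypersurfaces through \<open>x\<close> itself: at distance 0 they are
      nearer than all others, and genericity bounds their number by the dimension.\<close>
    define J where "J = {i. v i x = 0}"
    define I where "I = {i\<in>-J. v i x > 0}"
    obtain N where N: "open N" "x \<in> N" "finite {i. \<exists>y\<in>N. h i y \<noteq> 0}" using h(5) by blast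
    define F where "F = {i. \<exists>y\<in>N. h i y \<noteq> 0}"
    have vF: "v i y = - t i" if "i \<notin> F" "y \<in> N" for i y using that by (simp add: F_def v_def)
    have tp: "t i > 1/4" for i using t(1) by simp
    have JF: "J \<subseteq> F"
    proof
      fix i assume "i \<in> J"
      then have "v i x = 0" by (simp add: J_def)
      then show "i \<in> F" using vF[of i x] N(2) tp[of i] by fastforce
    qed
    have fJ: "finite J" using JF N(3) by (simp add: F_def finite_subset)
    have cJ: "card J < n"
    proof (rule ccontr)
      assume "\<not> card J < n"
      then obtain T where T: "T \<subseteq> J" "card T = n" using obtain_subset_with_card_n[of n J] by auto
      then show False using t(2)[of T x] by (auto simp: n_def J_def v_def)
    qed
    \<comment> \<open>Levels lie below 1/2, so a bump equal to 1 at \<open>x\<close> exceeds its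
      level, and \<open>I\<close> is nonempty.\<close>
    obtain i where i: "h i x = 1" using h(4) by blast
    then have "v i x > 0" using t(1)[of i] by (simp add: v_def)
    then have "i \<in> I" by (simp add: I_def J_def)
    then have Ine: "I \<noteq> {}" by blast
    \<comment> \<open>For indices outside \<open>F\<close> the value on \<open>N\<close> is -t i, of
      absolute value above 1/4. The bound 1/4 on the members of \<open>J\<close> thus settles
      infinitely many inequalities at once, and only finitely many open conditions remain.\<close>
    define O' where "O' = N \<inter> (\<Inter>j\<in>J. {y. \<bar>v j y\<bar> < 1/4}) \<inter> (\<Inter>j\<in>J. \<Inter>i\<in>F - J. {y. \<bar>v j y\<bar> < \<bar>v i y\<bar>})
      \<inter> (\<Inter>i\<in>F - J. {y. 0 < v i x * v i y})"
    have fF: "finite F" "finite (F - J)" using N(3) by (auto simp: F_def)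
    have o1: "open (\<Inter>j\<in>J. {y. \<bar>v j y\<bar> < 1/4})"
      using fJ by (intro open_INT ballI open_Collect_less continuous_intros vc) auto
    have o2: "open (\<Inter>j\<in>J. \<Inter>i\<in>F - J. {y. \<bar>v j y\<bar> < \<bar>v i y\<bar>})"
      using fJ fF by (intro open_INT ballI open_Collect_less continuous_intros vc) auto
    have o3: "open (\<Inter>i\<in>F - J. {y. 0 < v i x * v i y})"
      using fF by (intro open_INT ballI open_Collect_less continuous_intros vc) auto
    have "open O'" unfolding O'_def using N(1) o1 o2 o3 by (intro open_Int) auto
    moreover have "x \<in> O'" using N(2) by (auto simp: O'_def J_def zero_less_mult_iff)
    moreover have "O' \<subseteq> C J I"
    proof
      fix y assume y: "y \<in> O'"
      have sgn: "0 < v i x * v i y" if "i \<notin> J" for i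
      proof (cases "i \<in> F")
        case False
        then have "v i x = - t i" "v i y = - t i" using vF y N(2) by (auto simp: O'_def)
        then show ?thesis using tp[of i] by simp
      qed (use y that in \<open>auto simp: O'_def\<close>)
      have "\<bar>v j y\<bar> < \<bar>v i y\<bar>" if j: "j \<in> J" and i: "i \<notin> J" for i j
      proof (cases "i \<in> F")
        case False
        then have "v i y = - t i" using vF y by (auto simp: O'_def)
        moreover have "\<bar>v j y\<bar> < 1/4" using y j by (auto simp: O'_def)
        ultimately show ?thesis using tp[of i] by simp
      qed (use y j i in \<open>auto simp: O'_def\<close>)
      moreover have "v i y \<noteq> 0" if "i \<notin> J" for i using sgn[OF that] by auto
      moreover have "v i y > 0 \<longleftrightarrow> v i x > 0" if "i \<notin> J" for i
        using sgn[OF that] by (auto simp: zero_less_mult_iff)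
      ultimately show "y \<in> C J I" by (auto simp: C_def I_def)
    qed
    ultimately have "x \<in> interior (C J I)" by (rule interiorI)
    moreover have "interior (C J I) \<in> \<W> (card J)" using fJ Ine by (auto simp: \<W>_def)
    ultimately show ?thesis using cJ by blast
  qed
  define \<V> where "\<V> = (\<Union>c<n. \<W> c)"
  have opW: "open W" if "W \<in> \<W> c" for W c using that by (auto simp: \<W>_def)
  have covV: "\<Union>\<V> = UNIV" unfolding \<V>_def using cover by fast
  have opV: "open V" if "V \<in> \<V>" for V using that opW by (auto simp: \<V>_def)
  obtain b :: "nat \<Rightarrow> 'm \<Rightarrow> real" and w where b:
    "\<And>i. w i \<in> \<V>" "\<And>i. manifold_ck atlas k UNIV (b i)" "\<And>i x. 0 \<le> b i x"
    "\<And>i. closure {x. b i x \<noteq> 0} \<subseteq> w i" "\<And>x. \<exists>i. b i x = 1"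
    "\<And>x. \<exists>N. open N \<and> x \<in> N \<and> finite {i. \<exists>y\<in>N. b i y \<noteq> 0}"
    by (rule countable_bumps[OF opV covV, of k]) blast+
  have "\<exists>c<n. w i \<in> \<W> c" for i using b(1)[of i] by (auto simp: \<V>_def)
  then obtain col where col: "\<And>i. col i < n" "\<And>i. w i \<in> \<W> (col i)" by metis
  \<comment> \<open>All bumps assigned to one colour are added; as they are nonnegative, nothing
    cancels.\<close>
  define \<mu> where "\<mu> c x = (\<Sum>i | i \<in> {i. col i = c} \<and> b i x \<noteq> 0. b i x)" for c x
  note lf = locally_finite_sum[of k b, OF b(2) b(6)]
  show ?thesis
  proof (rule that[OF opW sub disj])
    show "manifold_ck atlas k UNIV (\<mu> c)" for c unfolding \<mu>_def by (rule lf(1))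
    show "closure {x. \<mu> c x \<noteq> 0} \<subseteq> \<Union>(\<W> c)" for c
    proof -
      have "closure {x. \<mu> c x \<noteq> 0} \<subseteq> (\<Union>i\<in>{i. col i = c}. closure {x. b i x \<noteq> 0})"
        unfolding \<mu>_def by (rule lf(2))
      also have "\<dots> \<subseteq> \<Union>(\<W> c)" using b(4) col(2) by blast
      finally show ?thesis .
    qed
    show "\<exists>c<n. \<mu> c x \<noteq> 0" for x
    proof -
      obtain i where i: "b i x = 1" using b(5) by blast
      obtain N where "open N" "x \<in> N" "finite {i. \<exists>y\<in>N. b i y \<noteq> 0}" using b(6) by blast
      then have "finite {j. j \<in> {j. col j = col i} \<and> b j x \<noteq> 0}"
        by (elim finite_subset[rotated]) auto
      then have "\<mu> (col i) x > 0" unfolding \<mu>_def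
        using i b(3) by (intro sum_pos2[of _ i]) auto
      then show ?thesis using col(1) by (intro exI[of _ "col i"]) auto
    qed
  qed
qed

end

section \<open>Sections in trivializations\<close>

context fin_dim_lie_algebra
begin

abbreviation lin :: "('f \<Rightarrow> 'f) \<Rightarrow> bool" where "lin \<equiv> Vector_Spaces.linear smul smul"
abbreviation functional :: "('f \<Rightarrow> 'k) \<Rightarrow> bool" where "functional \<equiv> Vector_Spaces.linear smul (*)"

abbreviation rs :: "real \<Rightarrow> 'f \<Rightarrow> 'f" where "rs r v \<equiv> smul (of_real r) v"

lemma vector_space_field: "vector_space ((*) :: 'k \<Rightarrow> 'k \<Rightarrow> 'k)"
  by unfold_locales (simp_all add: algebra_simps)

lemma lin_iff: "lin T \<longleftrightarrow> (\<forall>x y. T (x + y) = T x + T y) \<and> (\<forall>c x. T (smul c x) = smul c (T x))"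
  using vector_space_axioms by (simp add: Vector_Spaces.linear_iff)

lemma functional_iff: "functional l \<longleftrightarrow> (\<forall>x y. l (x + y) = l x + l y) \<and> (\<forall>c x. l (smul c x) = c * l x)"
  using vector_space_axioms vector_space_field by (simp add: Vector_Spaces.linear_iff)

lemma lin_add: "lin T \<Longrightarrow> T (x + y) = T x + T y" and lin_scale: "lin T \<Longrightarrow> T (smul c x) = smul c (T x)"
  by (simp_all add: lin_iff)

lemma lin_zero: "lin T \<Longrightarrow> T 0 = 0"
  using lin_scale[of T 0 0] by simp

lemma lin_sum: "lin T \<Longrightarrow> T (sum f I) = (\<Sum>i\<in>I. T (f i))"
  by (induction I rule: infinite_finite_induct) (simp_all add: lin_zero lin_add)

lemma functional_add: "functional l \<Longrightarrow> l (x + y) = l x + l y"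
  and functional_scale: "functional l \<Longrightarrow> l (smul c x) = c * l x"
  by (simp_all add: functional_iff)

lemma functional_zero: "functional l \<Longrightarrow> l 0 = 0"
  using functional_scale[of l 0 0] by simp

lemma functional_sum: "functional l \<Longrightarrow> l (sum f I) = (\<Sum>i\<in>I. l (f i))"
  by (induction I rule: infinite_finite_induct) (simp_all add: functional_zero functional_add)

lemma br_left: "lin (\<lambda>x. br x y)" and br_right: "lin (\<lambda>y. br x y)"
  by (rule br_linear_left br_linear_right)+

lemma br_add_left: "br (x + y) z = br x z + br y z" and br_add_right: "br z (x + y) = br z x + br z y"
  using lin_add[OF br_left] lin_add[OF br_right] by blast+

lemma br_scale_left: "br (smul c x) z = smul c (br x z)" and br_scale_right: "br z (smul c x) = smul c (br z x)"
  using lin_scale[OF br_left] lin_scale[OF br_right] by blast+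

lemma br_zero [simp]: "br 0 z = 0" "br z 0 = 0"
  using lin_zero[OF br_left] lin_zero[OF br_right] by blast+

lemma br_diff_left: "br (x - y) z = br x z - br y z"
  using br_add_left[of "x - y" y z] by simp

lemma coordinates:
  obtains B co where "finite B" "\<And>b. functional (co b)" "\<And>v. v = (\<Sum>b\<in>B. smul (co b v) b)"
proof -
  obtain C where C: "finite C" "span C = UNIV" using finite_dimensional by blast
  obtain B where B: "B \<subseteq> C" "independent B" "C \<subseteq> span B"
    by (rule maximal_independent_subset[of C])
  then have fB: "finite B" and sB: "span B = UNIV"
    using C finite_subset span_mono[of C "span B"] by (auto simp: span_span)
  show ?thesis
  proof (rule that[OF fB, of "\<lambda>b v. representation B v b"])
    show "functional (\<lambda>v. representation B v b)" for b
      using B(2) sB by (simp add: functional_iff representation_add representation_scale)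
    show "v = (\<Sum>b\<in>B. smul (representation B v b) b)" for v
      using sum_representation_eq[OF B(2) _ fB, of v] sB by simp
  qed
qed

text \<open>Each basis vector b is a finite sum of brackets, and the coordinate of v at b can be
  absorbed into the left entries. The right entries stay constant and the left ones are linear in v,
  so the formula applies to sections without losing regularity.\<close>

lemma perfect_decomposition:
  assumes "perfect_lie smul br"
  obtains A :: "('f \<times> nat) set" and T :: "'f \<times> nat \<Rightarrow> 'f \<Rightarrow> 'f" and e where
    "finite A" "\<And>a. lin (T a)" "\<And>v. v = (\<Sum>a\<in>A. br (T a v) (e a))"
proof -
  have ex: "\<exists>xs. v = (\<Sum>(x, y)\<leftarrow>xs. br x y)" for v
  proof -
    have "v \<in> span {br x y | x y. True}" using assms by (simp add: perfect_lie_def)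
    then show ?thesis
    proof (induction rule: span_induct_alt)
      case base
      show ?case by (rule exI[of _ "[]"]) simp
    next
      case (step c t v)
      then obtain x y xs where "t = br x y" "v = (\<Sum>(x, y)\<leftarrow>xs. br x y)" by blast
      then show ?case by (intro exI[of _ "(smul c x, y) # xs"]) (simp add: br_scale_left)
    qed
  qed
  then obtain xs where xs: "\<And>v. v = (\<Sum>(x, y)\<leftarrow>xs v. br x y)" by metis
  obtain B co where B: "finite B" "\<And>b. functional (co b)" "\<And>v. v = (\<Sum>b\<in>B. smul (co b v) b)"
    by (rule coordinates) blast
  define A where "A = (SIGMA b:B. {..<length (xs b)})"
  define T where "T = (\<lambda>(b, j) v. smul (co b v) (fst (xs b ! j)))"
  define e where "e = (\<lambda>(b, j). snd (xs b ! j))"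
  show ?thesis
  proof (rule that[of A T e])
    show "finite A" unfolding A_def using B(1) by auto
    show "lin (T a)" for a
      using B(2) by (cases a) (auto simp: T_def lin_iff functional_add functional_scale scale_left_distrib)
    fix v
    have "smul (co b v) b = (\<Sum>j<length (xs b). br (T (b, j) v) (e (b, j)))" for b
    proof -
      have "b = (\<Sum>j<length (xs b). br (fst (xs b ! j)) (snd (xs b ! j)))"
        by (subst xs[of b]) (simp add: sum_list_sum_nth case_prod_beta atLeast0LessThan)
      then have "smul (co b v) b = smul (co b v) (\<Sum>j<length (xs b). br (fst (xs b ! j)) (snd (xs b ! j)))" by simp
      then show ?thesis by (simp add: T_def e_def br_scale_left scale_sum_right)
    qed
    then have "v = (\<Sum>b\<in>B. \<Sum>j<length (xs b). br (T (b, j) v) (e (b, j)))" using B(3)[of v] by simp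
    then show "v = (\<Sum>a\<in>A. br (T a v) (e a))"
      unfolding A_def using B(1) by (simp add: sum.Sigma)
  qed
qed

end

text \<open>
  Here all fibers are the model Lie algebra itself, identified with the actual ones by arbitrary
  isomorphisms. Thus \<open>\<tau> x\<close> need not depend continuously on \<open>x\<close>; only the transition maps do.
\<close>
locale lie_bundle_model = fin_dim_lie_algebra smul br + smooth_manifold E atlas
  for smul :: "'k::real_normed_field \<Rightarrow> 'f::ab_group_add \<Rightarrow> 'f"
    and br :: "'f \<Rightarrow> 'f \<Rightarrow> 'f"
    and E :: "'e::euclidean_space set"
    and atlas :: "('m::t2_space set \<times> ('m \<Rightarrow> 'e)) set" +
  fixes triv :: "('m set \<times> ('m \<Rightarrow> 'f \<Rightarrow> 'f)) set"
  assumes triv_cover: "\<And>x. \<exists>(V, \<tau>)\<in>triv. x \<in> V"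
    and triv_open: "\<And>V \<tau>. (V, \<tau>) \<in> triv \<Longrightarrow> open V"
    and triv_lin: "\<And>V \<tau> x. (V, \<tau>) \<in> triv \<Longrightarrow> x \<in> V \<Longrightarrow> Vector_Spaces.linear smul smul (\<tau> x)"
    and triv_bij: "\<And>V \<tau> x. (V, \<tau>) \<in> triv \<Longrightarrow> x \<in> V \<Longrightarrow> bij (\<tau> x)"
    and triv_br: "\<And>V \<tau> x u v. (V, \<tau>) \<in> triv \<Longrightarrow> x \<in> V \<Longrightarrow> \<tau> x (br u v) = br (\<tau> x u) (\<tau> x v)"
    and triv_change: "\<And>V \<tau> W \<sigma> k. (V, \<tau>) \<in> triv \<Longrightarrow> (W, \<sigma>) \<in> triv \<Longrightarrow>
      end_ck smul atlas k (V \<inter> W) (\<lambda>x. \<sigma> x \<circ> inv (\<tau> x))"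
begin

abbreviation vck :: "nat \<Rightarrow> 'm set \<Rightarrow> ('m \<Rightarrow> 'f) \<Rightarrow> bool" where "vck \<equiv> vec_ck smul atlas"
abbreviation mck :: "nat \<Rightarrow> 'm set \<Rightarrow> ('m \<Rightarrow> 'b::real_normed_vector) \<Rightarrow> bool" where "mck \<equiv> manifold_ck atlas"

lemma vck_functional: "vck k W f \<Longrightarrow> functional l \<Longrightarrow> mck k W (\<lambda>x. l (f x))"
  by (simp add: vec_ck_def o_def)

lemma vckI: "(\<And>l. functional l \<Longrightarrow> mck k W (\<lambda>x. l (f x))) \<Longrightarrow> vck k W f"
  by (simp add: vec_ck_def o_def)

lemma vck_subset: "vck k W f \<Longrightarrow> W' \<subseteq> W \<Longrightarrow> vck k W' f"
  by (auto simp: vec_ck_def intro: manifold_ck_subset)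

lemma vck_cong: "vck k W f \<Longrightarrow> (\<And>x. x \<in> W \<Longrightarrow> g x = f x) \<Longrightarrow> vck k W g"
  by (rule vckI, rule manifold_ck_cong, erule (1) vck_functional) simp

lemma vck_Union: "(\<And>W. W \<in> \<W> \<Longrightarrow> open W) \<Longrightarrow> (\<And>W. W \<in> \<W> \<Longrightarrow> vck k W f) \<Longrightarrow> vck k (\<Union>\<W>) f"
  by (rule vckI, rule manifold_ck_Union) (auto intro: vck_functional)

lemma vck_const: "vck k W (\<lambda>x. v)"
  by (rule vckI) simp

lemma vck_add: "vck k W f \<Longrightarrow> vck k W g \<Longrightarrow> vck k W (\<lambda>x. f x + g x)"
  by (rule vckI) (simp add: functional_add manifold_ck_add vck_functional)

lemma vck_sum: "(\<And>i. i \<in> I \<Longrightarrow> vck k W (f i)) \<Longrightarrow> vck k W (\<lambda>x. \<Sum>i\<in>I. f i x)"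
  by (rule vckI) (simp add: functional_sum manifold_ck_sum vck_functional)

lemma vck_scale: "mck k W g \<Longrightarrow> vck k W f \<Longrightarrow> vck k W (\<lambda>x. smul (g x) (f x))"
  by (rule vckI) (simp add: functional_scale manifold_ck_mult vck_functional)

text \<open>\<open>end_ck\<close> tests \<open>A\<close> on constant vectors only; linearity and the
  coordinates of \<open>f\<close> reduce the general case to it.\<close>

lemma vck_end_apply:
  assumes A: "end_ck smul atlas k W A" and f: "vck k W f" and l: "\<And>x. x \<in> W \<Longrightarrow> lin (A x)"
  shows "vck k W (\<lambda>x. A x (f x))"
proof -
  obtain B co where B: "finite B" "\<And>b. functional (co b)" "\<And>v. v = (\<Sum>b\<in>B. smul (co b v) b)"
    by (rule coordinates) blast
  have "vck k W (\<lambda>x. \<Sum>b\<in>B. smul (co b (f x)) (A x b))"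
    using A B(2) f by (intro vck_sum vck_scale vck_functional) (auto simp: end_ck_def)
  then show ?thesis
  proof (rule vck_cong)
    fix x assume "x \<in> W"
    show "A x (f x) = (\<Sum>b\<in>B. smul (co b (f x)) (A x b))"
      by (subst B(3)[of "f x"]) (simp add: lin_sum lin_scale l[OF \<open>x \<in> W\<close>])
  qed
qed

lemma vck_lin: "lin T \<Longrightarrow> vck k W f \<Longrightarrow> vck k W (\<lambda>x. T (f x))"
  by (rule vck_end_apply[of k W "\<lambda>_. T"]) (simp_all add: end_ck_def vck_const)

lemma vck_br:
  assumes f: "vck k W f" and g: "vck k W g"
  shows "vck k W (\<lambda>x. br (f x) (g x))"
  by (rule vck_end_apply[OF _ g, of "\<lambda>x. br (f x)"])
     (use vck_lin[OF br_left f] br_right in \<open>auto simp: end_ck_def\<close>)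

lemma triv_inv_right: "(V, \<tau>) \<in> triv \<Longrightarrow> x \<in> V \<Longrightarrow> \<tau> x (inv (\<tau> x) v) = v"
  using triv_bij by (metis bij_is_surj surj_f_inv_f)

lemma triv_inv_left: "(V, \<tau>) \<in> triv \<Longrightarrow> x \<in> V \<Longrightarrow> inv (\<tau> x) (\<tau> x v) = v"
  using triv_bij by (metis bij_is_inj inv_f_f)

lemma triv_inj: "(V, \<tau>) \<in> triv \<Longrightarrow> x \<in> V \<Longrightarrow> \<tau> x u = \<tau> x v \<Longrightarrow> u = v"
  using triv_inv_left by metis

lemma triv_inv_lin: "(V, \<tau>) \<in> triv \<Longrightarrow> x \<in> V \<Longrightarrow> lin (inv (\<tau> x))"
  unfolding lin_iff
  by (intro conjI allI; rule triv_inj, assumption, assumption)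
     (simp_all add: triv_inv_right lin_add[OF triv_lin] lin_scale[OF triv_lin])

lemma triv_inv_br: "(V, \<tau>) \<in> triv \<Longrightarrow> x \<in> V \<Longrightarrow> inv (\<tau> x) (br u v) = br (inv (\<tau> x) u) (inv (\<tau> x) v)"
  by (rule triv_inj, assumption, assumption) (simp add: triv_inv_right triv_br)

lemma triv_at: obtains V \<tau> where "(V, \<tau>) \<in> triv" "x \<in> V"
  using triv_cover[of x] by auto

section \<open>Sections of class C^k in the model\<close>

definition sec :: "nat \<Rightarrow> 'm set \<Rightarrow> ('m \<Rightarrow> 'f) \<Rightarrow> bool"
  where "sec k W \<xi> \<longleftrightarrow> (\<forall>(V, \<tau>)\<in>triv. vck k (V \<inter> W) (\<lambda>x. \<tau> x (\<xi> x)))"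

lemma secD: "sec k W \<xi> \<Longrightarrow> (V, \<tau>) \<in> triv \<Longrightarrow> vck k (V \<inter> W) (\<lambda>x. \<tau> x (\<xi> x))"
  by (auto simp: sec_def)

text \<open>One trivialization decides, because the transition maps are of class C^k for every
  k.\<close>

lemma sec_chart:
  assumes V: "(V, \<tau>) \<in> triv" "W \<subseteq> V" and \<xi>: "vck k W (\<lambda>x. \<tau> x (\<xi> x))"
  shows "sec k W \<xi>"
  unfolding sec_def
proof clarify
  fix V' \<sigma> assume V': "(V', \<sigma>) \<in> triv"
  have *: "vck k (V' \<inter> W) (\<lambda>x. (\<sigma> x \<circ> inv (\<tau> x)) (\<tau> x (\<xi> x)))"
  proof (rule vck_end_apply[where A = "\<lambda>x. \<sigma> x \<circ> inv (\<tau> x)" and f = "\<lambda>x. \<tau> x (\<xi> x)"])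
    show "end_ck smul atlas k (V' \<inter> W) (\<lambda>x. \<sigma> x \<circ> inv (\<tau> x))"
      using triv_change[OF V(1) V', of k] vck_subset[of k "V \<inter> V'" _ "V' \<inter> W"] V(2)
      unfolding end_ck_def by blast
    show "vck k (V' \<inter> W) (\<lambda>x. \<tau> x (\<xi> x))" using \<xi> by (rule vck_subset) simp
    show "lin (\<sigma> x \<circ> inv (\<tau> x))" if "x \<in> V' \<inter> W" for x
      using triv_inv_lin[OF V(1), of x] triv_lin[OF V', of x] V(2) that
      by (intro Vector_Spaces.linear_compose) auto
  qed
  show "vck k (V' \<inter> W) (\<lambda>x. \<sigma> x (\<xi> x))"
    by (rule vck_cong[OF *]) (use triv_inv_left[OF V(1)] V(2) in auto)
qed

lemma sec_cong:
  assumes "sec k W \<xi>" "\<And>x. x \<in> W \<Longrightarrow> \<eta> x = \<xi> x"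
  shows "sec k W \<eta>"
  unfolding sec_def
proof clarify
  fix V \<tau> assume "(V, \<tau>) \<in> triv"
  then show "vck k (V \<inter> W) (\<lambda>x. \<tau> x (\<eta> x))"
    by (rule vck_cong[OF secD[OF assms(1)]]) (use assms(2) in auto)
qed

lemma sec_Union:
  assumes "\<And>W. W \<in> \<W> \<Longrightarrow> open W" "\<And>W. W \<in> \<W> \<Longrightarrow> sec k W \<xi>"
  shows "sec k (\<Union>\<W>) \<xi>"
  unfolding sec_def
proof clarify
  fix V \<tau> assume V: "(V, \<tau>) \<in> triv"
  have "vck k (\<Union>((\<lambda>W. V \<inter> W) ` \<W>)) (\<lambda>x. \<tau> x (\<xi> x))"
    using assms secD[OF _ V] triv_open[OF V] by (intro vck_Union) auto
  moreover have "\<Union>((\<lambda>W. V \<inter> W) ` \<W>) = V \<inter> \<Union>\<W>" by blast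
  ultimately show "vck k (V \<inter> \<Union>\<W>) (\<lambda>x. \<tau> x (\<xi> x))" by simp
qed

lemma sec_zero: "sec k W (\<lambda>x. 0)"
  unfolding sec_def
proof clarify
  fix V \<tau> assume "(V, \<tau>) \<in> triv"
  then show "vck k (V \<inter> W) (\<lambda>x. \<tau> x 0)"
    by (intro vck_cong[OF vck_const[of k _ 0]]) (simp add: lin_zero[OF triv_lin])
qed

lemma sec_add:
  assumes "sec k W \<xi>" "sec k W \<eta>"
  shows "sec k W (\<lambda>x. \<xi> x + \<eta> x)"
  unfolding sec_def
proof clarify
  fix V \<tau> assume V: "(V, \<tau>) \<in> triv"
  show "vck k (V \<inter> W) (\<lambda>x. \<tau> x (\<xi> x + \<eta> x))"
    by (rule vck_cong[OF vck_add[OF secD[OF assms(1) V] secD[OF assms(2) V]]])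
       (simp add: lin_add[OF triv_lin[OF V]])
qed

lemma sec_sum: "(\<And>i. i \<in> I \<Longrightarrow> sec k W (\<xi> i)) \<Longrightarrow> sec k W (\<lambda>x. \<Sum>i\<in>I. \<xi> i x)"
  by (induction I rule: infinite_finite_induct) (auto intro: sec_add sec_zero)

lemma sec_smul:
  assumes "mck k W g" "sec k W \<xi>"
  shows "sec k W (\<lambda>x. smul (g x) (\<xi> x))"
  unfolding sec_def
proof clarify
  fix V \<tau> assume V: "(V, \<tau>) \<in> triv"
  have g: "mck k (V \<inter> W) g" using assms(1) by (rule manifold_ck_subset) simp
  show "vck k (V \<inter> W) (\<lambda>x. \<tau> x (smul (g x) (\<xi> x)))"
    by (rule vck_cong[OF vck_scale[OF g secD[OF assms(2) V]]]) (simp add: lin_scale[OF triv_lin[OF V]])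
qed

lemma sec_rs: "mck k W f \<Longrightarrow> sec k W \<xi> \<Longrightarrow> sec k W (\<lambda>x. rs (f x) (\<xi> x))"
  by (rule sec_smul[OF manifold_ck_bounded_linear[OF bounded_linear_of_real]])

lemma sec_br:
  assumes "sec k W \<xi>" "sec k W \<eta>"
  shows "sec k W (\<lambda>x. br (\<xi> x) (\<eta> x))"
  unfolding sec_def
proof clarify
  fix V \<tau> assume V: "(V, \<tau>) \<in> triv"
  show "vck k (V \<inter> W) (\<lambda>x. \<tau> x (br (\<xi> x) (\<eta> x)))"
    by (rule vck_cong[OF vck_br[OF secD[OF assms(1) V] secD[OF assms(2) V]]]) (simp add: triv_br[OF V])
qed

section \<open>Extension by cut-off and local frames\<close>

definition ext :: "('m \<Rightarrow> real) \<Rightarrow> 'm set \<Rightarrow> ('m \<Rightarrow> 'f) \<Rightarrow> 'm \<Rightarrow> 'f"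
  where "ext \<rho> W \<xi> x = (if x \<in> W then rs (\<rho> x) (\<xi> x) else 0)"

lemma sec_ext:
  assumes \<rho>: "mck k UNIV \<rho>" and c: "closure {x. \<rho> x \<noteq> 0} \<subseteq> W" and W: "open W" and \<xi>: "sec k W \<xi>"
  shows "sec k UNIV (ext \<rho> W \<xi>)"
proof -
  let ?K = "closure {x. \<rho> x \<noteq> 0}"
  have "sec k (\<Union>{W, - ?K}) (ext \<rho> W \<xi>)"
  proof (rule sec_Union)
    fix V assume "V \<in> {W, - ?K}"
    moreover have "sec k W (ext \<rho> W \<xi>)"
      by (rule sec_cong[OF sec_rs[OF manifold_ck_subset[OF \<rho>] \<xi>]]) (auto simp: ext_def)
    moreover have "sec k (- ?K) (ext \<rho> W \<xi>)"
      by (rule sec_cong[OF sec_zero]) (use closure_subset[of "{x. \<rho> x \<noteq> 0}"] in \<open>auto simp: ext_def\<close>)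
    ultimately show "sec k V (ext \<rho> W \<xi>)" by auto
  qed (use W in auto)
  moreover have "\<Union>{W, - ?K} = UNIV" using c by auto
  ultimately show ?thesis by simp
qed

lemma sec_frame:
  assumes "(V, \<tau>) \<in> triv" "W \<subseteq> V"
  shows "sec k W (\<lambda>y. inv (\<tau> y) w)"
  by (rule sec_chart[OF assms], rule vck_cong[OF vck_const[of k W w]])
     (use assms triv_inv_right in auto)

text \<open>Global sections that are constant in a trivialization near a point. They reach every
  element of a fiber and serve as test sections for fields of endomorphisms.\<close>

lemma frame_extension:
  assumes V: "(V, \<tau>) \<in> triv" and x: "x \<in> V"
  obtains \<xi> N where "sec k UNIV \<xi>" "open N" "x \<in> N" "N \<subseteq> V" "\<And>y. y \<in> N \<Longrightarrow> \<tau> y (\<xi> y) = w"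
proof -
  obtain b where b: "mck k UNIV b" "closure {y. b y \<noteq> 0} \<subseteq> V"
    "\<exists>N. open N \<and> x \<in> N \<and> (\<forall>y\<in>N. b y = (1::real))"
    by (rule bump[OF triv_open[OF V] x, of k])
  then obtain N where N: "open N" "x \<in> N" "\<And>y. y \<in> N \<Longrightarrow> b y = 1" by blast
  have s: "sec k UNIV (ext b V (\<lambda>y. inv (\<tau> y) w))"
    using sec_ext[OF b(1,2) triv_open[OF V] sec_frame[OF V]] by simp
  show ?thesis
    by (rule that[OF s, of "N \<inter> V"])
       (use N x triv_open[OF V] triv_inv_right[OF V] in \<open>auto simp: ext_def\<close>)
qed

lemma section_through: obtains \<xi> where "sec k UNIV \<xi>" "\<xi> x = v"
proof -
  obtain V \<tau> where V: "(V, \<tau>) \<in> triv" "x \<in> V" by (rule triv_at)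
  obtain \<xi> N where \<xi>: "sec k UNIV \<xi>" "open N" "x \<in> N" "N \<subseteq> V" "\<And>y. y \<in> N \<Longrightarrow> \<tau> y (\<xi> y) = \<tau> x v"
    by (rule frame_extension[OF V]) blast
  then have "\<xi> x = v" using triv_inj[OF V] by blast
  then show ?thesis using that \<xi>(1) by blast
qed

lemma endomorphism_section:
  assumes lin: "\<And>x. lin (A x)"
    and A: "\<And>V \<tau>. (V, \<tau>) \<in> triv \<Longrightarrow> end_ck smul atlas k V (\<lambda>x. \<tau> x \<circ> A x \<circ> inv (\<tau> x))"
    and \<xi>: "sec k UNIV \<xi>"
  shows "sec k UNIV (\<lambda>x. A x (\<xi> x))"
  unfolding sec_def
proof clarify
  fix V \<tau> assume V: "(V, \<tau>) \<in> triv"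
  have *: "vck k V (\<lambda>x. (\<tau> x \<circ> A x \<circ> inv (\<tau> x)) (\<tau> x (\<xi> x)))"
    using secD[OF \<xi> V] triv_lin[OF V] triv_inv_lin[OF V] lin
    by (intro vck_end_apply[OF A[OF V]]) (auto intro!: Vector_Spaces.linear_compose)
  show "vck k (V \<inter> UNIV) (\<lambda>x. \<tau> x (A x (\<xi> x)))"
    using vck_cong[OF *, of "\<lambda>x. \<tau> x (A x (\<xi> x))"] triv_inv_left[OF V] by simp
qed

text \<open>Near a point a constant vector is the local expression of a global section, so the
  hypothesis on sections controls the matrix coefficients there.\<close>

lemma endomorphism_smooth:
  assumes A: "\<And>\<xi>. sec k UNIV \<xi> \<Longrightarrow> sec k UNIV (\<lambda>x. A x (\<xi> x))" and V: "(V, \<tau>) \<in> triv"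
  shows "end_ck smul atlas k V (\<lambda>x. \<tau> x \<circ> A x \<circ> inv (\<tau> x))"
  unfolding end_ck_def
proof
  fix v
  define \<W> where "\<W> = {N. open N \<and> N \<subseteq> V \<and> vck k N (\<lambda>x. (\<tau> x \<circ> A x \<circ> inv (\<tau> x)) v)}"
  have "V \<subseteq> \<Union>\<W>"
  proof
    fix x assume x: "x \<in> V"
    obtain \<xi> N where \<xi>: "sec k UNIV \<xi>" "open N" "x \<in> N" "N \<subseteq> V" "\<And>y. y \<in> N \<Longrightarrow> \<tau> y (\<xi> y) = v"
      by (rule frame_extension[OF V x]) blast
    have "vck k N (\<lambda>x. \<tau> x (A x (\<xi> x)))"
      using secD[OF A[OF \<xi>(1)] V] by (rule vck_subset) (use \<xi>(4) in simp)
    then have "vck k N (\<lambda>x. (\<tau> x \<circ> A x \<circ> inv (\<tau> x)) v)"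
      by (rule vck_cong) (use \<xi>(4,5) triv_inv_left[OF V] in force)
    then show "x \<in> \<Union>\<W>" using \<xi> by (auto simp: \<W>_def)
  qed
  then have "V = \<Union>\<W>" by (auto simp: \<W>_def)
  moreover have "vck k (\<Union>\<W>) (\<lambda>x. (\<tau> x \<circ> A x \<circ> inv (\<tau> x)) v)"
    by (rule vck_Union) (auto simp: \<W>_def)
  ultimately show "vck k V (\<lambda>x. (\<tau> x \<circ> A x \<circ> inv (\<tau> x)) v)" by simp
qed

end

section \<open>Derivations of sections\<close>

context lie_bundle_model
begin

text \<open>The fiberwise decomposition is carried out once per colour, giving finitely many
  brackets in all. Cut-offs are put on both entries of each bracket so that both extend by zero;
  their products \<mu>^2 / \<Theta> add up to 1.\<close>

lemma sections_perfect:
  assumes perf: "perfect_lie smul br" and \<xi>: "sec k UNIV \<xi>"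
  obtains I :: "(nat \<times> 'f \<times> nat) set" and \<eta> \<zeta> where "finite I" "\<And>i. sec k UNIV (\<eta> i)" "\<And>i. sec k UNIV (\<zeta> i)"
    "\<xi> = (\<lambda>x. \<Sum>i\<in>I. br (\<eta> i x) (\<zeta> i x))"
proof -
  obtain A :: "('f \<times> nat) set" and T e where A: "finite A" "\<And>a. lin (T a)" "\<And>v. v = (\<Sum>a\<in>A. br (T a v) (e a))"
    by (rule perfect_decomposition[OF perf]) blast
  define \<U> where "\<U> = fst ` triv"
  have op: "open U" if "U \<in> \<U>" for U using that triv_open by (auto simp: \<U>_def)
  have cov: "\<Union>\<U> = UNIV"
  proof -
    have "x \<in> \<Union>\<U>" for x
    proof -
      obtain V \<tau> where "(V, \<tau>) \<in> triv" "x \<in> V" by (rule triv_at)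
      then show ?thesis by (force simp: \<U>_def)
    qed
    then show ?thesis by blast
  qed
  obtain n :: nat and \<W> :: "nat \<Rightarrow> 'm set set" and \<mu> :: "nat \<Rightarrow> 'm \<Rightarrow> real" where W:
    "\<And>c W. W \<in> \<W> c \<Longrightarrow> open W" "\<And>c W. W \<in> \<W> c \<Longrightarrow> \<exists>U\<in>\<U>. W \<subseteq> U"
    "\<And>c W W'. W \<in> \<W> c \<Longrightarrow> W' \<in> \<W> c \<Longrightarrow> W \<noteq> W' \<Longrightarrow> W \<inter> W' = {}"
    "\<And>c. mck k UNIV (\<mu> c)" "\<And>c. closure {x. \<mu> c x \<noteq> 0} \<subseteq> \<Union>(\<W> c)"
    "\<And>x. \<exists>c<n. \<mu> c x \<noteq> 0"
    using colored_cover[OF op cov, of k] by metis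
  have "\<exists>V \<tau>. (V, \<tau>) \<in> triv \<and> W \<subseteq> V" if Wc: "W \<in> \<W> c" for W c
  proof -
    obtain p where "p \<in> triv" "W \<subseteq> fst p" using W(2)[OF Wc] by (auto simp: \<U>_def)
    then show ?thesis by (metis prod.collapse)
  qed
  then obtain V t where Vt: "\<And>W c. W \<in> \<W> c \<Longrightarrow> (V W, t W) \<in> triv \<and> W \<subseteq> V W" by metis
  \<comment> \<open>At a point covered by colour \<open>c\<close> exactly one member contains it, so
    the trivializations of the members merge into a single one over their union.\<close>
  define \<sigma> where "\<sigma> c x = t (THE W. W \<in> \<W> c \<and> x \<in> W) x" for c x
  have \<sigma>: "\<sigma> c x = t W x" if "W \<in> \<W> c" "x \<in> W" for W c x
  proof -
    have "(THE W. W \<in> \<W> c \<and> x \<in> W) = W" using that W(3) by (intro the_equality) blast+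
    then show ?thesis by (simp add: \<sigma>_def)
  qed
  have opO: "open (\<Union>(\<W> c))" for c using W(1) by blast
  have glue: "sec k (\<Union>(\<W> c)) \<eta>" if "\<And>W. W \<in> \<W> c \<Longrightarrow> sec k W \<eta>" for c \<eta>
    using W(1) that by (rule sec_Union)
  have frame: "sec k (\<Union>(\<W> c)) (\<lambda>x. inv (\<sigma> c x) w)" for c w
  proof (rule glue)
    fix W assume W': "W \<in> \<W> c"
    then have "(V W, t W) \<in> triv" "W \<subseteq> V W" using Vt by simp_all
    then have "sec k W (\<lambda>x. inv (t W x) w)" by (rule sec_frame)
    then show "sec k W (\<lambda>x. inv (\<sigma> c x) w)" by (rule sec_cong) (simp add: \<sigma>[OF W'])
  qed
  have comp: "sec k (\<Union>(\<W> c)) (\<lambda>x. inv (\<sigma> c x) (T a (\<sigma> c x (\<xi> x))))" for c a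
  proof (rule glue)
    fix W assume w: "W \<in> \<W> c"
    then have VW: "(V W, t W) \<in> triv" "W \<subseteq> V W" using Vt by simp_all
    have *: "vck k W (\<lambda>x. T a (t W x (\<xi> x)))"
      using vck_lin[OF A(2) secD[OF \<xi> VW(1)]] by (rule vck_subset) (use VW(2) in auto)
    have "sec k W (\<lambda>x. inv (t W x) (T a (t W x (\<xi> x))))"
      by (rule sec_chart[OF VW], rule vck_cong[OF *]) (use triv_inv_right[OF VW(1)] VW(2) in auto)
    then show "sec k W (\<lambda>x. inv (\<sigma> c x) (T a (\<sigma> c x (\<xi> x))))" by (rule sec_cong) (simp add: \<sigma>[OF w])
  qed
  define \<Theta> where "\<Theta> x = (\<Sum>c<n. (\<mu> c x)\<^sup>2)" for x
  have \<Theta>: "\<Theta> x > 0" for x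
  proof -
    obtain c where "c < n" "\<mu> c x \<noteq> 0" using W(6) by blast
    then show ?thesis unfolding \<Theta>_def by (intro sum_pos2[of _ c]) auto
  qed
  have \<Theta>c: "mck k UNIV (\<lambda>x. inverse (\<Theta> x))"
    unfolding \<Theta>_def
    by (rule manifold_ck_inverse, intro manifold_ck_sum manifold_ck_power W(4))
       (use \<Theta> in \<open>metis \<Theta>_def less_irrefl\<close>)
  \<comment> \<open>The normalization is placed on one of the two entries only; the other keeps the
    plain cut-off \<mu>.\<close>
  define \<nu> where "\<nu> c x = inverse (\<Theta> x) * \<mu> c x" for c x
  have \<nu>: "mck k UNIV (\<nu> c)" for c unfolding \<nu>_def by (intro manifold_ck_mult \<Theta>c W(4))
  have "{x. \<nu> c x \<noteq> 0} \<subseteq> {x. \<mu> c x \<noteq> 0}" for c by (auto simp: \<nu>_def)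
  then have \<nu>cl: "closure {x. \<nu> c x \<noteq> 0} \<subseteq> \<Union>(\<W> c)" for c
    using W(5) closure_mono by (metis order_trans)
  define \<eta> where "\<eta> = (\<lambda>(c, a). ext (\<nu> c) (\<Union>(\<W> c)) (\<lambda>x. inv (\<sigma> c x) (T a (\<sigma> c x (\<xi> x)))))"
  define \<zeta> where "\<zeta> = (\<lambda>(c, a). ext (\<mu> c) (\<Union>(\<W> c)) (\<lambda>x. inv (\<sigma> c x) (e a)))"
  show ?thesis
  proof (rule that[of "{..<n} \<times> A" \<eta> \<zeta>])
    show "finite ({..<n} \<times> A)" using A(1) by simp
    show "sec k UNIV (\<eta> i)" for i
      by (cases i) (simp add: \<eta>_def sec_ext[OF \<nu> \<nu>cl opO comp])
    show "sec k UNIV (\<zeta> i)" for i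
      by (cases i) (simp add: \<zeta>_def sec_ext[OF W(4,5) opO frame])
    have one: "(\<Sum>a\<in>A. br (\<eta> (c, a) x) (\<zeta> (c, a) x)) = rs (inverse (\<Theta> x) * (\<mu> c x)\<^sup>2) (\<xi> x)" for c x
    proof (cases "x \<in> \<Union>(\<W> c)")
      case True
      then obtain W' where W': "W' \<in> \<W> c" "x \<in> W'" by blast
      then have VW: "(V W', t W') \<in> triv" "x \<in> V W'" using Vt[of W' c] by auto
      have "(\<Sum>a\<in>A. br (\<eta> (c, a) x) (\<zeta> (c, a) x)) =
        (\<Sum>a\<in>A. rs (inverse (\<Theta> x) * (\<mu> c x)\<^sup>2) (inv (t W' x) (br (T a (t W' x (\<xi> x))) (e a))))"
        using True by (intro sum.cong)
          (simp_all add: \<eta>_def \<zeta>_def ext_def \<sigma>[OF W'] br_scale_left br_scale_right triv_inv_br[OF VW] \<nu>_def power2_eq_square mult_ac)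
      also have "\<dots> = rs (inverse (\<Theta> x) * (\<mu> c x)\<^sup>2) (inv (t W' x) (\<Sum>a\<in>A. br (T a (t W' x (\<xi> x))) (e a)))"
        by (simp add: scale_sum_right lin_sum[OF triv_inv_lin[OF VW]])
      also have "\<dots> = rs (inverse (\<Theta> x) * (\<mu> c x)\<^sup>2) (\<xi> x)"
        using A(3) triv_inv_left[OF VW] by metis
      finally show ?thesis .
    next
      case False
      then have "\<mu> c x = 0" using W(5)[of c] closure_subset[of "{x. \<mu> c x \<noteq> 0}"] by blast
      then show ?thesis using False by (simp add: \<eta>_def \<zeta>_def ext_def)
    qed
    show "\<xi> = (\<lambda>x. \<Sum>i\<in>{..<n} \<times> A. br (\<eta> i x) (\<zeta> i x))"
    proof
      fix x
      have "(\<Sum>i\<in>{..<n} \<times> A. br (\<eta> i x) (\<zeta> i x)) = (\<Sum>c<n. \<Sum>a\<in>A. br (\<eta> (c, a) x) (\<zeta> (c, a) x))"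
        by (simp add: sum.cartesian_product)
      also have "\<dots> = (\<Sum>c<n. rs (inverse (\<Theta> x) * (\<mu> c x)\<^sup>2) (\<xi> x))" by (simp only: one)
      also have "\<dots> = rs (\<Sum>c<n. inverse (\<Theta> x) * (\<mu> c x)\<^sup>2) (\<xi> x)" by (simp add: scale_sum_left)
      also have "(\<Sum>c<n. inverse (\<Theta> x) * (\<mu> c x)\<^sup>2) = 1"
        using \<Theta>[of x] by (simp add: \<Theta>_def flip: sum_distrib_left)
      finally show "\<xi> x = (\<Sum>i\<in>{..<n} \<times> A. br (\<eta> i x) (\<zeta> i x))" by simp
    qed
  qed
qed

end

section \<open>Derivations are linear over functions and act pointwise\<close>

locale section_derivation = lie_bundle_model smul br E atlas triv
  for smul :: "'k::real_normed_field \<Rightarrow> 'f::ab_group_add \<Rightarrow> 'f"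
    and br :: "'f \<Rightarrow> 'f \<Rightarrow> 'f"
    and E :: "'e::euclidean_space set"
    and atlas :: "('m::t2_space set \<times> ('m \<Rightarrow> 'e)) set"
    and triv :: "('m set \<times> ('m \<Rightarrow> 'f \<Rightarrow> 'f)) set" +
  fixes k :: nat and D :: "('m \<Rightarrow> 'f) \<Rightarrow> 'm \<Rightarrow> 'f"
  assumes D_sec: "\<And>\<xi>. sec k UNIV \<xi> \<Longrightarrow> sec k UNIV (D \<xi>)"
    and D_add: "\<And>\<xi> \<eta> x. sec k UNIV \<xi> \<Longrightarrow> sec k UNIV \<eta> \<Longrightarrow> D (\<lambda>x. \<xi> x + \<eta> x) x = D \<xi> x + D \<eta> x"
    and D_scale: "\<And>\<xi> c x. sec k UNIV \<xi> \<Longrightarrow> D (\<lambda>x. smul c (\<xi> x)) x = smul c (D \<xi> x)"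
    and D_br: "\<And>\<xi> \<eta> x. sec k UNIV \<xi> \<Longrightarrow> sec k UNIV \<eta> \<Longrightarrow>
      D (\<lambda>x. br (\<xi> x) (\<eta> x)) x = br (D \<xi> x) (\<eta> x) + br (\<xi> x) (D \<eta> x)"
    and perfect_or_centerfree: "perfect_lie smul br \<or> centerfree_lie br"
begin

lemma D_zero: "D (\<lambda>x. 0) x = 0"
  using D_scale[OF sec_zero, of 0 x] by simp

lemma D_sum: "(\<And>i. i \<in> I \<Longrightarrow> sec k UNIV (\<xi> i)) \<Longrightarrow> D (\<lambda>x. \<Sum>i\<in>I. \<xi> i x) x = (\<Sum>i\<in>I. D (\<xi> i) x)"
proof (induction I rule: infinite_finite_induct)
  case (insert i I)
  then show ?case
    using D_add[of "\<xi> i" "\<lambda>x. \<Sum>i\<in>I. \<xi> i x" x] by (simp add: sec_sum)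
qed (simp_all add: D_zero)

definition second_difference :: "('m \<Rightarrow> real) \<Rightarrow> ('m \<Rightarrow> real) \<Rightarrow> ('m \<Rightarrow> 'f) \<Rightarrow> 'm \<Rightarrow> 'f"
  where "second_difference f g \<xi> x =
    (D (\<lambda>x. rs (f x * g x) (\<xi> x)) x + rs (f x * g x) (D \<xi> x)) -
    (rs (f x) (D (\<lambda>x. rs (g x) (\<xi> x)) x) + rs (g x) (D (\<lambda>x. rs (f x) (\<xi> x)) x))"

context
  fixes f g :: "'m \<Rightarrow> real"
  assumes f: "mck k UNIV f" and g: "mck k UNIV g"
begin

lemma fg: "mck k UNIV (\<lambda>x. f x * g x)"
  using f g by (rule manifold_ck_mult)

text \<open>
  With \<open>m\<^sub>f\<close> the multiplication by \<open>f\<close>, the second difference is the commutator of \<open>[D, m\<^sub>f]\<close> and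
  \<open>m\<^sub>g\<close>. Both lie in the centroid of the Lie algebra of sections, so their commutator kills
  brackets and has values in the center.
\<close>
lemma second_difference_bracket:
  assumes \<xi>: "sec k UNIV \<xi>" and \<eta>: "sec k UNIV \<eta>"
  shows "second_difference f g (\<lambda>x. br (\<xi> x) (\<eta> x)) x = 0"
proof -
  \<comment> \<open>The bracket is split asymmetrically: \<open>f\<close> always goes to the left
    entry and \<open>g\<close> to the right one. With this choice all terms of the second difference
    cancel in pairs.\<close>
  have 1: "D (\<lambda>x. rs (f x * g x) (br (\<xi> x) (\<eta> x))) x =
      br (D (\<lambda>x. rs (f x) (\<xi> x)) x) (rs (g x) (\<eta> x)) + br (rs (f x) (\<xi> x)) (D (\<lambda>x. rs (g x) (\<eta> x)) x)"
    using D_br[OF sec_rs[OF f \<xi>] sec_rs[OF g \<eta>], of x]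
    by (simp add: br_scale_left br_scale_right mult.commute)
  have 2: "D (\<lambda>x. rs (g x) (br (\<xi> x) (\<eta> x))) x = br (D \<xi> x) (rs (g x) (\<eta> x)) + br (\<xi> x) (D (\<lambda>x. rs (g x) (\<eta> x)) x)"
    using D_br[OF \<xi> sec_rs[OF g \<eta>], of x] by (simp add: br_scale_right)
  have 3: "D (\<lambda>x. rs (f x) (br (\<xi> x) (\<eta> x))) x = br (D (\<lambda>x. rs (f x) (\<xi> x)) x) (\<eta> x) + br (rs (f x) (\<xi> x)) (D \<eta> x)"
    using D_br[OF sec_rs[OF f \<xi>] \<eta>, of x] by (simp add: br_scale_left)
  show ?thesis
    unfolding second_difference_def 1 2 3 D_br[OF \<xi> \<eta>]
    by (simp add: br_scale_left br_scale_right scale_right_distrib mult_ac add_ac)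
qed

lemma bracket_second_difference:
  assumes \<xi>: "sec k UNIV \<xi>" and \<eta>: "sec k UNIV \<eta>"
  shows "br (second_difference f g \<xi> x) (\<eta> x) = 0"
proof -
  \<comment> \<open>Here every multiplier stays in the left entry, so the second difference passes
    through the bracket.\<close>
  have *: "D (\<lambda>x. rs (h x) (br (\<xi> x) (\<eta> x))) x = br (D (\<lambda>x. rs (h x) (\<xi> x)) x) (\<eta> x) + rs (h x) (br (\<xi> x) (D \<eta> x))"
    if "mck k UNIV h" for h
    using D_br[OF sec_rs[OF that \<xi>] \<eta>, of x] by (simp add: br_scale_left)
  have "second_difference f g (\<lambda>x. br (\<xi> x) (\<eta> x)) x = br (second_difference f g \<xi> x) (\<eta> x)"
    unfolding second_difference_def *[OF f] *[OF g] *[OF fg] D_br[OF \<xi> \<eta>]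
    by (simp add: br_scale_left br_diff_left br_add_left scale_right_distrib mult_ac add_ac)
  then show ?thesis using second_difference_bracket[OF \<xi> \<eta>] by simp
qed

lemma second_difference_sum:
  assumes "\<And>i. i \<in> I \<Longrightarrow> sec k UNIV (\<xi> i)"
  shows "second_difference f g (\<lambda>x. \<Sum>i\<in>I. \<xi> i x) x = (\<Sum>i\<in>I. second_difference f g (\<xi> i) x)"
  unfolding second_difference_def
  using assms by (simp add: D_sum sec_rs f g fg scale_sum_right sum.distrib sum_subtractf del: of_real_mult)

text \<open>The hypotheses enter in dual ways. A perfect fiber makes every section a sum of
  brackets, on which the second difference vanishes; a centerfree fiber leaves no room for its
  values, since sections pass through all elements of a fiber.\<close>

lemma second_difference_zero:
  assumes \<xi>: "sec k UNIV \<xi>"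
  shows "second_difference f g \<xi> x = 0"
  using perfect_or_centerfree
proof
  assume "perfect_lie smul br"
  then obtain I :: "(nat \<times> 'f \<times> nat) set" and \<eta> \<zeta> where I: "\<And>i. sec k UNIV (\<eta> i)" "\<And>i. sec k UNIV (\<zeta> i)"
    "\<xi> = (\<lambda>x. \<Sum>i\<in>I. br (\<eta> i x) (\<zeta> i x))"
    by (rule sections_perfect[OF _ \<xi>]) blast
  show ?thesis
    unfolding I(3) using I(1,2) by (simp add: second_difference_sum sec_br second_difference_bracket)
next
  assume "centerfree_lie br"
  moreover have "second_difference f g \<xi> x \<in> lie_center br"
    unfolding lie_center_def
  proof (clarify)
    fix v
    obtain \<eta> where "sec k UNIV \<eta>" "\<eta> x = v" by (rule section_through)
    then show "br (second_difference f g \<xi> x) v = 0" using bracket_second_difference[OF \<xi>] by blast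
  qed
  ultimately show ?thesis by (simp add: centerfree_lie_def)
qed

end

lemma D_function_linear:
  assumes f: "mck k UNIV f" and \<xi>: "sec k UNIV \<xi>"
  shows "D (\<lambda>x. rs (f x) (\<xi> x)) x = rs (f x) (D \<xi> x)"
proof -
  obtain V \<tau> where V: "(V, \<tau>) \<in> triv" "x \<in> V" by (rule triv_at)
  define \<Delta> where "\<Delta> f y = D (\<lambda>x. rs (f x) (\<xi> x)) y - rs (f y) (D \<xi> y)" for f :: "'m \<Rightarrow> real" and y
  have \<Delta>s: "sec k UNIV (\<Delta> h)" if h: "mck k UNIV h" for h
  proof -
    have "mck k UNIV (\<lambda>x. - h x)" using h by (rule manifold_ck_uminus)
    then have "sec k UNIV (\<lambda>y. D (\<lambda>x. rs (h x) (\<xi> x)) y + rs (- h y) (D \<xi> y))"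
      by (intro sec_add D_sec sec_rs h \<xi>)
    then show ?thesis by (rule sec_cong) (simp add: \<Delta>_def)
  qed
  have \<Delta>add: "\<Delta> (\<lambda>x. g x + h x) y = \<Delta> g y + \<Delta> h y" if "mck k UNIV g" "mck k UNIV h" for g h y
    using D_add[OF sec_rs[OF that(1) \<xi>] sec_rs[OF that(2) \<xi>], of y]
    by (simp add: \<Delta>_def scale_left_distrib)
  have \<Delta>const: "\<Delta> (\<lambda>_. c) y = 0" for c y
    using D_scale[OF \<xi>, of "of_real c" y] by (simp add: \<Delta>_def)
  \<comment> \<open>Rearranged, the vanishing of the second difference is the Leibniz rule for
    \<Delta> = [D, m_f] \<xi>.\<close>
  have \<Delta>mult: "\<Delta> (\<lambda>x. g x * h x) y = rs (g y) (\<Delta> h y) + rs (h y) (\<Delta> g y)"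
    if "mck k UNIV g" "mck k UNIV h" for g h y
    using second_difference_zero[OF that \<xi>, of y]
    by (simp add: second_difference_def \<Delta>_def scale_right_diff_distrib algebra_simps)
  obtain re im :: "'k \<Rightarrow> real" and j where K: "bounded_linear re" "bounded_linear im"
    "\<And>z. z = of_real (re z) + of_real (im z) * j"
    by (rule real_normed_field_cases) blast
  \<comment> \<open>A functional followed by a real-linear map to the reals makes \<Delta> a scalar
    derivation over \<open>V\<close>, to which the vanishing theorem for finite \<open>k\<close>
    applies.\<close>
  have zero: "p (l (\<tau> x (\<Delta> f x))) = 0" if p: "bounded_linear p" and l: "functional l" for p :: "'k \<Rightarrow> real" and l
  proof -
    interpret p: bounded_linear p by (rule p)
    have pl: "p (of_real r * z) = r * p z" for r z
      using p.scaleR[of r z] by (simp add: scaleR_conv_of_real)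
    interpret ck_derivation E atlas k V "\<lambda>f y. p (l (\<tau> y (\<Delta> f y)))"
    proof
      show "open V" using V by (simp add: triv_open)
      show "mck k V (\<lambda>y. p (l (\<tau> y (\<Delta> h y))))" if "mck k UNIV h" for h
        using vck_functional[OF secD[OF \<Delta>s[OF that] V(1)] l] by (intro manifold_ck_bounded_linear[OF p]) simp
      show "p (l (\<tau> y (\<Delta> (\<lambda>x. g x + h x) y))) = p (l (\<tau> y (\<Delta> g y))) + p (l (\<tau> y (\<Delta> h y)))"
        if "mck k UNIV g" "mck k UNIV h" "y \<in> V" for g h y
        by (simp add: \<Delta>add[OF that(1,2)] lin_add[OF triv_lin[OF V(1) that(3)]] functional_add[OF l] p.add)
      show "p (l (\<tau> y (\<Delta> (\<lambda>_. c) y))) = 0" if "y \<in> V" for c y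
        by (simp add: \<Delta>const lin_zero[OF triv_lin[OF V(1) that]] functional_zero[OF l] p.zero)
      show "p (l (\<tau> y (\<Delta> (\<lambda>x. g x * h x) y))) = g y * p (l (\<tau> y (\<Delta> h y))) + h y * p (l (\<tau> y (\<Delta> g y)))"
        if "mck k UNIV g" "mck k UNIV h" "y \<in> V" for g h y
        by (simp add: \<Delta>mult[OF that(1,2)] lin_add[OF triv_lin[OF V(1) that(3)]] lin_scale[OF triv_lin[OF V(1) that(3)]]
            functional_add[OF l] functional_scale[OF l] p.add pl)
    qed
    show ?thesis by (rule zero[OF f V(2)])
  qed
  obtain B co where B: "\<And>b. functional (co b)" "\<And>v. v = (\<Sum>b\<in>B. smul (co b v) b)"
    by (rule coordinates) blast
  have "co b (\<tau> x (\<Delta> f x)) = 0" for b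
    using K(3)[of "co b (\<tau> x (\<Delta> f x))"] zero[OF K(1) B(1)[of b]] zero[OF K(2) B(1)[of b]] by simp
  then have "\<tau> x (\<Delta> f x) = \<tau> x 0"
    using B(2)[of "\<tau> x (\<Delta> f x)"] by (simp add: lin_zero[OF triv_lin[OF V]])
  then have "\<Delta> f x = 0" by (rule triv_inj[OF V])
  then show ?thesis by (simp add: \<Delta>_def)
qed

text \<open>Near \<open>x\<close> the section is a combination of frame sections whose coefficients
  vanish at \<open>x\<close>, and \<open>D\<close> commutes with the coefficients. As this is known
  for real functions only, a coefficient is split into its two real parts, the second of which
  multiplies the frame section of \<open>smul j b\<close>.\<close>

lemma D_vanishes:
  assumes \<xi>: "sec k UNIV \<xi>" and x: "\<xi> x = 0"
  shows "D \<xi> x = 0"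
proof -
  obtain V \<tau> where V: "(V, \<tau>) \<in> triv" "x \<in> V" by (rule triv_at)
  obtain \<rho> where \<rho>: "mck k UNIV \<rho>" "closure {y. \<rho> y \<noteq> 0} \<subseteq> V"
    "\<exists>N. open N \<and> x \<in> N \<and> (\<forall>y\<in>N. \<rho> y = (1::real))"
    by (rule bump[OF triv_open[OF V(1)] V(2), of k])
  have \<rho>x: "\<rho> x = 1" using \<rho>(3) by blast
  have \<rho>0: "\<rho> y = 0" if "y \<notin> V" for y using \<rho>(2) that closure_subset[of "{y. \<rho> y \<noteq> 0}"] by blast
  obtain re im :: "'k \<Rightarrow> real" and j where K: "bounded_linear re" "bounded_linear im"
    "\<And>z. z = of_real (re z) + of_real (im z) * j"
    by (rule real_normed_field_cases) blast
  obtain B co where B: "finite B" "\<And>b. functional (co b)" "\<And>v. v = (\<Sum>b\<in>B. smul (co b v) b)"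
    by (rule coordinates) blast
  define e where "e w = ext \<rho> V (\<lambda>y. inv (\<tau> y) w)" for w
  have e: "sec k UNIV (e w)" for w
    unfolding e_def using sec_ext[OF \<rho>(1,2) triv_open[OF V(1)] sec_frame[OF V(1)]] by simp
  define G where "G p b y = (if y \<in> V then \<rho> y * p (co b (\<tau> y (\<xi> y))) else 0)" for p :: "'k \<Rightarrow> real" and b y
  have G: "mck k UNIV (G p b)" if "bounded_linear p" for p b
    unfolding G_def
  proof (rule manifold_ck_zero_extension[OF triv_open[OF V(1)] _ closed_closure \<rho>(2)])
    have "mck k V (\<lambda>y. co b (\<tau> y (\<xi> y)))" using vck_functional[OF secD[OF \<xi> V(1)] B(2)] by simp
    then show "mck k V (\<lambda>y. \<rho> y * p (co b (\<tau> y (\<xi> y))))"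
      using manifold_ck_subset[OF \<rho>(1)] by (intro manifold_ck_mult manifold_ck_bounded_linear[OF that]) auto
  next
    fix y assume "y \<in> V - closure {y. \<rho> y \<noteq> 0}"
    then have "\<rho> y = 0" using closure_subset[of "{y. \<rho> y \<noteq> 0}"] by auto
    then show "\<rho> y * p (co b (\<tau> y (\<xi> y))) = 0" by simp
  qed
  have G0: "G p b x = 0" if "bounded_linear p" for p b
    using x functional_zero[OF B(2)] lin_zero[OF triv_lin[OF V]] linear_0[OF bounded_linear.linear[OF that]]
    by (simp add: G_def)
  \<comment> \<open>One factor \<rho> makes the coefficient global and the other the frame section,
    so the identity holds for \<rho>^2 \<xi>. It is harmless to replace \<xi> by this because \<rho>
    is 1 at \<open>x\<close>.\<close>
  have eq: "(\<lambda>y. rs (\<rho> y * \<rho> y) (\<xi> y)) = (\<lambda>y. \<Sum>b\<in>B. rs (G re b y) (e b y) + rs (G im b y) (e (smul j b) y))"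
  proof
    fix y
    show "rs (\<rho> y * \<rho> y) (\<xi> y) = (\<Sum>b\<in>B. rs (G re b y) (e b y) + rs (G im b y) (e (smul j b) y))"
    proof (cases "y \<in> V")
      case True
      let ?c = "\<lambda>b. co b (\<tau> y (\<xi> y))"
      have l: "lin (inv (\<tau> y))" using triv_inv_lin[OF V(1) True] .
      have "(\<Sum>b\<in>B. rs (G re b y) (e b y) + rs (G im b y) (e (smul j b) y)) =
        (\<Sum>b\<in>B. rs (\<rho> y * \<rho> y) (smul (of_real (re (?c b)) + of_real (im (?c b)) * j) (inv (\<tau> y) b)))"
        using True by (intro sum.cong) (simp_all add: G_def e_def ext_def lin_scale[OF l] algebra_simps)
      also have "\<dots> = (\<Sum>b\<in>B. rs (\<rho> y * \<rho> y) (smul (?c b) (inv (\<tau> y) b)))" by (simp flip: K(3))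
      also have "\<dots> = rs (\<rho> y * \<rho> y) (inv (\<tau> y) (\<Sum>b\<in>B. smul (?c b) b))"
        by (simp add: scale_sum_right lin_sum[OF l] lin_scale[OF l])
      also have "(\<Sum>b\<in>B. smul (?c b) b) = \<tau> y (\<xi> y)" by (rule B(3)[symmetric])
      finally show ?thesis by (simp add: triv_inv_left[OF V(1) True])
    qed (simp add: \<rho>0 G_def)
  qed
  have \<rho>2: "mck k UNIV (\<lambda>y. \<rho> y * \<rho> y)" using \<rho>(1) by (intro manifold_ck_mult)
  have s: "sec k UNIV (\<lambda>y. rs (G re b y) (e b y))" "sec k UNIV (\<lambda>y. rs (G im b y) (e (smul j b) y))" for b
    using G[OF K(1)] G[OF K(2)] e by (auto intro: sec_rs)
  have "D \<xi> x = D (\<lambda>y. rs (\<rho> y * \<rho> y) (\<xi> y)) x"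
    using D_function_linear[OF \<rho>2 \<xi>, of x] \<rho>x by simp
  also have "\<dots> = (\<Sum>b\<in>B. D (\<lambda>y. rs (G re b y) (e b y) + rs (G im b y) (e (smul j b) y)) x)"
    unfolding eq by (rule D_sum) (intro sec_add s)
  also have "\<dots> = (\<Sum>b\<in>B. D (\<lambda>y. rs (G re b y) (e b y)) x + D (\<lambda>y. rs (G im b y) (e (smul j b) y)) x)"
    by (intro sum.cong refl D_add s)
  also have "\<dots> = 0"
    using D_function_linear[OF G[OF K(1)] e] D_function_linear[OF G[OF K(2)] e] G0[OF K(1)] G0[OF K(2)]
    by simp
  finally show ?thesis .
qed

theorem D_pointwise:
  assumes \<xi>: "sec k UNIV \<xi>" and \<eta>: "sec k UNIV \<eta>" and eq: "\<xi> x = \<eta> x"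
  shows "D \<xi> x = D \<eta> x"
proof -
  have s: "sec k UNIV (\<lambda>x. smul (- 1) (\<eta> x))" by (rule sec_smul[OF manifold_ck_const \<eta>])
  have "D (\<lambda>x. \<xi> x + smul (- 1) (\<eta> x)) x = 0"
    by (rule D_vanishes[OF sec_add[OF \<xi> s]]) (simp add: eq)
  then show ?thesis using D_add[OF \<xi> s, of x] D_scale[OF \<eta>, of "- 1" x] by simp
qed

end

section \<open>Derivations of a bundle of Lie algebras\<close>

context smooth_manifold
begin

lemma end_ck_cong:
  assumes "end_ck smul atlas k W A" "\<And>x. x \<in> W \<Longrightarrow> A' x = A x"
  shows "end_ck smul atlas k W A'"
  unfolding end_ck_def vec_ck_def
proof (intro allI impI)
  fix v l assume "Vector_Spaces.linear smul (*) l"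
  then have "manifold_ck atlas k W (l \<circ> (\<lambda>x. A x v))" using assms(1) by (simp add: end_ck_def vec_ck_def)
  then show "manifold_ck atlas k W (l \<circ> (\<lambda>x. A' x v))"
    by (rule manifold_ck_cong) (simp add: assms(2))
qed

end

lemma lie_isoD:
  assumes "lie_iso G H h"
  shows "bij_betw h (lcarrier G) (lcarrier H)"
    "\<And>x y. x \<in> lcarrier G \<Longrightarrow> y \<in> lcarrier G \<Longrightarrow> h (ladd G x y) = ladd H (h x) (h y)"
    "\<And>c x. x \<in> lcarrier G \<Longrightarrow> h (lscale G c x) = lscale H c (h x)"
    "\<And>x y. x \<in> lcarrier G \<Longrightarrow> y \<in> lcarrier G \<Longrightarrow> h (lbracket G x y) = lbracket H (h x) (h y)"
  using assms by (auto simp: lie_iso_def)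

lemma lie_iso_inv_into:
  assumes h: "lie_iso G H h" and G: "lie_closed G"
  defines "g \<equiv> inv_into (lcarrier G) h"
  shows "u \<in> lcarrier H \<Longrightarrow> g u \<in> lcarrier G" "u \<in> lcarrier H \<Longrightarrow> h (g u) = u"
    "x \<in> lcarrier G \<Longrightarrow> g (h x) = x"
    "u \<in> lcarrier H \<Longrightarrow> v \<in> lcarrier H \<Longrightarrow> g (ladd H u v) = ladd G (g u) (g v)"
    "u \<in> lcarrier H \<Longrightarrow> g (lscale H c u) = lscale G c (g u)"
    "u \<in> lcarrier H \<Longrightarrow> v \<in> lcarrier H \<Longrightarrow> g (lbracket H u v) = lbracket G (g u) (g v)"
proof -
  have b: "bij_betw h (lcarrier G) (lcarrier H)" using h by (simp add: lie_iso_def)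
  show g: "u \<in> lcarrier H \<Longrightarrow> g u \<in> lcarrier G" for u
    unfolding g_def using bij_betw_inv_into[OF b] by (auto simp: bij_betw_def)
  show r: "u \<in> lcarrier H \<Longrightarrow> h (g u) = u" for u
    unfolding g_def using b by (rule bij_betw_inv_into_right)
  show l: "x \<in> lcarrier G \<Longrightarrow> g (h x) = x" for x
    unfolding g_def using b by (rule bij_betw_inv_into_left)
  show "u \<in> lcarrier H \<Longrightarrow> v \<in> lcarrier H \<Longrightarrow> g (ladd H u v) = ladd G (g u) (g v)"
    using l[of "ladd G (g u) (g v)"] lie_isoD(2)[OF h, of "g u" "g v"] g r G by (simp add: lie_closed_def)
  show "u \<in> lcarrier H \<Longrightarrow> g (lscale H c u) = lscale G c (g u)"
    using l[of "lscale G c (g u)"] lie_isoD(3)[OF h, of "g u" c] g r G by (simp add: lie_closed_def)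
  show "u \<in> lcarrier H \<Longrightarrow> v \<in> lcarrier H \<Longrightarrow> g (lbracket H u v) = lbracket G (g u) (g v)"
    using l[of "lbracket G (g u) (g v)"] lie_isoD(4)[OF h, of "g u" "g v"] g r G by (simp add: lie_closed_def)
qed

lemma lie_of_simps [simp]:
  "lcarrier (lie_of smul br) = UNIV" "ladd (lie_of smul br) = (+)"
  "lscale (lie_of smul br) = smul" "lbracket (lie_of smul br) = br"
  by (simp_all add: lie_of_def)

context lie_algebra_bundle
begin

section \<open>Passage from the bundle to the model\<close>

abbreviation fiber :: "'m \<Rightarrow> 'l set" where "fiber x \<equiv> lcarrier (fib x)"

text \<open>
  A discontinuous choice of bundle charts identifies all fibers with the model Lie algebra, so that
  sections become functions with values in the latter.
\<close>
definition chart_choice :: "'m \<Rightarrow> 'l \<Rightarrow> 'f"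
  where "chart_choice x = (SOME \<Phi>. \<exists>V. (V, \<Phi>) \<in> batlas \<and> x \<in> V)"

definition chart_inverse :: "'m \<Rightarrow> 'f \<Rightarrow> 'l"
  where "chart_inverse x = inv_into (fiber x) (chart_choice x)"

lemma chart_choice: "\<exists>V. (V, chart_choice x) \<in> batlas \<and> x \<in> V"
proof -
  have "x \<in> (\<Union>(V, \<Phi>)\<in>batlas. V)" using bundle_charts_cover by simp
  then have "\<exists>\<Phi> V. (V, \<Phi>) \<in> batlas \<and> x \<in> V" by auto
  then show ?thesis unfolding chart_choice_def by (rule someI_ex)
qed

lemma chart_choice_iso: "lie_iso (fib x) (lie_of smul br) (chart_choice x)"
  using chart_choice[of x] bundle_chart_iso by blast

lemmas chart_hom = lie_isoD(2-4)[OF chart_choice_iso, simplified]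
lemmas chart_inverse_simps = lie_iso_inv_into[OF chart_choice_iso fiber_closed, folded chart_inverse_def, simplified]

definition trivializations :: "('m set \<times> ('m \<Rightarrow> 'f \<Rightarrow> 'f)) set"
  where "trivializations = (\<lambda>(V, \<Phi>). (V, \<lambda>x. \<Phi> \<circ> chart_inverse x)) ` batlas"

text \<open>At each single point the map is a transition map, hence an automorphism. Regularity in
  \<open>x\<close> is lost because the chosen chart varies with the point.\<close>

lemma trivialization_transition: "(\<lambda>x. \<Phi> \<circ> chart_inverse x) x = transition fib (chart_choice x) \<Phi> x"
  by (simp add: transition_def chart_inverse_def)

lemma trivialization_iso:
  assumes V: "(V, \<Phi>) \<in> batlas" and x: "x \<in> V"
  shows "lie_iso (lie_of smul br) (lie_of smul br) (\<Phi> \<circ> chart_inverse x)"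
proof -
  obtain W where "(W, chart_choice x) \<in> batlas" "x \<in> W" using chart_choice by blast
  then show ?thesis
    using transition_automorphism[OF _ V, of W "chart_choice x" x] x trivialization_transition[of \<Phi> x] by simp
qed

lemma trivialization_inv:
  assumes V: "(V, \<Phi>) \<in> batlas" and x: "x \<in> V"
  shows "chart_inverse x \<circ> inv (\<Phi> \<circ> chart_inverse x) = inv_into (fiber x) \<Phi>"
proof
  fix v
  have P: "lie_iso (fib x) (lie_of smul br) \<Phi>" by (rule bundle_chart_iso[OF V x])
  have "bij (\<Phi> \<circ> chart_inverse x)"
    using lie_isoD(1)[OF trivialization_iso[OF V x]] by simp
  then have "surj (\<Phi> \<circ> chart_inverse x)" by (rule bij_is_surj)
  then have "\<Phi> (chart_inverse x (inv (\<Phi> \<circ> chart_inverse x) v)) = v"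
    using surj_f_inv_f[of "\<Phi> \<circ> chart_inverse x" v] by simp
  then show "(chart_inverse x \<circ> inv (\<Phi> \<circ> chart_inverse x)) v = inv_into (fiber x) \<Phi> v"
    using lie_iso_inv_into(3)[OF P fiber_closed, of "chart_inverse x (inv (\<Phi> \<circ> chart_inverse x) v)"]
      chart_inverse_simps(1) by simp
qed

text \<open>In the change of two trivializations the arbitrary chart choice cancels, and the
  original transition map remains.\<close>

sublocale model: lie_bundle_model smul br E atlas trivializations
proof (rule lie_bundle_model.intro[OF fin_dim_lie_algebra_axioms smooth_manifold_axioms], rule lie_bundle_model_axioms.intro)
  show "\<exists>(V, \<tau>)\<in>trivializations. x \<in> V" for x
    using chart_choice[of x] by (force simp: trivializations_def)
  fix V \<tau> assume "(V, \<tau>) \<in> trivializations"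
  then obtain \<Phi> where V: "(V, \<Phi>) \<in> batlas" and \<tau>: "\<tau> = (\<lambda>x. \<Phi> \<circ> chart_inverse x)"
    by (auto simp: trivializations_def)
  show "open V" by (rule bundle_chart_open[OF V])
  {
    fix x assume x: "x \<in> V"
    note iso = lie_isoD[OF trivialization_iso[OF V x], simplified]
    show "Vector_Spaces.linear smul smul (\<tau> x)" using iso(2,3) by (simp add: lin_iff \<tau>)
    show "bij (\<tau> x)" using iso(1) by (simp add: \<tau>)
    show "\<tau> x (br u v) = br (\<tau> x u) (\<tau> x v)" for u v using iso(4) by (simp add: \<tau>)
  }
  fix W \<sigma> k assume "(W, \<sigma>) \<in> trivializations"
  then obtain \<Psi> where W: "(W, \<Psi>) \<in> batlas" and \<sigma>: "\<sigma> = (\<lambda>x. \<Psi> \<circ> chart_inverse x)"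
    by (auto simp: trivializations_def)
  show "end_ck smul atlas k (V \<inter> W) (\<lambda>x. \<sigma> x \<circ> inv (\<tau> x))"
  proof (rule end_ck_cong[OF transition_smooth[OF V W]])
    fix x assume "x \<in> V \<inter> W"
    then show "\<sigma> x \<circ> inv (\<tau> x) = transition fib \<Phi> \<Psi> x"
      using trivialization_inv[OF V, of x] by (simp add: \<sigma> \<tau> transition_def o_assoc[symmetric])
  qed
qed

lemma sec_iff: "model.sec k UNIV \<xi> \<longleftrightarrow> (\<forall>(V, \<Phi>)\<in>batlas. vec_ck smul atlas k V (\<lambda>x. \<Phi> (chart_inverse x (\<xi> x))))"
  unfolding model.sec_def by (auto simp: trivializations_def)

definition lift :: "('m \<Rightarrow> 'f) \<Rightarrow> 'm \<Rightarrow> 'l" where "lift \<xi> x = chart_inverse x (\<xi> x)"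
definition lower :: "('m \<Rightarrow> 'l) \<Rightarrow> 'm \<Rightarrow> 'f" where "lower X x = chart_choice x (X x)"

section \<open>Sections of the bundle and fiberwise action of their derivations\<close>

context
  fixes k :: nat
begin

abbreviation "G \<equiv> sections smul atlas fib batlas k"
abbreviation "\<Gamma> \<equiv> lcarrier G"

lemma G_simps:
  "ladd G X Y x = ladd (fib x) (X x) (Y x)" "lscale G c X x = lscale (fib x) c (X x)"
  "lbracket G X Y x = lbracket (fib x) (X x) (Y x)"
  by (simp_all add: sections_def pointwise_def)

lemma G_fiber: "X \<in> \<Gamma> \<Longrightarrow> X x \<in> fiber x"
  by (simp add: sections_def pointwise_def)

lemma lift_sec: "lift \<xi> \<in> \<Gamma> \<longleftrightarrow> model.sec k UNIV \<xi>"
  by (simp add: sections_def pointwise_def sec_iff lift_def chart_inverse_simps)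

lemma lower_lift: "lower (lift \<xi>) = \<xi>"
  by (simp add: lower_def lift_def chart_inverse_simps fun_eq_iff)

lemma lift_lower: "(\<And>x. X x \<in> fiber x) \<Longrightarrow> lift (lower X) = X"
  by (simp add: lower_def lift_def chart_inverse_simps fun_eq_iff)

lemma lower_sec: "(\<And>x. X x \<in> fiber x) \<Longrightarrow> model.sec k UNIV (lower X) \<longleftrightarrow> X \<in> \<Gamma>"
  using lift_sec[of "lower X"] lift_lower[of X] by simp

lemma lift_hom:
  "lift (\<lambda>x. \<xi> x + \<eta> x) = ladd G (lift \<xi>) (lift \<eta>)"
  "lift (\<lambda>x. smul c (\<xi> x)) = lscale G c (lift \<xi>)"
  "lift (\<lambda>x. br (\<xi> x) (\<eta> x)) = lbracket G (lift \<xi>) (lift \<eta>)"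
  by (simp_all add: fun_eq_iff G_simps lift_def chart_inverse_simps)

lemma lower_hom:
  assumes "X \<in> \<Gamma>" "Y \<in> \<Gamma>"
  shows "lower (ladd G X Y) x = lower X x + lower Y x"
    "lower (lscale G c X) x = smul c (lower X x)"
    "lower (lbracket G X Y) x = br (lower X x) (lower Y x)"
  using G_fiber[OF assms(1)] G_fiber[OF assms(2)] by (simp_all add: G_simps lower_def chart_hom)

lemma G_closed: "lie_closed G"
proof -
  have s: "model.sec k UNIV (lower X)" "lift (lower X) = X" if "X \<in> \<Gamma>" for X
    using lower_sec[of X] lift_lower[of X] G_fiber[OF that] that by auto
  have "ladd G X Y \<in> \<Gamma>" "lbracket G X Y \<in> \<Gamma>" "lscale G c X \<in> \<Gamma>" if "X \<in> \<Gamma>" "Y \<in> \<Gamma>" for X Y c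
    using model.sec_add[OF s(1)[OF that(1)] s(1)[OF that(2)]] model.sec_br[OF s(1)[OF that(1)] s(1)[OF that(2)]]
      model.sec_smul[OF manifold_ck_const s(1)[OF that(1)], of c] s(2)[OF that(1)] s(2)[OF that(2)]
    by (simp_all flip: lift_sec add: lift_hom)
  then show ?thesis unfolding lie_closed_def by blast
qed

lemma section_through_point:
  assumes "u \<in> fiber x"
  obtains X where "X \<in> \<Gamma>" "X x = u"
proof -
  obtain \<xi> where "model.sec k UNIV \<xi>" "\<xi> x = chart_choice x u" by (rule model.section_through)
  then have "lift \<xi> \<in> \<Gamma>" "lift \<xi> x = u" using assms by (simp_all add: lift_sec) (simp add: lift_def chart_inverse_simps)
  then show ?thesis by (rule that)
qed

text \<open>The choice of the section is immaterial for \<open>fiberwise\<close> once derivations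
  are known to act pointwise.\<close>

definition through :: "'m \<Rightarrow> 'l \<Rightarrow> 'm \<Rightarrow> 'l" where "through x u = (SOME X. X \<in> \<Gamma> \<and> X x = u)"

lemma through: "u \<in> fiber x \<Longrightarrow> through x u \<in> \<Gamma>" "u \<in> fiber x \<Longrightarrow> through x u x = u"
proof -
  assume "u \<in> fiber x"
  then have "\<exists>X. X \<in> \<Gamma> \<and> X x = u" using section_through_point by metis
  then have "through x u \<in> \<Gamma> \<and> through x u x = u" unfolding through_def by (rule someI_ex)
  then show "through x u \<in> \<Gamma>" "through x u x = u" by auto
qed

definition fiberwise :: "(('m \<Rightarrow> 'l) \<Rightarrow> 'm \<Rightarrow> 'l) \<Rightarrow> 'm \<Rightarrow> 'l \<Rightarrow> 'l"
  where "fiberwise D x = (\<lambda>u\<in>fiber x. D (through x u) x)"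

lemma derivation_carrier: "D \<in> derivations H \<Longrightarrow> X \<in> lcarrier H \<Longrightarrow> D X \<in> lcarrier H"
  by (auto simp: derivations_def)

lemma derivationD:
  assumes "D \<in> derivations H"
  shows "\<And>x y. x \<in> lcarrier H \<Longrightarrow> y \<in> lcarrier H \<Longrightarrow> D (ladd H x y) = ladd H (D x) (D y)"
    "\<And>c x. x \<in> lcarrier H \<Longrightarrow> D (lscale H c x) = lscale H c (D x)"
    "\<And>x y. x \<in> lcarrier H \<Longrightarrow> y \<in> lcarrier H \<Longrightarrow> D (lbracket H x y) = ladd H (lbracket H (D x) y) (lbracket H x (D y))"
  using assms by (auto simp: derivations_def)

context
  assumes pc: "perfect_lie smul br \<or> centerfree_lie br"
begin

text \<open>Conjugation with \<open>lift\<close> and \<open>lower\<close> turns \<open>D\<close>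
  into a derivation in the model, whose value at \<open>x\<close> depends only on the value of the
  section at \<open>x\<close>.\<close>

lemma fiberwise_apply:
  assumes D: "D \<in> derivations G" and X: "X \<in> \<Gamma>"
  shows "fiberwise D x (X x) = D X x"
proof -
  define D' where "D' \<xi> = lower (D (lift \<xi>))" for \<xi>
  have DG: "D Y \<in> \<Gamma>" if "Y \<in> \<Gamma>" for Y using derivation_carrier[OF D that] .
  have cl: "lbracket G Y Z \<in> \<Gamma>" if "Y \<in> \<Gamma>" "Z \<in> \<Gamma>" for Y Z
    using G_closed that by (simp add: lie_closed_def)
  interpret D': section_derivation smul br E atlas trivializations k D'
  proof
    fix \<xi> assume \<xi>: "model.sec k UNIV \<xi>"
    then have L: "lift \<xi> \<in> \<Gamma>" by (simp add: lift_sec)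
    show "model.sec k UNIV (D' \<xi>)"
      using DG[OF L] lower_sec[of "D (lift \<xi>)"] G_fiber[OF DG[OF L]] by (simp add: D'_def)
    show "D' (\<lambda>x. smul c (\<xi> x)) x = smul c (D' \<xi> x)" for c x
      using lower_hom(2)[OF DG[OF L] DG[OF L]] by (simp add: D'_def lift_hom derivationD(2)[OF D L])
    fix \<eta> assume "model.sec k UNIV \<eta>"
    then have L': "lift \<eta> \<in> \<Gamma>" by (simp add: lift_sec)
    show "D' (\<lambda>x. \<xi> x + \<eta> x) x = D' \<xi> x + D' \<eta> x" for x
      using lower_hom(1)[OF DG[OF L] DG[OF L']] by (simp add: D'_def lift_hom derivationD(1)[OF D L L'])
    show "D' (\<lambda>x. br (\<xi> x) (\<eta> x)) x = br (D' \<xi> x) (\<eta> x) + br (\<xi> x) (D' \<eta> x)" for x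
      using lower_hom(1)[OF cl[OF DG[OF L] L'] cl[OF L DG[OF L']]] lower_hom(3)[OF DG[OF L] L'] lower_hom(3)[OF L DG[OF L']]
      by (simp add: D'_def lift_hom derivationD(3)[OF D L L'] lower_lift)
  qed (rule pc)
  have u: "X x \<in> fiber x" by (rule G_fiber[OF X])
  let ?Y = "through x (X x)"
  have Y: "?Y \<in> \<Gamma>" "?Y x = X x" using through[OF u] by auto
  have s: "model.sec k UNIV (lower Z)" "lift (lower Z) = Z" if "Z \<in> \<Gamma>" for Z
    using lower_sec[of Z] lift_lower[of Z] G_fiber[OF that] that by auto
  have "D' (lower ?Y) x = D' (lower X) x"
    by (rule D'.D_pointwise[OF s(1)[OF Y(1)] s(1)[OF X]]) (simp add: lower_def Y(2))
  then have "lower (D ?Y) x = lower (D X) x" by (simp add: D'_def s(2)[OF X] s(2)[OF Y(1)])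
  then have "D ?Y x = D X x"
    using chart_inverse_simps(3)[OF G_fiber[OF DG[OF X]], of x] chart_inverse_simps(3)[OF G_fiber[OF DG[OF Y(1)]], of x]
    by (simp add: lower_def)
  then show ?thesis using u by (simp add: fiberwise_def)
qed

lemma fiberwise_derivation:
  assumes D: "D \<in> derivations G"
  shows "fiberwise D x \<in> derivations (fib x)"
proof -
  have cl: "ladd G Y Z \<in> \<Gamma>" "lbracket G Y Z \<in> \<Gamma>" "lscale G c Y \<in> \<Gamma>" if "Y \<in> \<Gamma>" "Z \<in> \<Gamma>" for Y Z c
    using G_closed that by (simp_all add: lie_closed_def)
  have DG: "D Y \<in> \<Gamma>" if "Y \<in> \<Gamma>" for Y using derivation_carrier[OF D that] .
  note ap = fiberwise_apply[OF D]
  have P: "fiberwise D x \<in> fiber x \<rightarrow>\<^sub>E fiber x"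
    unfolding fiberwise_def using G_fiber[OF DG[OF through(1)]] by auto
  have op: "fiberwise D x (ladd (fib x) u v) = ladd (fib x) (fiberwise D x u) (fiberwise D x v)"
      "fiberwise D x (lscale (fib x) c u) = lscale (fib x) c (fiberwise D x u)"
      "fiberwise D x (lbracket (fib x) u v) =
        ladd (fib x) (lbracket (fib x) (fiberwise D x u) v) (lbracket (fib x) u (fiberwise D x v))"
    if uv: "u \<in> fiber x" "v \<in> fiber x" for u v c
  proof -
    obtain X where X: "X \<in> \<Gamma>" "X x = u" by (rule section_through_point[OF uv(1)])
    obtain Y where Y: "Y \<in> \<Gamma>" "Y x = v" by (rule section_through_point[OF uv(2)])
    show "fiberwise D x (ladd (fib x) u v) = ladd (fib x) (fiberwise D x u) (fiberwise D x v)"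
      using ap[OF cl(1)[OF X(1) Y(1)], of x] ap[OF X(1), of x] ap[OF Y(1), of x] derivationD(1)[OF D X(1) Y(1)]
      by (simp add: G_simps X(2) Y(2))
    show "fiberwise D x (lscale (fib x) c u) = lscale (fib x) c (fiberwise D x u)"
      using ap[OF cl(3)[OF X(1) X(1)], of x c] ap[OF X(1), of x] derivationD(2)[OF D X(1)]
      by (simp add: G_simps X(2))
    show "fiberwise D x (lbracket (fib x) u v) =
        ladd (fib x) (lbracket (fib x) (fiberwise D x u) v) (lbracket (fib x) u (fiberwise D x v))"
      using ap[OF cl(2)[OF X(1) Y(1)], of x] ap[OF X(1), of x] ap[OF Y(1), of x] derivationD(3)[OF D X(1) Y(1)]
      by (simp add: G_simps X(2) Y(2))
  qed
  show ?thesis unfolding derivations_def using P op by blast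
qed

text \<open>The chosen chart cancels, so regularity of an endomorphism field in the model coincides
  with its regularity in the charts of Hom.\<close>

lemma conjugate_chart:
  assumes V: "(V, \<Phi>) \<in> batlas" and x: "x \<in> V" and A: "A \<in> fiber x \<rightarrow> fiber x"
  shows "(\<Phi> \<circ> chart_inverse x) \<circ> (chart_choice x \<circ> A \<circ> chart_inverse x) \<circ> inv (\<Phi> \<circ> chart_inverse x)
    = \<Phi> \<circ> A \<circ> inv_into (fiber x) \<Phi>"
proof
  fix v
  have "chart_inverse x (inv (\<Phi> \<circ> chart_inverse x) v) = inv_into (fiber x) \<Phi> v"
    using trivialization_inv[OF V x] by (metis comp_apply)
  moreover have "inv_into (fiber x) \<Phi> v \<in> fiber x"
    using lie_iso_inv_into(1)[OF bundle_chart_iso[OF V x] fiber_closed] by simp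
  then have "A (inv_into (fiber x) \<Phi> v) \<in> fiber x" using A by blast
  ultimately show "((\<Phi> \<circ> chart_inverse x) \<circ> (chart_choice x \<circ> A \<circ> chart_inverse x) \<circ> inv (\<Phi> \<circ> chart_inverse x)) v
    = (\<Phi> \<circ> A \<circ> inv_into (fiber x) \<Phi>) v"
    by (simp add: chart_inverse_simps)
qed

text \<open>That \<open>D\<close> preserves C^k sections, tested on local frames, gives the
  regularity of the field of fiber derivations.\<close>

lemma fiberwise_der_section:
  assumes D: "D \<in> derivations G"
  shows "fiberwise D \<in> lcarrier (der_sections smul atlas fib batlas k)"
proof -
  define A where "A x = chart_choice x \<circ> fiberwise D x \<circ> chart_inverse x" for x
  have As: "model.sec k UNIV (\<lambda>x. A x (\<xi> x))" if "model.sec k UNIV \<xi>" for \<xi>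
  proof -
    have L: "lift \<xi> \<in> \<Gamma>" using that by (simp add: lift_sec)
    have DL: "D (lift \<xi>) \<in> \<Gamma>" using derivation_carrier[OF D L] .
    have "(\<lambda>x. A x (\<xi> x)) = lower (D (lift \<xi>))"
      using fiberwise_apply[OF D L] by (simp add: fun_eq_iff A_def lower_def lift_def)
    then show ?thesis using lower_sec[of "D (lift \<xi>)"] G_fiber[OF DL] DL by simp
  qed
  have "end_ck smul atlas k V (\<lambda>x. \<Phi> \<circ> fiberwise D x \<circ> inv_into (fiber x) \<Phi>)" if V: "(V, \<Phi>) \<in> batlas" for V \<Phi>
  proof -
    have "(V, \<lambda>x. \<Phi> \<circ> chart_inverse x) \<in> trivializations" using V by (force simp: trivializations_def)
    from model.endomorphism_smooth[OF As this] show ?thesis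
    proof (rule end_ck_cong)
      fix x assume "x \<in> V"
      have "fiberwise D x \<in> fiber x \<rightarrow> fiber x"
        using derivation_carrier[OF fiberwise_derivation[OF D]] by auto
      then show "\<Phi> \<circ> fiberwise D x \<circ> inv_into (fiber x) \<Phi> = (\<Phi> \<circ> chart_inverse x) \<circ> A x \<circ> inv (\<Phi> \<circ> chart_inverse x)"
        unfolding A_def using conjugate_chart[OF V \<open>x \<in> V\<close>] by simp
    qed
  qed
  then show ?thesis
    using fiberwise_derivation[OF D] by (auto simp: der_sections_def pointwise_def Der_def)
qed

text \<open>This supplies the inverse of \<open>fiberwise\<close>. The algebraic identities hold
  pointwise; the substance is that the image of a section is again of class C^k.\<close>

lemma der_section_derivation:
  assumes A: "A \<in> lcarrier (der_sections smul atlas fib batlas k)"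
  shows "(\<lambda>X\<in>\<Gamma>. \<lambda>x. A x (X x)) \<in> derivations G"
proof -
  have Ad: "A x \<in> derivations (fib x)" for x
    using A by (simp add: der_sections_def pointwise_def Der_def)
  have Ac: "A x u \<in> fiber x" if "u \<in> fiber x" for x u using derivation_carrier[OF Ad that] .
  define A' where "A' x = chart_choice x \<circ> A x \<circ> chart_inverse x" for x
  have lin: "lin (A' x)" for x
    using chart_inverse_simps(1)[of x] Ac[of _ x]
    by (simp add: lin_iff A'_def chart_inverse_simps(4,5) derivationD(1,2)[OF Ad] chart_hom)
  have smooth: "end_ck smul atlas k V (\<lambda>x. \<tau> x \<circ> A' x \<circ> inv (\<tau> x))" if "(V, \<tau>) \<in> trivializations" for V \<tau>
  proof -
    obtain \<Phi> where V: "(V, \<Phi>) \<in> batlas" and \<tau>: "\<tau> = (\<lambda>x. \<Phi> \<circ> chart_inverse x)"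
      using \<open>(V, \<tau>) \<in> trivializations\<close> by (auto simp: trivializations_def)
    have "end_ck smul atlas k V (\<lambda>x. \<Phi> \<circ> A x \<circ> inv_into (fiber x) \<Phi>)"
      using A V by (auto simp: der_sections_def pointwise_def)
    then show ?thesis
      by (rule end_ck_cong) (use conjugate_chart[OF V] Ac in \<open>simp add: \<tau> A'_def Pi_def\<close>)
  qed
  have mem: "(\<lambda>x. A x (X x)) \<in> \<Gamma>" if X: "X \<in> \<Gamma>" for X
  proof -
    have f: "A x (X x) \<in> fiber x" for x using Ac[OF G_fiber[OF X]] .
    have "model.sec k UNIV (lower X)" using lower_sec[of X] G_fiber[OF X] X by simp
    then have "model.sec k UNIV (\<lambda>x. A' x (lower X x))"
      using model.endomorphism_section[OF lin smooth] by blast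
    moreover have "(\<lambda>x. A' x (lower X x)) = lower (\<lambda>x. A x (X x))"
      using G_fiber[OF X] by (simp add: fun_eq_iff A'_def lower_def chart_inverse_simps)
    ultimately show ?thesis using lower_sec[OF f] by simp
  qed
  have cl: "ladd G Y Z \<in> \<Gamma>" "lbracket G Y Z \<in> \<Gamma>" "lscale G c Y \<in> \<Gamma>" if "Y \<in> \<Gamma>" "Z \<in> \<Gamma>" for Y Z c
    using G_closed that by (simp_all add: lie_closed_def)
  let ?D = "\<lambda>X\<in>\<Gamma>. \<lambda>x. A x (X x)"
  have "?D \<in> \<Gamma> \<rightarrow>\<^sub>E \<Gamma>" using mem by auto
  moreover have "?D (ladd G X Y) = ladd G (?D X) (?D Y)"
    "?D (lscale G c X) = lscale G c (?D X)"
    "?D (lbracket G X Y) = ladd G (lbracket G (?D X) Y) (lbracket G X (?D Y))"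
    if XY: "X \<in> \<Gamma>" "Y \<in> \<Gamma>" for X Y c
    using cl(1)[OF XY] cl(2)[OF XY] cl(3)[OF XY, of c] XY G_fiber[OF XY(1)] G_fiber[OF XY(2)]
    by (simp_all add: fun_eq_iff G_simps derivationD[OF Ad])
  ultimately show ?thesis unfolding derivations_def by blast
qed

theorem derivations_isomorphic:
  "lie_iso (Der G) (der_sections smul atlas fib batlas k) fiberwise"
proof -
  let ?H = "der_sections smul atlas fib batlas k"
  have car: "lcarrier (Der G) = derivations G" by (simp add: Der_def)
  have H: "ladd ?H A A' = (\<lambda>x. \<lambda>u\<in>fiber x. ladd (fib x) (A x u) (A' x u))"
    "lscale ?H c A = (\<lambda>x. \<lambda>u\<in>fiber x. lscale (fib x) c (A x u))"
    "lbracket ?H A A' = (\<lambda>x. \<lambda>u\<in>fiber x. ladd (fib x) (A x (A' x u)) (lscale (fib x) (- 1) (A' x (A x u))))" for A A' c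
    by (simp_all add: der_sections_def pointwise_def Der_def)
  have bij: "bij_betw fiberwise (derivations G) (lcarrier ?H)"
    unfolding bij_betw_def
  proof
    show "inj_on fiberwise (derivations G)"
    proof (rule inj_onI)
      fix D D' assume D: "D \<in> derivations G" "D' \<in> derivations G" and eq: "fiberwise D = fiberwise D'"
      have "D X = D' X" if "X \<in> \<Gamma>" for X
        using fiberwise_apply[OF D(1) that] fiberwise_apply[OF D(2) that] eq by (simp add: fun_eq_iff)
      moreover have "D \<in> \<Gamma> \<rightarrow>\<^sub>E \<Gamma>" "D' \<in> \<Gamma> \<rightarrow>\<^sub>E \<Gamma>" using D by (simp_all add: derivations_def)
      ultimately show "D = D'" by (auto intro: PiE_ext)
    qed
    show "fiberwise ` derivations G = lcarrier ?H"
    proof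
      show "fiberwise ` derivations G \<subseteq> lcarrier ?H" using fiberwise_der_section by blast
      show "lcarrier ?H \<subseteq> fiberwise ` derivations G"
      proof
        fix A assume A: "A \<in> lcarrier ?H"
        let ?D = "\<lambda>X\<in>\<Gamma>. \<lambda>x. A x (X x)"
        have "fiberwise ?D x u = A x u" for x u
        proof (cases "u \<in> fiber x")
          case True
          then show ?thesis using through[OF True] by (simp add: fiberwise_def)
        next
          case False
          \<comment> \<open>Off the fiber both sides have the default value
            \<open>undefined\<close>, since fiber derivations are extensional.\<close>
          have "A x \<in> fiber x \<rightarrow>\<^sub>E fiber x"
            using A by (simp add: der_sections_def pointwise_def Der_def derivations_def)
          from PiE_arb[OF this False] show ?thesis using False by (simp add: fiberwise_def)
        qed
        then have "A = fiberwise ?D" by (simp add: fun_eq_iff)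
        then show "A \<in> fiberwise ` derivations G" using der_section_derivation[OF A] by blast
      qed
    qed
  qed
  have "fiberwise (ladd (Der G) D D') = ladd ?H (fiberwise D) (fiberwise D')"
    if "D \<in> derivations G" "D' \<in> derivations G" for D D'
    unfolding H using through(1) by (auto simp: fun_eq_iff fiberwise_def Der_def G_simps restrict_def)
  moreover have "fiberwise (lscale (Der G) c D) = lscale ?H c (fiberwise D)" if "D \<in> derivations G" for c D
    unfolding H using through(1) by (auto simp: fun_eq_iff fiberwise_def Der_def G_simps restrict_def)
  moreover have "fiberwise (lbracket (Der G) D D') = lbracket ?H (fiberwise D) (fiberwise D')"
    if D: "D \<in> derivations G" "D' \<in> derivations G" for D D'
  proof (intro ext)
    fix x u
    show "fiberwise (lbracket (Der G) D D') x u = lbracket ?H (fiberwise D) (fiberwise D') x u"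
    proof (cases "u \<in> fiber x")
      case True
      let ?X = "through x u"
      have X: "?X \<in> \<Gamma>" "?X x = u" using through[OF True] by auto
      \<comment> \<open>The section \<open>D' ?X\<close> has the value
        \<open>fiberwise D' x u\<close> at \<open>x\<close>, so it may stand in for the section
        chosen by \<open>through\<close>.\<close>
      have "fiberwise D x (fiberwise D' x u) = D (D' ?X) x"
        using fiberwise_apply[OF D(1) derivation_carrier[OF D(2) X(1)], of x] fiberwise_apply[OF D(2) X(1), of x] X(2) by simp
      moreover have "fiberwise D' x (fiberwise D x u) = D' (D ?X) x"
        using fiberwise_apply[OF D(2) derivation_carrier[OF D(1) X(1)], of x] fiberwise_apply[OF D(1) X(1), of x] X(2) by simp
      moreover have "fiberwise (lbracket (Der G) D D') x u = lbracket (Der G) D D' ?X x"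
        using True by (simp add: fiberwise_def)
      ultimately show ?thesis
        unfolding H using True X(1) by (simp add: Der_def G_simps)
    qed (simp add: H fiberwise_def)
  qed
  ultimately show ?thesis
    unfolding lie_iso_def car using bij by blast
qed

end

end

end

theorem theorem2p74:
  fixes smul :: "'k::real_normed_field \<Rightarrow> 'f::ab_group_add \<Rightarrow> 'f"
    and br :: "'f \<Rightarrow> 'f \<Rightarrow> 'f"
    and E :: "'e::euclidean_space set"
    and atlas :: "('m::t2_space set \<times> ('m \<Rightarrow> 'e)) set"
    and proj :: "'l \<Rightarrow> 'm"
    and fib :: "'m \<Rightarrow> ('k, 'l) lie_struct"
    and batlas :: "('m set \<times> ('l \<Rightarrow> 'f)) set"
    and k :: nat
  assumes "lie_algebra_bundle smul br E atlas proj fib batlas"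
    and "perfect_lie smul br \<or> centerfree_lie br"
  shows "lie_isomorphic (Der (sections smul atlas fib batlas k)) (der_sections smul atlas fib batlas k)"
proof -
  interpret lie_algebra_bundle smul br E atlas proj fib batlas by (rule assms(1))
  show ?thesis unfolding lie_isomorphic_def using derivations_isomorphic[OF assms(2)] by blast
qed

end
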